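(* Assume $\mathbb E[a_1]=0$, $\mathbb E[a_1^2]=1$ and $\mathbb E[a_1^4]<\infty$, and let $X$ be uniform on $[0,2\pi]$. Set \[ C(a_1):=81\sqrt{13+|\mathbb E[a_1^3]|}+8\sqrt{\mathbb E[a_1^4]}+\sqrt 2+8\,\mathbb E[|a_1|^3]+24\,\mathbb E[|a_1|]. \] If $G$ is $\sigma(X)$-measurable and $G\sim\mathcal N(0,1)$ under $\mathbb P_X$, then for every $n\ge1$, \[ \mathbb E\big[d^X_{\mathcal C^3}(f_n(X),G)\big]\le \frac{C(a_1)}{\sqrt n}. \]
   Context: On a probability space $(\Omega,\mathcal F,\mathbb P)$ let $(a_k)_{k\ge1}$ and $(b_k)_{k\ge1}$ be random variables such that all the $a_k,b_k$ are mutually independent with the common distribution of $a_1$. For $n\ge1$ and $t\in\mathbb R$ let $f_n(t)=\frac{1}{\sqrt n}\sum_{k=1}^n \big(a_k\cos(kt)+b_k\sin(kt)\big)$. The random variable $X$ with values in $[0,2\pi]$ is independent of all the coefficients; concretely one works on $\Omega\times[0,2\pi]$ with $\mathbb P\otimes\mathbb P_X$, $X$ being the identity on $[0,2\pi]$. $\mathbb E$ denotes expectation with respect to $\mathbb P$ and $\mathbb E_X,\mathbb P_X$ expectation/probability with respect to $X$ only (coefficients fixed). For $U,V$ measurable w.r.t. $\mathcal F\otimes\mathcal B([0,2\pi])$, $d^X_{\mathcal C^3}(U,V):=\sup\{\mathbb E_X[\phi(U)-\phi(V)]:\ \phi\in\mathcal C^3(\mathbb R),\ \|\phi^{(k)}\|_\infty\le1,\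 0\le k\le3\}$, an $\mathcal F$-measurable random variable. *)

theory Defs
  imports "HOL-Probability.Probability"
begin

definition C3_test :: "(real \<Rightarrow> real) set" where
  "C3_test = {\<phi>. (\<forall>k<3. \<forall>x. (deriv ^^ k) \<phi> differentiable (at x))
                 \<and> continuous_on UNIV ((deriv ^^ 3) \<phi>)
                 \<and> (\<forall>k\<le>3. \<forall>x. \<bar>(deriv ^^ k) \<phi> x\<bar> \<le> 1)}"

definition PX :: "real measure" where
  "PX = uniform_measure lborel {0..2*pi}"

text \<open>d^X_{C^3}(U,V) for fixed coefficients, U and V given as functions of x in [0,2pi].\<close>
definition dC3X :: "(real \<Rightarrow> real) \<Rightarrow> (real \<Rightarrow> real) \<Rightarrow> real" where
  "dC3X U V = (SUP \<phi>\<in>C3_test. (\<integral>x. \<phi> (U x) \<partial>PX) - (\<integral>x. \<phi> (V x) \<partial>PX))"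

definition fn :: "(nat \<Rightarrow> 'w \<Rightarrow> real) \<Rightarrow> (nat \<Rightarrow> 'w \<Rightarrow> real) \<Rightarrow> nat \<Rightarrow> 'w \<Rightarrow> real \<Rightarrow> real" where
  "fn a b n w t = (1 / sqrt (real n)) * (\<Sum>k=1..n. a k w * cos (real k * t) + b k w * sin (real k * t))"

definition coeffs :: "(nat \<Rightarrow> 'w \<Rightarrow> real) \<Rightarrow> (nat \<Rightarrow> 'w \<Rightarrow> real) \<Rightarrow> nat + nat \<Rightarrow> 'w \<Rightarrow> real" where
  "coeffs a b i = (case i of Inl k \<Rightarrow> a k | Inr k \<Rightarrow> b k)"

end

theory Submission
  imports Defs "HOL-Real_Asymp.Real_Asymp"
begin

text \<open>The distance splits into a bias, uniform over the test functions, and a fluctuation. For fixed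
  \<open>x\<close> the value \<open>f\<^sub>n(x)\<close> is a normalised sum of independent variables, so Lindeberg's replacement
  argument bounds the bias by \<open>O(1/\<surd>n)\<close>.

  For the fluctuation, every test function is a superposition of translates of one kernel:
  \<open>\<phi>(x) = \<integral> K(x - y) (L\<phi>)(y) dy\<close> with \<open>L = (1 - D)(1 + D)\<^sup>2\<close>, \<open>D = d/dx\<close>, and \<open>|L\<phi>| \<le> 4\<close>. Hence the supremum
  over \<open>\<phi>\<close> is at most \<open>4 \<integral> |Z\<^sub>y - E Z\<^sub>y| dy\<close> with \<open>Z\<^sub>y = E\<^sub>X K(f\<^sub>n(X) - y)\<close>, and it suffices to bound
  \<open>\<integral> (1 + y\<^sup>2) Var(Z\<^sub>y) dy\<close> by \<open>O(1/n)\<close>. By the Efron-Stein inequality this reduces to the effect of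
  setting one coefficient to zero. To first order that effect is \<open>1/\<surd>n\<close> times a Fourier coefficient of
  \<open>K'(f\<^sub>n - y)\<close>, and Bessel's inequality sums the squares of all of these; the second-order Taylor
  remainder is of order \<open>1/n\<close> per coefficient and costs only a fourth moment.\<close>

section \<open>The kernel\<close>

text \<open>The supremum over test functions stands inside the expectation. The representation
  removes it because \<open>\<phi>\<close> enters only through the bounded factor
  \<open>ker_op \<phi>\<close>, so that one random variable \<open>T\<close> serves all test
  functions. The order of the operator equals the number of bounded derivatives. The weight 1 + y^2
  pays for passing from L1 to L2 in y, since its reciprocal has integral pi.

  The obstacle is the first-order term. Expanding around \<open>w(i := 0)\<close> makes
  \<open>w i\<close> independent of the Fourier coefficient that it multiplies, so that only
  E[(w i)^2] = 1 enters there. Bessel's inequality, however, sums the Fourier coefficients of a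
  single function, whereas the functions at \<open>w(i := 0)\<close> differ from one i to the next.
  Each coefficient is therefore moved back to the common \<open>w\<close>. The squared error of that
  move is of order 1/n; with the factor 1/n in front, the 2n errors still add up to order 1/n.

  The weight also forces estimates for z times the increments of the kernel. They are arranged so
  that no power of the increment higher than for the unweighted ones appears; otherwise moments
  beyond the fourth would be needed.\<close>

text \<open>The Green function of \<open>(1 - D)(1 + D)\<^sup>2\<close> together with its first two derivatives (the second
  one jumps at 0).\<close>

definition ker :: "real \<Rightarrow> real" where
  "ker z = (if z \<le> 0 then exp z / 4 else (1/4 + z/2) * exp (-z))"

definition ker1 :: "real \<Rightarrow> real" where
  "ker1 z = (if z \<le> 0 then exp z / 4 else (1/4 - z/2) * exp (-z))"

definition ker2 :: "real \<Rightarrow> real" where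
  "ker2 z = (if z \<le> 0 then exp z / 4 else (z/2 - 3/4) * exp (-z))"

lemma ker_measurable [measurable]: "ker \<in> borel_measurable borel"
  unfolding ker_def by measurable

lemma ker1_measurable [measurable]: "ker1 \<in> borel_measurable borel"
  unfolding ker1_def by measurable

lemma ker2_measurable [measurable]: "ker2 \<in> borel_measurable borel"
  unfolding ker2_def by measurable

text \<open>Both sides of 1 + z <= e^z enter: the affine factor is at most 1 + z. This covers the
  right half of the kernel and of its two derivatives at once.\<close>

lemma affine_exp_le_1:
  assumes "z \<ge> (0::real)" "\<bar>c\<bar> \<le> 1" "\<bar>d\<bar> \<le> 1"
  shows "\<bar>(c + d * z) * exp (-z)\<bar> \<le> 1"
proof -
  have "\<bar>c + d * z\<bar> \<le> \<bar>c\<bar> + \<bar>d\<bar> * z"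
    using assms(1) abs_triangle_ineq[of c "d * z"] by (simp add: abs_mult)
  also have "\<dots> \<le> 1 + z" using assms mult_right_mono[of "\<bar>d\<bar>" 1 z] by simp
  also have "\<dots> \<le> exp z" by simp
  finally have "\<bar>c + d * z\<bar> * exp (-z) \<le> exp z * exp (-z)" by (rule mult_right_mono) simp
  then show ?thesis by (simp add: abs_mult flip: exp_add)
qed

lemma abs_ker_le: "\<bar>ker z\<bar> \<le> 1"
  using affine_exp_le_1[of z "1/4" "1/2"] exp_le_one_iff[of z] unfolding ker_def by (auto simp del: exp_le_one_iff)

lemma abs_ker1_le: "\<bar>ker1 z\<bar> \<le> 1"
  using affine_exp_le_1[of z "1/4" "-1/2"] exp_le_one_iff[of z] unfolding ker1_def by (auto simp del: exp_le_one_iff)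

lemma abs_ker2_le: "\<bar>ker2 z\<bar> \<le> 1"
  using affine_exp_le_1[of z "-3/4" "1/2"] exp_le_one_iff[of z] unfolding ker2_def by (auto simp del: exp_le_one_iff)

lemma ker_nonneg: "ker z \<ge> 0"
  unfolding ker_def by auto

lemma continuous_on_ker [continuous_intros]: "continuous_on A ker"
proof -
  have "continuous_on ({..0} \<union> {0..}) ker"
    unfolding ker_def by (intro continuous_on_cases continuous_intros) auto
  then show ?thesis by (rule continuous_on_subset) auto
qed

lemma continuous_on_ker1 [continuous_intros]: "continuous_on A ker1"
proof -
  have "continuous_on ({..0} \<union> {0..}) ker1"
    unfolding ker1_def by (intro continuous_on_cases continuous_intros) auto
  then show ?thesis by (rule continuous_on_subset) auto
qed

lemma DERIV_ker:
  assumes "z \<noteq> 0" shows "(ker has_real_derivative ker1 z) (at z)"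
proof (cases "z < 0")
  case True
  have "((\<lambda>z. exp z / 4) has_real_derivative ker1 z) (at z)"
    using True by (auto intro!: derivative_eq_intros simp: ker1_def)
  then show ?thesis
    by (rule has_field_derivative_transform_within_open[of _ _ _ "{..<0}"]) (use True in \<open>auto simp: ker_def\<close>)
next
  case False
  have "((\<lambda>z. (1/4 + z/2) * exp (-z)) has_real_derivative ker1 z) (at z)"
    using False assms by (auto intro!: derivative_eq_intros simp: ker1_def field_simps)
  then show ?thesis
    by (rule has_field_derivative_transform_within_open[of _ _ _ "{0<..}"]) (use False assms in \<open>auto simp: ker_def\<close>)
qed

lemma DERIV_ker1:
  assumes "z \<noteq> 0" shows "(ker1 has_real_derivative ker2 z) (at z)"
proof (cases "z < 0")
  case True
  have "((\<lambda>z. exp z / 4) has_real_derivative ker2 z) (at z)"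
    using True by (auto intro!: derivative_eq_intros simp: ker2_def)
  then show ?thesis
    by (rule has_field_derivative_transform_within_open[of _ _ _ "{..<0}"]) (use True in \<open>auto simp: ker1_def\<close>)
next
  case False
  have "((\<lambda>z. (1/4 - z/2) * exp (-z)) has_real_derivative ker2 z) (at z)"
    using False assms by (auto intro!: derivative_eq_intros simp: ker2_def field_simps)
  then show ?thesis
    by (rule has_field_derivative_transform_within_open[of _ _ _ "{0<..}"]) (use False assms in \<open>auto simp: ker1_def\<close>)
qed

section \<open>Weighted L2 norms of the derivatives of the kernel\<close>

lemma nn_integral_real_split:
  fixes f :: "real \<Rightarrow> real"
  assumes f: "f \<in> borel_measurable borel"
    and pos: "\<And>x. 0 < x \<Longrightarrow> f x = p x" "p \<in> borel_measurable borel"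
      "\<And>x. 0 \<le> x \<Longrightarrow> DERIV P x :> p x" "\<And>x. 0 \<le> x \<Longrightarrow> 0 \<le> p x" "(P \<longlongrightarrow> 0) at_top"
    and neg: "\<And>x. 0 < x \<Longrightarrow> f (-x) = q x" "q \<in> borel_measurable borel"
      "\<And>x. 0 \<le> x \<Longrightarrow> DERIV Q x :> q x" "\<And>x. 0 \<le> x \<Longrightarrow> 0 \<le> q x" "(Q \<longlongrightarrow> 0) at_top"
    and c: "- P 0 - Q 0 = c" "P 0 \<le> 0" "Q 0 \<le> 0"
  shows "(\<integral>\<^sup>+x. ennreal (f x) \<partial>lborel) = ennreal c"
proof -
  note [measurable] = f pos(2) neg(2)
  have "(\<integral>\<^sup>+x. ennreal (f x) \<partial>lborel) = (\<integral>\<^sup>+x. ennreal (f x) * indicator {0..} x + ennreal (f x) * indicator {..<0} x \<partial>lborel)"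
    by (intro nn_integral_cong) (auto split: split_indicator)
  also have "\<dots> = (\<integral>\<^sup>+x. ennreal (f x) * indicator {0..} x \<partial>lborel) + (\<integral>\<^sup>+x. ennreal (f x) * indicator {..<0} x \<partial>lborel)"
    by (intro nn_integral_add) auto
  also have "(\<integral>\<^sup>+x. ennreal (f x) * indicator {0..} x \<partial>lborel) = (\<integral>\<^sup>+x. ennreal (p x) * indicator {0..} x \<partial>lborel)"
    by (intro nn_integral_cong_AE AE_I[where N="{0}"]) (auto simp: pos(1) indicator_def not_le order.order_iff_strict)
  also have "\<dots> = ennreal (0 - P 0)" by (intro nn_integral_FTC_atLeast pos)
  also have "(\<integral>\<^sup>+x. ennreal (f x) * indicator {..<0} x \<partial>lborel) = (\<integral>\<^sup>+x. ennreal (f (-x)) * indicator {..<0} (-x) \<partial>lborel)"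
    by (subst nn_integral_real_affine[of _ "-1" 0]) auto
  also have "\<dots> = (\<integral>\<^sup>+x. ennreal (q x) * indicator {0..} x \<partial>lborel)"
    by (intro nn_integral_cong_AE AE_I[where N="{0}"]) (auto simp: neg(1) indicator_def not_le order.order_iff_strict)
  also have "\<dots> = ennreal (0 - Q 0)" by (intro nn_integral_FTC_atLeast neg)
  finally show ?thesis using c by (simp flip: ennreal_plus)
qed

text \<open>A single template for the antiderivatives of the four norms below; the coefficients
  there come from comparing coefficients of the polynomial factor.\<close>

lemma DERIV_quartic_exp:
  "((\<lambda>x::real. - (a * x^4 + b * x^3 + c * x^2 + d * x + g) * exp (-2*x)) has_real_derivative
     (2 * a * x^4 + (2 * b - 4 * a) * x^3 + (2 * c - 3 * b) * x^2 + (2 * d - 2 * c) * x + (2 * g - d)) * exp (-2*x)) (at x)"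
  by (rule refl derivative_eq_intros)+ (simp add: algebra_simps)

lemma nn_integral_ker1_sq: "(\<integral>\<^sup>+z. ennreal ((ker1 z)\<^sup>2) \<partial>lborel) = ennreal (1/16)"
proof (rule nn_integral_real_split[where p="\<lambda>x. (1/4 - x/2)\<^sup>2 * exp (-2*x)" and q="\<lambda>x. exp (-2*x)/16"
      and P="\<lambda>x. - (0 * x^4 + 0 * x^3 + 1/8 * x^2 + 0 * x + 1/32) * exp (-2*x)"
      and Q="\<lambda>x. - (0 * x^4 + 0 * x^3 + 0 * x^2 + 0 * x + 1/32) * exp (-2*x)"])
  show "((\<lambda>x::real. - (0 * x^4 + 0 * x^3 + 1/8 * x^2 + 0 * x + 1/32) * exp (-2*x)) \<longlongrightarrow> 0) at_top" by real_asymp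
  show "((\<lambda>x::real. - (0 * x^4 + 0 * x^3 + 0 * x^2 + 0 * x + 1/32) * exp (-2*x)) \<longlongrightarrow> 0) at_top" by real_asymp
  show "((\<lambda>x::real. - (0 * x^4 + 0 * x^3 + 1/8 * x^2 + 0 * x + 1/32) * exp (-2*x)) has_real_derivative (1/4 - x/2)\<^sup>2 * exp (-2*x)) (at x)" for x
    by (rule DERIV_cong[OF DERIV_quartic_exp]) (simp add: field_simps power2_eq_square power3_eq_cube power4_eq_xxxx)
  show "((\<lambda>x::real. - (0 * x^4 + 0 * x^3 + 0 * x^2 + 0 * x + 1/32) * exp (-2*x)) has_real_derivative exp (-2*x)/16) (at x)" for x
    by (rule DERIV_cong[OF DERIV_quartic_exp]) (simp add: field_simps power2_eq_square power3_eq_cube power4_eq_xxxx)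
qed (simp_all add: ker1_def power_mult_distrib power_divide flip: exp_double)

lemma nn_integral_id_ker1_sq: "(\<integral>\<^sup>+z. ennreal ((z * ker1 z)\<^sup>2) \<partial>lborel) = ennreal (1/8)"
proof (rule nn_integral_real_split[where p="\<lambda>x. (x * (1/4 - x/2))\<^sup>2 * exp (-2*x)" and q="\<lambda>x. x^2 * exp (-2*x)/16"
      and P="\<lambda>x. - (1/8 * x^4 + 1/8 * x^3 + 7/32 * x^2 + 7/32 * x + 7/64) * exp (-2*x)"
      and Q="\<lambda>x. - (0 * x^4 + 0 * x^3 + 1/32 * x^2 + 1/32 * x + 1/64) * exp (-2*x)"])
  show "((\<lambda>x::real. - (1/8 * x^4 + 1/8 * x^3 + 7/32 * x^2 + 7/32 * x + 7/64) * exp (-2*x)) \<longlongrightarrow> 0) at_top" by real_asymp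
  show "((\<lambda>x::real. - (0 * x^4 + 0 * x^3 + 1/32 * x^2 + 1/32 * x + 1/64) * exp (-2*x)) \<longlongrightarrow> 0) at_top" by real_asymp
  show "((\<lambda>x::real. - (1/8 * x^4 + 1/8 * x^3 + 7/32 * x^2 + 7/32 * x + 7/64) * exp (-2*x)) has_real_derivative (x * (1/4 - x/2))\<^sup>2 * exp (-2*x)) (at x)" for x
    by (rule DERIV_cong[OF DERIV_quartic_exp]) (simp add: field_simps power2_eq_square power3_eq_cube power4_eq_xxxx)
  show "((\<lambda>x::real. - (0 * x^4 + 0 * x^3 + 1/32 * x^2 + 1/32 * x + 1/64) * exp (-2*x)) has_real_derivative x^2 * exp (-2*x)/16) (at x)" for x
    by (rule DERIV_cong[OF DERIV_quartic_exp]) (simp add: field_simps power2_eq_square power3_eq_cube power4_eq_xxxx)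
qed (simp_all add: ker1_def power_mult_distrib power_divide flip: exp_double)

lemma nn_integral_ker2_sq: "(\<integral>\<^sup>+z. ennreal ((ker2 z)\<^sup>2) \<partial>lborel) = ennreal (3/16)"
proof (rule nn_integral_real_split[where p="\<lambda>x. (x/2 - 3/4)\<^sup>2 * exp (-2*x)" and q="\<lambda>x. exp (-2*x)/16"
      and P="\<lambda>x. - (0 * x^4 + 0 * x^3 + 1/8 * x^2 + ((-1/4)) * x + 5/32) * exp (-2*x)"
      and Q="\<lambda>x. - (0 * x^4 + 0 * x^3 + 0 * x^2 + 0 * x + 1/32) * exp (-2*x)"])
  show "((\<lambda>x::real. - (0 * x^4 + 0 * x^3 + 1/8 * x^2 + ((-1/4)) * x + 5/32) * exp (-2*x)) \<longlongrightarrow> 0) at_top" by real_asymp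
  show "((\<lambda>x::real. - (0 * x^4 + 0 * x^3 + 0 * x^2 + 0 * x + 1/32) * exp (-2*x)) \<longlongrightarrow> 0) at_top" by real_asymp
  show "((\<lambda>x::real. - (0 * x^4 + 0 * x^3 + 1/8 * x^2 + ((-1/4)) * x + 5/32) * exp (-2*x)) has_real_derivative (x/2 - 3/4)\<^sup>2 * exp (-2*x)) (at x)" for x
    by (rule DERIV_cong[OF DERIV_quartic_exp]) (simp add: field_simps power2_eq_square power3_eq_cube power4_eq_xxxx)
  show "((\<lambda>x::real. - (0 * x^4 + 0 * x^3 + 0 * x^2 + 0 * x + 1/32) * exp (-2*x)) has_real_derivative exp (-2*x)/16) (at x)" for x
    by (rule DERIV_cong[OF DERIV_quartic_exp]) (simp add: field_simps power2_eq_square power3_eq_cube power4_eq_xxxx)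
qed (simp_all add: ker2_def power_mult_distrib power_divide flip: exp_double)

lemma nn_integral_id_ker2_sq: "(\<integral>\<^sup>+z. ennreal ((z * ker2 z)\<^sup>2) \<partial>lborel) = ennreal (1/16)"
proof (rule nn_integral_real_split[where p="\<lambda>x. (x * (x/2 - 3/4))\<^sup>2 * exp (-2*x)" and q="\<lambda>x. x^2 * exp (-2*x)/16"
      and P="\<lambda>x. - (1/8 * x^4 + ((-1/8)) * x^3 + 3/32 * x^2 + 3/32 * x + 3/64) * exp (-2*x)"
      and Q="\<lambda>x. - (0 * x^4 + 0 * x^3 + 1/32 * x^2 + 1/32 * x + 1/64) * exp (-2*x)"])
  show "((\<lambda>x::real. - (1/8 * x^4 + ((-1/8)) * x^3 + 3/32 * x^2 + 3/32 * x + 3/64) * exp (-2*x)) \<longlongrightarrow> 0) at_top" by real_asymp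
  show "((\<lambda>x::real. - (0 * x^4 + 0 * x^3 + 1/32 * x^2 + 1/32 * x + 1/64) * exp (-2*x)) \<longlongrightarrow> 0) at_top" by real_asymp
  show "((\<lambda>x::real. - (1/8 * x^4 + ((-1/8)) * x^3 + 3/32 * x^2 + 3/32 * x + 3/64) * exp (-2*x)) has_real_derivative (x * (x/2 - 3/4))\<^sup>2 * exp (-2*x)) (at x)" for x
    by (rule DERIV_cong[OF DERIV_quartic_exp]) (simp add: field_simps power2_eq_square power3_eq_cube power4_eq_xxxx)
  show "((\<lambda>x::real. - (0 * x^4 + 0 * x^3 + 1/32 * x^2 + 1/32 * x + 1/64) * exp (-2*x)) has_real_derivative x^2 * exp (-2*x)/16) (at x)" for x
    by (rule DERIV_cong[OF DERIV_quartic_exp]) (simp add: field_simps power2_eq_square power3_eq_cube power4_eq_xxxx)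
qed (simp_all add: ker2_def power_mult_distrib power_divide flip: exp_double)

text \<open>Cauchy-Schwarz on an interval of length one, read off from the nonnegativity of the
  integral of (\<open>\<phi>\<close> - F)^2. The bound \<open>B\<close> supplies
  integrability.\<close>

lemma sq_integral_le:
  fixes \<phi> :: "real \<Rightarrow> real"
  assumes F: "(\<phi> has_integral F) {0..1}" and [measurable]: "\<phi> \<in> borel_measurable borel"
    and B: "\<And>s. s \<in> {0..1} \<Longrightarrow> \<bar>\<phi> s\<bar> \<le> B"
  shows "ennreal (F\<^sup>2) \<le> (\<integral>\<^sup>+s. ennreal ((\<phi> s)\<^sup>2) * indicator {0..1} s \<partial>lborel)"
proof -
  have B2: "(\<phi> s)\<^sup>2 \<le> B\<^sup>2" if "s \<in> {0..1}" for s
    using power_mono[OF B[OF that], of 2] by simp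
  have i1: "integrable lborel (\<lambda>s. indicator {0..1} s *\<^sub>R \<phi> s)"
    by (rule integrableI_bounded_set[where A="{0..1}" and B=B]) (use B in \<open>auto simp: indicator_def\<close>)
  have i2: "integrable lborel (\<lambda>s. indicator {0..1} s *\<^sub>R (\<phi> s)\<^sup>2)"
    by (rule integrableI_bounded_set[where A="{0..1}" and B="B\<^sup>2"]) (use B2 in \<open>auto simp: indicator_def\<close>)
  have i0: "integrable lborel (\<lambda>s. indicator {0..1::real} s *\<^sub>R (1::real))"
    by (rule integrableI_bounded_set[where A="{0..1}" and B=1]) (auto simp: indicator_def)
  have e1: "(\<integral>s. indicator {0..1} s *\<^sub>R \<phi> s \<partial>lborel) = F"
    using set_borel_integral_eq_integral(2)[of "{0..1}" \<phi>] i1 F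
    by (simp add: set_integrable_def set_lebesgue_integral_def integral_unique)
  have e0: "(\<integral>s. indicator {0..1::real} s *\<^sub>R (1::real) \<partial>lborel) = 1"
    by simp
  have lin: "(\<integral>s. u s - 2 * F * v s + F\<^sup>2 * w s \<partial>lborel) = (\<integral>s. u s \<partial>lborel) - 2 * F * (\<integral>s. v s \<partial>lborel) + F\<^sup>2 * (\<integral>s. w s \<partial>lborel)"
    if "integrable lborel u" "integrable lborel v" "integrable lborel w" for u v w :: "real \<Rightarrow> real"
    using that by simp
  have "0 \<le> (\<integral>s. indicator {0..1} s *\<^sub>R (\<phi> s - F)\<^sup>2 \<partial>lborel)"
    by (rule integral_nonneg_AE) auto
  also have "\<dots> = (\<integral>s. indicator {0..1} s *\<^sub>R (\<phi> s)\<^sup>2 - 2 * F * (indicator {0..1} s *\<^sub>R \<phi> s)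
      + F\<^sup>2 * (indicator {0..1} s *\<^sub>R 1) \<partial>lborel)"
    by (intro Bochner_Integration.integral_cong) (auto simp: indicator_def power2_diff)
  also have "\<dots> = (\<integral>s. indicator {0..1} s *\<^sub>R (\<phi> s)\<^sup>2 \<partial>lborel) - 2 * F * F + F\<^sup>2"
    unfolding lin[OF i2 i1 i0] e1 e0 by simp
  finally have "F\<^sup>2 \<le> (\<integral>s. indicator {0..1} s *\<^sub>R (\<phi> s)\<^sup>2 \<partial>lborel)"
    by (simp add: power2_eq_square)
  then have "ennreal (F\<^sup>2) \<le> ennreal (\<integral>s. indicator {0..1} s *\<^sub>R (\<phi> s)\<^sup>2 \<partial>lborel)"
    by (rule ennreal_leI)
  also have "\<dots> = (\<integral>\<^sup>+s. ennreal (indicator {0..1} s *\<^sub>R (\<phi> s)\<^sup>2) \<partial>lborel)"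
    by (rule nn_integral_eq_integral[symmetric]) (use i2 in auto)
  also have "\<dots> = (\<integral>\<^sup>+s. ennreal ((\<phi> s)\<^sup>2) * indicator {0..1} s \<partial>lborel)"
    by (intro nn_integral_cong) (auto simp: indicator_def)
  finally show ?thesis .
qed

text \<open>Cauchy-Schwarz in s for each fixed z, then Tonelli. The bound \<open>B\<close> may grow
  with z because it only secures integrability of each slice; the quantitative input is
  \<open>C\<close>.\<close>

lemma nn_integral_sq_le_of_integral_repr:
  fixes \<Phi> :: "real \<Rightarrow> real \<Rightarrow> real"
  assumes F: "\<And>z. ((\<lambda>s. \<Phi> s z) has_integral F z) {0..1}"
    and [measurable]: "(\<lambda>(s,z). \<Phi> s z) \<in> borel_measurable (borel \<Otimes>\<^sub>M borel)"
    and B: "\<And>z s. s \<in> {0..1} \<Longrightarrow> \<bar>\<Phi> s z\<bar> \<le> B z"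
    and C: "\<And>s. s \<in> {0..1} \<Longrightarrow> (\<integral>\<^sup>+z. ennreal ((\<Phi> s z)\<^sup>2) \<partial>lborel) \<le> ennreal (C s)"
    and c: "(C has_integral c) {0..1}" and C0: "\<And>s. s \<in> {0..1} \<Longrightarrow> 0 \<le> C s"
  shows "(\<integral>\<^sup>+z. ennreal ((F z)\<^sup>2) \<partial>lborel) \<le> ennreal c"
proof -
  have "(\<integral>\<^sup>+z. ennreal ((F z)\<^sup>2) \<partial>lborel) \<le> (\<integral>\<^sup>+z. (\<integral>\<^sup>+s. ennreal ((\<Phi> s z)\<^sup>2) * indicator {0..1} s \<partial>lborel) \<partial>lborel)"
    by (intro nn_integral_mono sq_integral_le[OF F _ B]) (auto)
  also have "\<dots> = (\<integral>\<^sup>+s. (\<integral>\<^sup>+z. ennreal ((\<Phi> s z)\<^sup>2) * indicator {0..1} s \<partial>lborel) \<partial>lborel)"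
    by (rule lborel_pair.Fubini') measurable
  also have "\<dots> \<le> (\<integral>\<^sup>+s. ennreal (indicator {0..1} s * C s) \<partial>lborel)"
    by (intro nn_integral_mono) (use C in \<open>auto simp: indicator_def nn_integral_multc\<close>)
  also have "\<dots> = ennreal c"
    by (rule nn_integral_has_integral_lebesgue[OF C0 c])
  finally show ?thesis .
qed

lemma nn_integral_shift:
  fixes f :: "real \<Rightarrow> ennreal" assumes [measurable]: "f \<in> borel_measurable borel"
  shows "(\<integral>\<^sup>+z. f (z + c) \<partial>lborel) = (\<integral>\<^sup>+z. f z \<partial>lborel)"
  using nn_integral_real_affine[of f 1 c] by (simp add: add.commute)

lemma nn_integral_sq_scaled_shift:
  fixes k :: "real \<Rightarrow> real"
  assumes [measurable]: "k \<in> borel_measurable borel"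
    and I: "(\<integral>\<^sup>+z. ennreal ((k z)\<^sup>2) \<partial>lborel) = ennreal r" and r: "0 \<le> r"
  shows "(\<integral>\<^sup>+z. ennreal ((p * k (z + c))\<^sup>2) \<partial>lborel) = ennreal (p\<^sup>2 * r)"
  using r by (simp add: power_mult_distrib ennreal_mult nn_integral_cmult
       nn_integral_shift[of "\<lambda>z. ennreal ((k z)\<^sup>2)" c] I)

lemma square_add_le: "(a + b)\<^sup>2 \<le> 2 * a\<^sup>2 + 2 * (b::real)\<^sup>2"
  using sum_squares_ge_zero[of "a - b" 0] by (simp add: power2_eq_square algebra_simps)

lemma nn_integral_square_add_le:
  fixes f g :: "'x \<Rightarrow> real"
  assumes [measurable]: "f \<in> borel_measurable M" "g \<in> borel_measurable M"
    and f: "(\<integral>\<^sup>+z. ennreal ((f z)\<^sup>2) \<partial>M) \<le> ennreal r" and g: "(\<integral>\<^sup>+z. ennreal ((g z)\<^sup>2) \<partial>M) \<le> ennreal s"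
    and "0 \<le> r" "0 \<le> s"
  shows "(\<integral>\<^sup>+z. ennreal ((f z + g z)\<^sup>2) \<partial>M) \<le> ennreal (2 * r + 2 * s)"
proof -
  have "(\<integral>\<^sup>+z. ennreal ((f z + g z)\<^sup>2) \<partial>M) \<le> (\<integral>\<^sup>+z. 2 * ennreal ((f z)\<^sup>2) + 2 * ennreal ((g z)\<^sup>2) \<partial>M)"
    by (intro nn_integral_mono order.trans[OF ennreal_leI[OF square_add_le]])
       (simp add: ennreal_plus ennreal_mult)
  also have "\<dots> = 2 * (\<integral>\<^sup>+z. ennreal ((f z)\<^sup>2) \<partial>M) + 2 * (\<integral>\<^sup>+z. ennreal ((g z)\<^sup>2) \<partial>M)"
    by (simp add: nn_integral_add nn_integral_cmult)
  also have "\<dots> \<le> 2 * ennreal r + 2 * ennreal s"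
    by (intro add_mono mult_left_mono f g) auto
  also have "\<dots> = ennreal (2 * r + 2 * s)"
    using assms by (simp add: ennreal_mult)
  finally show ?thesis .
qed

text \<open>Substituting z = x - y turns the weight into 1 + (x - z)^2, which is at most 1 + 2 x^2 +
  2 z^2. The dependence on x is later averaged through the second moment of the random sum.\<close>

lemma nn_integral_weight_shift:
  assumes [measurable]: "\<rho> \<in> borel_measurable borel"
    and a: "(\<integral>\<^sup>+z. ennreal ((\<rho> z)\<^sup>2) \<partial>lborel) \<le> ennreal a" "0 \<le> a"
    and b: "(\<integral>\<^sup>+z. ennreal ((z * \<rho> z)\<^sup>2) \<partial>lborel) \<le> ennreal b" "0 \<le> b"
  shows "(\<integral>\<^sup>+y. ennreal ((1 + y\<^sup>2) * (\<rho> (x - y))\<^sup>2) \<partial>lborel) \<le> ennreal ((1 + 2 * x\<^sup>2) * a + 2 * b)"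
proof -
  have "(\<integral>\<^sup>+y. ennreal ((1 + y\<^sup>2) * (\<rho> (x - y))\<^sup>2) \<partial>lborel) = (\<integral>\<^sup>+z. ennreal ((1 + (x - z)\<^sup>2) * (\<rho> z)\<^sup>2) \<partial>lborel)"
    by (subst nn_integral_real_affine[where c="-1" and t=x]) auto
  also have "\<dots> \<le> (\<integral>\<^sup>+z. ennreal (1 + 2 * x\<^sup>2) * ennreal ((\<rho> z)\<^sup>2) + 2 * ennreal ((z * \<rho> z)\<^sup>2) \<partial>lborel)"
  proof (intro nn_integral_mono)
    fix z
    have "(1 + (x - z)\<^sup>2) * (\<rho> z)\<^sup>2 \<le> (1 + (2 * x\<^sup>2 + 2 * z\<^sup>2)) * (\<rho> z)\<^sup>2"
      using square_add_le[of x "-z"] by (intro mult_right_mono) auto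
    then have "ennreal ((1 + (x - z)\<^sup>2) * (\<rho> z)\<^sup>2) \<le> ennreal ((1 + 2 * x\<^sup>2) * (\<rho> z)\<^sup>2 + 2 * (z * \<rho> z)\<^sup>2)"
      by (intro ennreal_leI) (simp add: algebra_simps power_mult_distrib)
    then show "ennreal ((1 + (x - z)\<^sup>2) * (\<rho> z)\<^sup>2) \<le> ennreal (1 + 2 * x\<^sup>2) * ennreal ((\<rho> z)\<^sup>2) + 2 * ennreal ((z * \<rho> z)\<^sup>2)"
      by (simp add: ennreal_plus ennreal_mult del: ennreal_leI)
  qed
  also have "\<dots> = ennreal (1 + 2 * x\<^sup>2) * (\<integral>\<^sup>+z. ennreal ((\<rho> z)\<^sup>2) \<partial>lborel) + 2 * (\<integral>\<^sup>+z. ennreal ((z * \<rho> z)\<^sup>2) \<partial>lborel)"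
    by (simp add: nn_integral_add nn_integral_cmult)
  also have "\<dots> \<le> ennreal (1 + 2 * x\<^sup>2) * ennreal a + 2 * ennreal b"
    by (intro add_mono mult_left_mono a b) auto
  also have "\<dots> = ennreal ((1 + 2 * x\<^sup>2) * a + 2 * b)"
    using a b by (simp add: ennreal_mult)
  finally show ?thesis .
qed

section \<open>Taylor remainders of the kernel, with and without the weight\<close>

definition ker_rem :: "real \<Rightarrow> real \<Rightarrow> real" where
  "ker_rem h z = ker (z + h) - ker z - h * ker1 z"

lemma ker_rem_measurable [measurable (raw)]:
  assumes [measurable]: "h \<in> borel_measurable M" "z \<in> borel_measurable M"
  shows "(\<lambda>p. ker_rem (h p) (z p)) \<in> borel_measurable M"
  unfolding ker_rem_def by measurable

text \<open>The segment s -> z + s h meets the kink at 0 for the single parameter s = -z/h, and the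
  fundamental theorem tolerates one exceptional point as long as \<open>G\<close> is
  continuous.\<close>

lemma FTC_off_kink:
  fixes G G' :: "real \<Rightarrow> real"
  assumes "continuous_on UNIV G" and "h \<noteq> 0"
    and "\<And>s. z + s * h \<noteq> 0 \<Longrightarrow> (G has_real_derivative G' s) (at s)"
  shows "(G' has_integral (G 1 - G 0)) {0..1}"
proof (rule fundamental_theorem_of_calculus_interior_strong[where S="{- z / h}"])
  fix s assume "s \<in> {0<..<1} - {- z / h}"
  then have "z + s * h \<noteq> 0" using assms(2) by (auto simp: field_simps)
  from assms(3)[OF this] show "(G has_vector_derivative G' s) (at s)"
    by (simp add: has_real_derivative_iff_has_vector_derivative)
qed (auto intro: continuous_on_subset[OF assms(1)])

lemma abs_affine_le: "\<bar>z + s * h\<bar> \<le> \<bar>z\<bar> + \<bar>h\<bar>" if "s \<in> {0..1}" for s z h :: real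
proof -
  have "\<bar>s * h\<bar> \<le> \<bar>h\<bar>" using that by (simp add: abs_mult mult_left_le_one_le)
  then show ?thesis by linarith
qed

lemma DERIV_ker_affine:
  "z + s * h \<noteq> 0 \<Longrightarrow> ((\<lambda>s. ker (z + s * h)) has_real_derivative (h * ker1 (z + s * h))) (at s)"
  "z + s * h \<noteq> 0 \<Longrightarrow> ((\<lambda>s. ker1 (z + s * h)) has_real_derivative (h * ker2 (z + s * h))) (at s)"
  by (rule DERIV_cong[OF DERIV_chain2[of _ _ "\<lambda>s. z + s * h" _ h]], (auto intro!: DERIV_ker DERIV_ker1 derivative_eq_intros)[3])+

lemma continuous_ker_affine:
  "continuous_on UNIV (\<lambda>s::real. ker (z + s * h))" "continuous_on UNIV (\<lambda>s::real. ker1 (z + s * h))"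
  by (rule continuous_on_compose2[OF continuous_on_ker[of UNIV]] continuous_on_compose2[OF continuous_on_ker1[of UNIV]];
      auto intro!: continuous_intros)+

text \<open>The integral form of the Taylor remainder. Two derivatives suffice although
  \<open>ker2\<close> jumps, because \<open>ker1\<close> is continuous.\<close>

lemma ker_rem_repr:
  assumes "h \<noteq> 0"
  shows "((\<lambda>s. h\<^sup>2 * (1 - s) * ker2 (z + s * h)) has_integral ker_rem h z) {0..1}"
proof -
  let ?G = "\<lambda>s. ker (z + s * h) + (1 - s) * h * ker1 (z + s * h)"
  have "((\<lambda>s. h\<^sup>2 * (1 - s) * ker2 (z + s * h)) has_integral (?G 1 - ?G 0)) {0..1}"
  proof (rule FTC_off_kink)
    show "continuous_on UNIV ?G" by (intro continuous_intros continuous_ker_affine)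
    fix s assume "z + s * h \<noteq> 0"
    note D = DERIV_ker_affine[OF this]
    show "(?G has_real_derivative h\<^sup>2 * (1 - s) * ker2 (z + s * h)) (at s)"
      by (rule derivative_eq_intros D refl)+ (simp add: algebra_simps power2_eq_square)
  qed fact
  then show ?thesis by (simp add: ker_rem_def algebra_simps)
qed

text \<open>The factor z has to appear as the moving point z + s h, so that translation invariance
  applies for each s. Writing z = (z + s h) - s h in \<open>ker_rem_repr\<close> would leave a term
  with h^3, whose square asks for a sixth moment. Integrating that term by parts trades h
  \<open>ker2\<close> for \<open>ker1\<close> and keeps the prefactor h^2. The function
  \<open>?G\<close> is the Taylor expression of u \<open>ker\<close> u along the segment, minus h
  \<open>ker\<close>.\<close>

lemma id_ker_rem_repr:
  assumes "h \<noteq> 0"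
  shows "((\<lambda>s. h\<^sup>2 * ((1 - 2 * s) * ker1 (z + s * h) + (1 - s) * ((z + s * h) * ker2 (z + s * h))))
    has_integral z * ker_rem h z) {0..1}"
proof -
  let ?M = "\<lambda>s. (z + s * h) * ker (z + s * h)"
  let ?G = "\<lambda>s. ?M s + (1 - s) * h * (ker (z + s * h) + (z + s * h) * ker1 (z + s * h)) - h * ker (z + s * h)"
  have "((\<lambda>s. h\<^sup>2 * ((1 - 2 * s) * ker1 (z + s * h) + (1 - s) * ((z + s * h) * ker2 (z + s * h))))
      has_integral (?G 1 - ?G 0)) {0..1}"
  proof (rule FTC_off_kink)
    show "continuous_on UNIV ?G" by (intro continuous_intros continuous_ker_affine)
    fix s assume "z + s * h \<noteq> 0"
    note D = DERIV_ker_affine[OF this]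
    show "(?G has_real_derivative h\<^sup>2 * ((1 - 2 * s) * ker1 (z + s * h) + (1 - s) * ((z + s * h) * ker2 (z + s * h)))) (at s)"
      by (rule derivative_eq_intros D refl)+ (simp add: algebra_simps power2_eq_square)
  qed fact
  then show ?thesis by (simp add: ker_rem_def algebra_simps)
qed

lemma ker1_diff_repr:
  assumes "h \<noteq> 0"
  shows "((\<lambda>s. h * ker2 (z + s * h)) has_integral (ker1 (z + h) - ker1 z)) {0..1}"
proof -
  have "((\<lambda>s. h * ker2 (z + s * h)) has_integral (ker1 (z + 1 * h) - ker1 (z + 0 * h))) {0..1}"
    by (rule FTC_off_kink) (use assms in \<open>auto intro!: continuous_ker_affine DERIV_ker_affine\<close>)
  then show ?thesis by simp
qed

text \<open>The same device as in \<open>id_ker_rem_repr\<close>: subtracting s h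
  \<open>ker1\<close> (z + h) cancels the surplus h \<open>ker1\<close> (z + h) at s = 1, and the
  prefactor stays h instead of acquiring a term with h^2.\<close>

lemma id_ker1_diff_repr:
  assumes "h \<noteq> 0"
  shows "((\<lambda>s. h * (ker1 (z + s * h) + (z + s * h) * ker2 (z + s * h) - ker1 (z + h)))
    has_integral z * (ker1 (z + h) - ker1 z)) {0..1}"
proof -
  let ?G = "\<lambda>s. (z + s * h) * ker1 (z + s * h) - s * h * ker1 (z + h)"
  have "((\<lambda>s. h * (ker1 (z + s * h) + (z + s * h) * ker2 (z + s * h) - ker1 (z + h)))
      has_integral (?G 1 - ?G 0)) {0..1}"
  proof (rule FTC_off_kink)
    show "continuous_on UNIV ?G" by (intro continuous_intros continuous_ker_affine)
    fix s assume "z + s * h \<noteq> 0"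
    note D = DERIV_ker_affine[OF this]
    show "(?G has_real_derivative h * (ker1 (z + s * h) + (z + s * h) * ker2 (z + s * h) - ker1 (z + h))) (at s)"
      by (rule derivative_eq_intros D refl)+ (simp add: algebra_simps power2_eq_square)
  qed fact
  then show ?thesis by (simp add: algebra_simps)
qed

lemma abs_id_ker2_le: "s \<in> {0..1} \<Longrightarrow> \<bar>(z + s * h) * ker2 (z + s * h)\<bar> \<le> \<bar>z\<bar> + \<bar>h\<bar>"
  using mult_mono[OF abs_affine_le[of s z h] abs_ker2_le[of "z + s * h"]] by (simp add: abs_mult)

lemma nn_integral_ker_rem_sq: "(\<integral>\<^sup>+z. ennreal ((ker_rem h z)\<^sup>2) \<partial>lborel) \<le> ennreal (h^4/16)"
proof (cases "h = 0")
  case False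
  show ?thesis
  proof (rule nn_integral_sq_le_of_integral_repr[OF ker_rem_repr[OF False], where C="\<lambda>s. h^4 * (1 - s)\<^sup>2 * (3/16)" and B="\<lambda>_. h\<^sup>2"])
    show "\<bar>h\<^sup>2 * (1 - s) * ker2 (z + s * h)\<bar> \<le> h\<^sup>2" if "s \<in> {0..1}" for s z
      using mult_mono[of "1 - s" 1 "\<bar>ker2 (z + s * h)\<bar>" 1] abs_ker2_le[of "z + s * h"] that mult_left_mono[of _ 1 "h\<^sup>2"]
      by (auto simp: abs_mult mult.assoc)
    show "(\<integral>\<^sup>+ z. ennreal ((h\<^sup>2 * (1 - s) * ker2 (z + s * h))\<^sup>2) \<partial>lborel) \<le> ennreal (h^4 * (1 - s)\<^sup>2 * (3/16))" for s
      by (subst nn_integral_sq_scaled_shift[OF _ nn_integral_ker2_sq]) (auto simp: power_mult_distrib)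
    \<comment> \<open>The average of (1 - s)^2 is 1/3, which turns the norm 3/16 of
      \<open>ker2\<close> into 1/16.\<close>
    have "((\<lambda>s. h^4 * (1 - s)\<^sup>2 * (3/16)) has_integral (- (h^4) * (1 - 1)^3/16 - (- (h^4) * (1 - 0)^3/16))) {0..1}"
      by (rule fundamental_theorem_of_calculus)
         (auto intro!: derivative_eq_intros simp: field_simps simp flip: has_real_derivative_iff_has_vector_derivative)
    then show "((\<lambda>s. h^4 * (1 - s)\<^sup>2 * (3/16)) has_integral h^4/16) {0..1}" by simp
  qed auto
qed (simp add: ker_rem_def)

lemma nn_integral_id_ker_rem_sq: "(\<integral>\<^sup>+z. ennreal ((z * ker_rem h z)\<^sup>2) \<partial>lborel) \<le> ennreal (h^4/12)"
proof (cases "h = 0")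
  case False
  show ?thesis
  proof (rule nn_integral_sq_le_of_integral_repr[OF id_ker_rem_repr[OF False],
        where C="\<lambda>s. 2 * (h^4 * (1 - 2 * s)\<^sup>2 * (1/16)) + 2 * (h^4 * (1 - s)\<^sup>2 * (1/16))" and B="\<lambda>z. h\<^sup>2 * (1 + (\<bar>z\<bar> + \<bar>h\<bar>))"])
    show "\<bar>h\<^sup>2 * ((1 - 2 * s) * ker1 (z + s * h) + (1 - s) * ((z + s * h) * ker2 (z + s * h)))\<bar> \<le> h\<^sup>2 * (1 + (\<bar>z\<bar> + \<bar>h\<bar>))"
      if s: "s \<in> {0..1}" for s z
    proof -
      have "\<bar>(1 - 2 * s) * ker1 (z + s * h)\<bar> \<le> 1 * 1"
        unfolding abs_mult by (rule mult_mono) (use s abs_ker1_le in auto)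
      moreover have "\<bar>(1 - s) * ((z + s * h) * ker2 (z + s * h))\<bar> \<le> 1 * (\<bar>z\<bar> + \<bar>h\<bar>)"
        unfolding abs_mult[of "1 - s"] by (rule mult_mono) (use s abs_id_ker2_le in auto)
      ultimately show ?thesis unfolding abs_mult[of "h\<^sup>2"] by (intro mult_mono) auto
    qed
    show "(\<integral>\<^sup>+ z. ennreal ((h\<^sup>2 * ((1 - 2 * s) * ker1 (z + s * h) + (1 - s) * ((z + s * h) * ker2 (z + s * h))))\<^sup>2) \<partial>lborel)
        \<le> ennreal (2 * (h^4 * (1 - 2 * s)\<^sup>2 * (1/16)) + 2 * (h^4 * (1 - s)\<^sup>2 * (1/16)))" for s
    proof -
      have eq: "h\<^sup>2 * ((1 - 2 * s) * ker1 (z + s * h) + (1 - s) * ((z + s * h) * ker2 (z + s * h))) =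
          h\<^sup>2 * (1 - 2 * s) * ker1 (z + s * h) + h\<^sup>2 * (1 - s) * ((z + s * h) * ker2 (z + s * h))" for z
        by (simp add: algebra_simps)
      show ?thesis unfolding eq
        by (rule order.trans[OF nn_integral_square_add_le[OF _ _ eq_refl[OF nn_integral_sq_scaled_shift[OF _ nn_integral_ker1_sq]]
             eq_refl[OF nn_integral_sq_scaled_shift[OF _ nn_integral_id_ker2_sq]]]])
          (auto intro!: ennreal_leI simp: power_mult_distrib)
    qed
    have "((\<lambda>s. 2 * (h^4 * (1 - 2 * s)\<^sup>2 * (1/16)) + 2 * (h^4 * (1 - s)\<^sup>2 * (1/16))) has_integral
       ((- (h^4) * (1 - 2 * 1)^3/48 - (h^4) * (1 - 1)^3/24) - (- (h^4) * (1 - 2 * 0)^3/48 - (h^4) * (1 - 0)^3/24))) {0..1}"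
      by (rule fundamental_theorem_of_calculus)
         (auto intro!: derivative_eq_intros simp: field_simps simp flip: has_real_derivative_iff_has_vector_derivative)
    then show "((\<lambda>s. 2 * (h^4 * (1 - 2 * s)\<^sup>2 * (1/16)) + 2 * (h^4 * (1 - s)\<^sup>2 * (1/16))) has_integral h^4/12) {0..1}" by simp
  qed auto
qed (simp add: ker_rem_def)

lemma nn_integral_ker1_diff_sq: "(\<integral>\<^sup>+z. ennreal ((ker1 (z + h) - ker1 z)\<^sup>2) \<partial>lborel) \<le> ennreal (3/16 * h\<^sup>2)"
proof (cases "h = 0")
  case False
  show ?thesis
  proof (rule nn_integral_sq_le_of_integral_repr[OF ker1_diff_repr[OF False], where C="\<lambda>s. 3/16 * h\<^sup>2" and B="\<lambda>_. \<bar>h\<bar>"])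
    show "\<bar>h * ker2 (z + s * h)\<bar> \<le> \<bar>h\<bar>" for s z
      using abs_ker2_le[of "z + s * h"] by (simp add: abs_mult mult_left_le)
    show "(\<integral>\<^sup>+ z. ennreal ((h * ker2 (z + s * h))\<^sup>2) \<partial>lborel) \<le> ennreal (3/16 * h\<^sup>2)" for s
      by (subst nn_integral_sq_scaled_shift[OF _ nn_integral_ker2_sq]) auto
    show "((\<lambda>s. 3/16 * h\<^sup>2) has_integral 3/16 * h\<^sup>2) {0..1::real}"
      using has_integral_const_real[of "3/16 * h\<^sup>2" 0 1] by simp
  qed auto
qed simp

lemma nn_integral_id_ker1_diff_sq:
  "(\<integral>\<^sup>+z. ennreal ((z * (ker1 (z + h) - ker1 z))\<^sup>2) \<partial>lborel) \<le> ennreal (5/8 * h\<^sup>2)"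
proof (cases "h = 0")
  case False
  show ?thesis
  proof (rule nn_integral_sq_le_of_integral_repr[OF id_ker1_diff_repr[OF False], where C="\<lambda>s. 5/8 * h\<^sup>2" and B="\<lambda>z. \<bar>h\<bar> * (1 + (\<bar>z\<bar> + \<bar>h\<bar>) + 1)"])
    show "\<bar>h * (ker1 (z + s * h) + (z + s * h) * ker2 (z + s * h) - ker1 (z + h))\<bar> \<le> \<bar>h\<bar> * (1 + (\<bar>z\<bar> + \<bar>h\<bar>) + 1)"
      if s: "s \<in> {0..1}" for s z
      unfolding abs_mult[of h] using abs_ker1_le[of "z + s * h"] abs_ker1_le[of "z + h"] abs_id_ker2_le[OF s, of z h]
      by (intro mult_left_mono) linarith+
    \<comment> \<open>Three summands of squared norm h^2/16, grouped as one plus two: 2/16 + 2 (2/16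
      + 2/16) = 5/8.\<close>
    have "(\<integral>\<^sup>+ z. ennreal ((h * ker1 (z + s * h) + (h * ((z + s * h) * ker2 (z + s * h)) + - h * ker1 (z + h)))\<^sup>2) \<partial>lborel)
        \<le> ennreal (2 * (h\<^sup>2 * (1/16)) + 2 * (2 * (h\<^sup>2 * (1/16)) + 2 * (h\<^sup>2 * (1/16))))" for s
      by (intro nn_integral_square_add_le)
         (simp_all add: nn_integral_sq_scaled_shift[OF _ nn_integral_ker1_sq, of "-h", simplified] nn_integral_sq_scaled_shift[OF _ nn_integral_ker1_sq]
            nn_integral_sq_scaled_shift[OF _ nn_integral_id_ker2_sq])
    moreover have "h * (ker1 (z + s * h) + (z + s * h) * ker2 (z + s * h) - ker1 (z + h)) =
       h * ker1 (z + s * h) + (h * ((z + s * h) * ker2 (z + s * h)) + - h * ker1 (z + h))" for s z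
      by (simp add: algebra_simps)
    ultimately show "(\<integral>\<^sup>+ z. ennreal ((h * (ker1 (z + s * h) + (z + s * h) * ker2 (z + s * h) - ker1 (z + h)))\<^sup>2) \<partial>lborel) \<le> ennreal (5/8 * h\<^sup>2)" for s
      by simp
    show "((\<lambda>s. 5/8 * h\<^sup>2) has_integral 5/8 * h\<^sup>2) {0..1::real}"
      using has_integral_const_real[of "5/8 * h\<^sup>2" 0 1] by simp
  qed auto
qed simp

lemma nn_integral_weight_ker_rem:
  "(\<integral>\<^sup>+y. ennreal ((1 + y\<^sup>2) * (ker_rem h (x - y))\<^sup>2) \<partial>lborel) \<le> ennreal (h^4 * ((1 + 2 * x\<^sup>2) / 16 + 1/6))"
  by (rule order.trans[OF nn_integral_weight_shift[OF _ nn_integral_ker_rem_sq _ nn_integral_id_ker_rem_sq]])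
     (auto simp: algebra_simps)

lemma nn_integral_weight_ker1_diff:
  "(\<integral>\<^sup>+y. ennreal ((1 + y\<^sup>2) * (ker1 (x - y + h) - ker1 (x - y))\<^sup>2) \<partial>lborel) \<le> ennreal (h\<^sup>2 * (3 * (1 + 2 * x\<^sup>2) / 16 + 5/4))"
  by (rule order.trans[OF nn_integral_weight_shift[OF _ nn_integral_ker1_diff_sq _ nn_integral_id_ker1_diff_sq]])
     (auto intro!: ennreal_leI simp: algebra_simps)

lemma nn_integral_weight_ker1:
  "(\<integral>\<^sup>+y. ennreal ((1 + y\<^sup>2) * (ker1 (x - y))\<^sup>2) \<partial>lborel) \<le> ennreal ((1 + 2 * x\<^sup>2) / 16 + 1/4)"
  by (rule order.trans[OF nn_integral_weight_shift[OF _ eq_refl[OF nn_integral_ker1_sq] _ eq_refl[OF nn_integral_id_ker1_sq]]])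
     (auto intro!: ennreal_leI simp del: ennreal_plus)

section \<open>Test functions as superpositions of translated kernels\<close>

lemma C3_test_DERIV:
  assumes "\<phi> \<in> C3_test" "k < 3"
  shows "((deriv ^^ k) \<phi> has_real_derivative (deriv ^^ Suc k) \<phi> x) (at x)"
  using assms by (auto simp: C3_test_def DERIV_deriv_iff_real_differentiable)

lemma C3_test_bound: "\<phi> \<in> C3_test \<Longrightarrow> k \<le> 3 \<Longrightarrow> \<bar>(deriv ^^ k) \<phi> x\<bar> \<le> 1"
  by (auto simp: C3_test_def)

lemma C3_test_continuous:
  assumes "\<phi> \<in> C3_test" "k \<le> 3" shows "continuous_on UNIV ((deriv ^^ k) \<phi>)"
proof (cases "k = 3")
  case False
  then show ?thesis
    using assms by (intro DERIV_continuous_on[OF has_field_derivative_at_within[OF C3_test_DERIV]]) auto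
qed (use assms in \<open>auto simp: C3_test_def\<close>)

lemma C3_test_measurable:
  assumes "\<phi> \<in> C3_test" "k \<le> 3" shows "(deriv ^^ k) \<phi> \<in> borel_measurable borel"
  by (rule borel_measurable_continuous_onI[OF C3_test_continuous[OF assms]])

lemma zero_in_C3_test: "(\<lambda>_. 0) \<in> C3_test"
proof -
  have "(deriv ^^ k) (\<lambda>_::real. 0::real) = (\<lambda>_. 0)" for k
    by (induction k) auto
  then show ?thesis by (simp add: C3_test_def)
qed

text \<open>The product (1 - D)(1 + D)^2 multiplied out: its coefficients 1, 1, -1, -1 add up to 4
  in absolute value, whereas (1 + D)^3 would give 8.\<close>

definition ker_op :: "(real \<Rightarrow> real) \<Rightarrow> real \<Rightarrow> real" where
  "ker_op \<phi> y = \<phi> y + (deriv ^^ 1) \<phi> y - (deriv ^^ 2) \<phi> y - (deriv ^^ 3) \<phi> y"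

lemma abs_ker_op_le: "\<phi> \<in> C3_test \<Longrightarrow> \<bar>ker_op \<phi> y\<bar> \<le> 4"
  using C3_test_bound[of \<phi> 0 y] C3_test_bound[of \<phi> 1 y] C3_test_bound[of \<phi> 2 y] C3_test_bound[of \<phi> 3 y]
  unfolding ker_op_def abs_le_iff by simp

lemma ker_op_measurable: "\<phi> \<in> C3_test \<Longrightarrow> ker_op \<phi> \<in> borel_measurable borel"
  using C3_test_measurable[of \<phi> 0] C3_test_measurable[of \<phi> 1] C3_test_measurable[of \<phi> 2] C3_test_measurable[of \<phi> 3]
  unfolding ker_op_def by simp

text \<open>Adding the constant 4 makes the integrand nonnegative, so that the fundamental theorem for
  nonnegative functions on half-lines applies on both sides of the kink of the kernel.\<close>

lemma nn_integral_ker_ker_op: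
  assumes \<phi>: "\<phi> \<in> C3_test"
  shows "(\<integral>\<^sup>+z. ennreal (ker z * (ker_op \<phi> (x - z) + 4)) \<partial>lborel) = ennreal (\<phi> x + 4)"
proof -
  define u v w where "u = \<phi>" and "v = (deriv ^^ 1) \<phi>" and "w = (deriv ^^ 2) \<phi>"
  have uvw: "\<bar>u y\<bar> \<le> 1" "\<bar>v y\<bar> \<le> 1" "\<bar>w y\<bar> \<le> 1" for y
    using C3_test_bound[OF \<phi>, of 0 y] C3_test_bound[OF \<phi>, of 1 y] C3_test_bound[OF \<phi>, of 2 y]
    by (simp_all add: u_def v_def w_def)
  have op: "ker_op \<phi> y = u y + v y - w y - (deriv ^^ 3) \<phi> y" for y
    by (simp add: ker_op_def u_def v_def w_def)
  have D: "(u has_real_derivative v y) (at y)" "(v has_real_derivative w y) (at y)" "(w has_real_derivative (deriv ^^ 3) \<phi> y) (at y)" for y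
    using C3_test_DERIV[OF \<phi>, of 0 y] C3_test_DERIV[OF \<phi>, of 1 y] C3_test_DERIV[OF \<phi>, of 2 y]
    by (simp_all add: u_def v_def w_def numeral_2_eq_2 numeral_3_eq_3 o_def)
  have [measurable]: "ker_op \<phi> \<in> borel_measurable borel" by (rule ker_op_measurable[OF \<phi>])
  have nonneg: "0 \<le> ker_op \<phi> y + 4" for y using abs_ker_op_le[OF \<phi>, of y] by linarith
  have minus: "((\<lambda>z. f (x - z)) has_real_derivative - d) (at z)" if "(f has_real_derivative d) (at (x - z))" for f d z
    by (rule DERIV_cong[OF DERIV_chain2[where g="\<lambda>z. x - z", OF that]]) (auto intro!: derivative_eq_intros)
  have plus: "((\<lambda>z. f (x + z)) has_real_derivative d) (at z)" if "(f has_real_derivative d) (at (x + z))" for f d z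
    by (rule DERIV_cong[OF DERIV_chain2[where g="\<lambda>z. x + z", OF that]]) (auto intro!: derivative_eq_intros)
  note D1 = D[THEN minus] and D2 = D[THEN plus]
  \<comment> \<open>On each half-line the integrand is an exact derivative. On the left the kernel
    is a pure exponential, which inverts 1 - D, so \<open>?Q\<close> is -exp (-z)/4 times (1 + D)^2
    applied to \<open>\<phi>\<close> + 4. On the right \<open>?P\<close> results from integrating by
    parts until no derivative of third order is left. At 0 the terms with \<open>v\<close> and
    \<open>w\<close> cancel and the weights 3/4 and 1/4 of \<open>u\<close> + 4 add up to 1; this is
    the matching condition for a Green function.\<close>
  let ?P = "\<lambda>z. - exp (-z) * ((3/4 + z/2) * (u (x - z) + 4) - v (x - z) / 2 - (1/4 + z/2) * w (x - z))"
  let ?Q = "\<lambda>z. - exp (-z) * ((u (x + z) + 4 + 2 * v (x + z) + w (x + z)) / 4)"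
  have "(\<integral>\<^sup>+z. ennreal (ker z * (ker_op \<phi> (x - z) + 4)) \<partial>lborel) = ennreal (u x + 4)"
  proof (rule nn_integral_real_split[where p="\<lambda>z. (1/4 + z/2) * exp (-z) * (ker_op \<phi> (x - z) + 4)"
        and q="\<lambda>z. exp (-z) / 4 * (ker_op \<phi> (x + z) + 4)" and P="?P" and Q="?Q"])
    show "(?P \<longlongrightarrow> 0) at_top"
    proof (rule Lim_null_comparison)
      show "\<forall>\<^sub>F z in at_top. norm (?P z) \<le> exp (-z) * ((3/4 + z/2) * 5 + 1 + (1/4 + z/2))"
        using eventually_ge_at_top[of 0]
      proof eventually_elim
        case (elim z)
        have "\<bar>(3/4 + z/2) * (u (x - z) + 4)\<bar> \<le> (3/4 + z/2) * 5"
          using elim uvw(1)[of "x - z"] unfolding abs_mult by (intro mult_mono) linarith+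
        moreover have "\<bar>(1/4 + z/2) * w (x - z)\<bar> \<le> (1/4 + z/2) * 1"
          using elim uvw(3)[of "x - z"] unfolding abs_mult by (intro mult_mono) linarith+
        moreover have "\<bar>v (x - z) / 2\<bar> \<le> 1" using uvw(2)[of "x - z"] by simp
        moreover have "\<bar>p - q - r\<bar> \<le> P + Q + R" if "\<bar>p\<bar> \<le> P" "\<bar>r\<bar> \<le> R" "\<bar>q\<bar> \<le> Q" for p q r P Q R :: real
          using that by linarith
        ultimately have "\<bar>(3/4 + z/2) * (u (x - z) + 4) - v (x - z) / 2 - (1/4 + z/2) * w (x - z)\<bar> \<le> (3/4 + z/2) * 5 + 1 + (1/4 + z/2) * 1"
          by blast
        then show ?case by (simp add: abs_mult)
      qed
      show "((\<lambda>z::real. exp (-z) * ((3/4 + z/2) * 5 + 1 + (1/4 + z/2))) \<longlongrightarrow> 0) at_top" by real_asymp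
    qed
    show "(?Q \<longlongrightarrow> 0) at_top"
    proof (rule Lim_null_comparison)
      show "\<forall>\<^sub>F z in at_top. norm (?Q z) \<le> exp (-z) * 2"
      proof (rule always_eventually, rule allI)
        fix z
        have "\<bar>(u (x + z) + 4 + 2 * v (x + z) + w (x + z)) / 4\<bar> \<le> 2"
          using uvw[of "x + z"] by (auto simp: abs_le_iff field_simps)
        then show "norm (?Q z) \<le> exp (-z) * 2" by (simp add: abs_mult)
      qed
      show "((\<lambda>z::real. exp (-z) * 2) \<longlongrightarrow> 0) at_top" by real_asymp
    qed
    show "(?P has_real_derivative (1/4 + z/2) * exp (-z) * (ker_op \<phi> (x - z) + 4)) (at z)" for z
      by (rule derivative_eq_intros refl D1 | simp)+ (simp add: op field_simps)
    show "(?Q has_real_derivative exp (-z) / 4 * (ker_op \<phi> (x + z) + 4)) (at z)" for z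
      by (rule derivative_eq_intros refl D2 | simp)+ (simp add: op field_simps)
    show "?P 0 \<le> 0" "?Q 0 \<le> 0" using uvw[of x] by (auto simp: abs_le_iff field_simps)
    show "- ?P 0 - ?Q 0 = u x + 4" by (simp add: field_simps)
  qed (use nonneg in \<open>auto simp: ker_def\<close>)
  then show ?thesis by (simp add: u_def)
qed

text \<open>The zero test function already gives the normalisation: only the added constant 4
  survives on both sides of \<open>nn_integral_ker_ker_op\<close>.\<close>

lemma has_bochner_integral_ker: "has_bochner_integral lborel (\<lambda>y. ker (x - y)) 1"
proof -
  have 0: "ker_op (\<lambda>_. 0) y = 0" for y
    by (simp add: ker_op_def numeral_2_eq_2 numeral_3_eq_3)
  have "(\<integral>\<^sup>+y. ennreal (4 * ker (x - y)) \<partial>lborel) = (\<integral>\<^sup>+z. ennreal (4 * ker z) \<partial>lborel)"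
    by (subst nn_integral_real_affine[where c="-1" and t=x]) auto
  also have "\<dots> = ennreal 4"
    using nn_integral_ker_ker_op[OF zero_in_C3_test] by (simp add: 0 mult.commute)
  finally have "has_bochner_integral lborel (\<lambda>y. 4 * ker (x - y)) 4"
    by (intro has_bochner_integral_nn_integral) (auto simp: ker_nonneg)
  from has_bochner_integral_mult_right[OF this, of "1/4"] show ?thesis by simp
qed

lemma has_bochner_integral_ker_ker_op:
  assumes \<phi>: "\<phi> \<in> C3_test"
  shows "has_bochner_integral lborel (\<lambda>y. ker (x - y) * ker_op \<phi> y) (\<phi> x)"
proof -
  note [measurable] = ker_op_measurable[OF \<phi>]
  have pos: "0 \<le> ker z * (ker_op \<phi> y + 4)" for z y
    using abs_ker_op_le[OF \<phi>, of y] ker_nonneg[of z] by auto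
  have "(\<integral>\<^sup>+y. ennreal (ker (x - y) * (ker_op \<phi> y + 4)) \<partial>lborel) = (\<integral>\<^sup>+z. ennreal (ker z * (ker_op \<phi> (x - z) + 4)) \<partial>lborel)"
    by (subst nn_integral_real_affine[where c="-1" and t=x]) auto
  also have "\<dots> = ennreal (\<phi> x + 4)" by (rule nn_integral_ker_ker_op[OF \<phi>])
  finally have "has_bochner_integral lborel (\<lambda>y. ker (x - y) * (ker_op \<phi> y + 4)) (\<phi> x + 4)"
    by (intro has_bochner_integral_nn_integral) (use pos C3_test_bound[OF \<phi>, of 0 x] in auto)
  \<comment> \<open>The auxiliary constant 4 is taken out again; the kernel has total mass
    1.\<close>
  from has_bochner_integral_diff[OF this has_bochner_integral_mult_right[OF has_bochner_integral_ker[of x], of 4]]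
  show ?thesis by (simp add: algebra_simps)
qed

section \<open>Product measures\<close>

lemma (in prob_space) integrable_bounded:
  fixes f :: "'a \<Rightarrow> real"
  assumes "f \<in> borel_measurable M" "\<And>x. x \<in> space M \<Longrightarrow> \<bar>f x\<bar> \<le> B"
  shows "integrable M f"
  by (rule integrable_const_bound[where B=B]) (use assms in auto)

lemma (in prob_space) abs_integral_le:
  fixes f :: "'a \<Rightarrow> real"
  assumes "f \<in> borel_measurable M" "\<And>x. x \<in> space M \<Longrightarrow> \<bar>f x\<bar> \<le> B"
  shows "\<bar>\<integral>x. f x \<partial>M\<bar> \<le> B"
proof -
  have "\<bar>\<integral>x. f x \<partial>M\<bar> \<le> (\<integral>x. \<bar>f x\<bar> \<partial>M)" by (rule integral_abs_bound)
  also have "\<dots> \<le> (\<integral>x. B \<partial>M)"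
    using integrable_bounded[OF assms] assms(2) by (intro integral_mono) auto
  finally show ?thesis by (simp add: prob_space)
qed

text \<open>The mean minimises the mean square deviation, so any constant \<open>a\<close> may
  replace it. In the Efron-Stein inequality \<open>a\<close> is the value with one coordinate
  frozen.\<close>

lemma (in prob_space) integral_square_deviation_ge:
  fixes f :: "'a \<Rightarrow> real"
  assumes f: "f \<in> borel_measurable M" and B: "\<And>x. x \<in> space M \<Longrightarrow> \<bar>f x\<bar> \<le> B"
  shows "(\<integral>x. (f x)\<^sup>2 \<partial>M) - (\<integral>x. f x \<partial>M)\<^sup>2 \<le> (\<integral>x. (f x - a)\<^sup>2 \<partial>M)"
proof -
  note i = integrable_bounded[OF f B]
  have i2: "integrable M (\<lambda>x. (f x)\<^sup>2)"
    by (rule integrable_bounded[where B="B\<^sup>2"]) (use f power_mono[OF B, of _ 2] in auto)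
  have "(\<integral>x. (f x - a)\<^sup>2 \<partial>M) = (\<integral>x. (f x)\<^sup>2 - 2 * a * f x + a\<^sup>2 \<partial>M)"
    by (intro Bochner_Integration.integral_cong) (auto simp: power2_diff)
  also have "\<dots> = (\<integral>x. (f x)\<^sup>2 \<partial>M) - 2 * a * (\<integral>x. f x \<partial>M) + a\<^sup>2"
    using i i2 by (simp add: prob_space)
  finally show ?thesis
    using zero_le_power2[of "(\<integral>x. f x \<partial>M) - a"] by (simp add: power2_diff algebra_simps)
qed

lemma (in prob_space) square_integral_le:
  fixes f :: "'a \<Rightarrow> real"
  assumes f: "f \<in> borel_measurable M" and B: "\<And>x. x \<in> space M \<Longrightarrow> \<bar>f x\<bar> \<le> B"
  shows "(\<integral>x. f x \<partial>M)\<^sup>2 \<le> (\<integral>x. (f x)\<^sup>2 \<partial>M)"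
proof -
  have "0 \<le> (\<integral>x. (f x - (\<integral>x. f x \<partial>M))\<^sup>2 \<partial>M)" by simp
  also have "\<dots> = (\<integral>x. (f x)\<^sup>2 - 2 * (\<integral>x. f x \<partial>M) * f x + (\<integral>x. f x \<partial>M)\<^sup>2 \<partial>M)"
    by (intro Bochner_Integration.integral_cong) (auto simp: power2_diff)
  also have "\<dots> = (\<integral>x. (f x)\<^sup>2 \<partial>M) - (\<integral>x. f x \<partial>M)\<^sup>2"
  proof -
    have "integrable M (\<lambda>x. (f x)\<^sup>2)"
      by (rule integrable_bounded[where B="B\<^sup>2"]) (use f power_mono[OF B, of _ 2] in auto)
    then show ?thesis
      using integrable_bounded[OF f B] by (simp add: prob_space power2_eq_square)
  qed
  finally show ?thesis by simp
qed

locale prob_family =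
  fixes M :: "'i \<Rightarrow> 'a measure"
  assumes prob_family: "\<And>i. prob_space (M i)"
begin

sublocale Mp: prob_space "M i" for i by (rule prob_family)

sublocale product_sigma_finite M
  by standard (rule Mp.sigma_finite_countable)

lemma integral_PiM_insert_bounded:
  fixes f :: "_ \<Rightarrow> real"
  assumes "finite I" "i \<notin> I" "f \<in> borel_measurable (PiM (insert i I) M)"
    and "\<And>w. w \<in> space (PiM (insert i I) M) \<Longrightarrow> \<bar>f w\<bar> \<le> B"
  shows "(\<integral>w. f w \<partial>PiM (insert i I) M) = (\<integral>w. (\<integral>y. f (w(i := y)) \<partial>M i) \<partial>PiM I M)"
proof (rule product_integral_insert)
  interpret PI: prob_space "PiM (insert i I) M" by (intro prob_space_PiM prob_family)
  show "integrable (PiM (insert i I) M) f" using assms by (intro PI.integrable_bounded) auto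
qed (use assms in auto)

theorem efron_stein:
  fixes Z :: "('i \<Rightarrow> 'a) \<Rightarrow> real"
  assumes "finite I" and c: "\<And>i. c i \<in> space (M i)"
    and "Z \<in> borel_measurable (PiM I M)" and "\<And>w. \<bar>Z w\<bar> \<le> B"
  shows "(\<integral>w. (Z w)\<^sup>2 \<partial>PiM I M) - (\<integral>w. Z w \<partial>PiM I M)\<^sup>2
      \<le> (\<Sum>i\<in>I. \<integral>w. (Z w - Z (w(i := c i)))\<^sup>2 \<partial>PiM I M)"
  using assms(1,3,4)
proof (induction I arbitrary: Z)
  case empty
  then show ?case by (simp add: PiM_empty lebesgue_integral_count_space_finite)
next
  case (insert j I)
  interpret PI: prob_space "PiM I M" by (intro prob_space_PiM prob_family)
  interpret PI': prob_space "PiM (insert j I) M" by (intro prob_space_PiM prob_family)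
  note [measurable] = insert.prems(1)
  note ZB = insert.prems(2)
  have B2: "\<bar>(Z w)\<^sup>2\<bar> \<le> B\<^sup>2" for w using power_mono[OF ZB, of _ 2] by simp
  have B4: "\<bar>(Z w - Z w')\<^sup>2\<bar> \<le> 4 * B\<^sup>2" for w w'
  proof -
    have "\<bar>Z w - Z w'\<bar> \<le> B + B" using ZB[of w] ZB[of w'] by linarith
    from power_mono[OF this, of 2] show ?thesis by simp
  qed
  have upd [measurable]: "(\<lambda>(w, x). w(j := x)) \<in> measurable (PiM I M \<Otimes>\<^sub>M M j) (PiM (insert j I) M)"
    by (rule measurable_add_dim)
  have Zu [measurable]: "(\<lambda>(w, x). Z (w(j := x))) \<in> borel_measurable (PiM I M \<Otimes>\<^sub>M M j)"
    using measurable_compose[OF upd insert.prems(1)] by (simp add: case_prod_beta')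
  have cj [measurable]: "(\<lambda>w. w(j := c j)) \<in> measurable (PiM I M) (PiM (insert j I) M)"
    by (rule measurable_fun_upd) (use c in auto)
  have Zs [measurable]: "(\<lambda>x. Z (w(j := x))) \<in> borel_measurable (M j)" if "w \<in> space (PiM I M)" for w
    using measurable_compose[OF measurable_Pair1' Zu, OF that] by simp
  have ci [measurable]: "(\<lambda>w. w(i := c i)) \<in> measurable (PiM I M) (PiM I M)" if "i \<in> I" for i
    by (rule measurable_fun_upd) (use c that in auto)
  have ci' [measurable]: "(\<lambda>w. w(i := c i)) \<in> measurable (PiM (insert j I) M) (PiM (insert j I) M)" if "i \<in> insert j I" for i
    by (rule measurable_fun_upd[where J="insert j I"]) (use c that in auto)
  define g where "g w = (\<integral>x. Z (w(j := x)) \<partial>M j)" for w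
  have g [measurable]: "g \<in> borel_measurable (PiM I M)"
    unfolding g_def by measurable
  have B0: "0 \<le> B" using ZB[of undefined] by linarith
  \<comment> \<open>The induction hypothesis wants the bound for every \<open>w\<close>, also
    outside the space of the product, where the slice may fail to be measurable. The integral is
    then 0 by convention, and 0 <= B.\<close>
  have gB: "\<bar>g w\<bar> \<le> B" for w
  proof (cases "(\<lambda>x. Z (w(j := x))) \<in> borel_measurable (M j)")
    case True
    then show ?thesis unfolding g_def by (rule Mp.abs_integral_le) (rule ZB)
  next
    case False
    then have "\<not> integrable (M j) (\<lambda>x. Z (w(j := x)))" by auto
    then show ?thesis using B0 by (simp add: g_def not_integrable_integral_eq)
  qed
  have gB2: "\<bar>(g w)\<^sup>2\<bar> \<le> B\<^sup>2" for w using power_mono[OF gB, of _ 2] by simp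
  have us: "(\<lambda>x. w(j := x)) \<in> measurable (M j) (PiM (insert j I) M)" if "w \<in> space (PiM I M)" for w
    using measurable_component_update[OF that] insert.hyps by simp
  have Zu' [measurable]: "(\<lambda>(w, x). Z (w(j := x, i := c i))) \<in> borel_measurable (PiM I M \<Otimes>\<^sub>M M j)" if "i \<in> insert j I" for i
  proof -
    have "(\<lambda>p. Z ((case p of (w, x) \<Rightarrow> w(j := x))(i := c i))) \<in> borel_measurable (PiM I M \<Otimes>\<^sub>M M j)"
      by (rule measurable_compose[OF upd measurable_compose[OF ci'[OF that] insert.prems(1)]])
    then show ?thesis by (simp add: case_prod_beta' del: fun_upd_apply)
  qed
  have Zs': "(\<lambda>x. Z (w(j := x, i := c i))) \<in> borel_measurable (M j)" if "w \<in> space (PiM I M)" "i \<in> insert j I" for w i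
    by (rule measurable_compose[OF us[OF that(1)] measurable_compose[OF ci'[OF that(2)] insert.prems(1)]])
  have M2: "\<bar>\<integral>x. (Z (w(j := x)))\<^sup>2 \<partial>M j\<bar> \<le> B\<^sup>2" if "w \<in> space (PiM I M)" for w
    by (rule Mp.abs_integral_le, rule borel_measurable_power, rule Zs[OF that], rule B2)
  have M4: "\<bar>\<integral>x. (Z (w(j := x)) - Z (w(j := x, i := c i)))\<^sup>2 \<partial>M j\<bar> \<le> 4 * B\<^sup>2" if "w \<in> space (PiM I M)" "i \<in> insert j I" for w i
    by (rule Mp.abs_integral_le, intro borel_measurable_power borel_measurable_diff Zs Zs' that, rule B4)
  have i2: "integrable (PiM I M) (\<lambda>w. \<integral>x. (Z (w(j := x)))\<^sup>2 \<partial>M j)"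
    by (rule PI.integrable_bounded[OF _ M2]) measurable
  have i4: "integrable (PiM I M) (\<lambda>w. \<integral>x. (Z (w(j := x)) - Z (w(j := x, i := c i)))\<^sup>2 \<partial>M j)" if i: "i \<in> insert j I" for i
  proof -
    note Zu'[OF i, measurable]
    show ?thesis by (rule PI.integrable_bounded[OF _ M4[OF _ i]]) measurable
  qed
  have ig: "integrable (PiM I M) (\<lambda>w. (g w)\<^sup>2)"
    by (rule PI.integrable_bounded[OF _ gB2]) measurable
  have dev: "(\<integral>w. (Z w - Z (w(i := c i)))\<^sup>2 \<partial>PiM (insert j I) M) =
      (\<integral>w. (\<integral>x. (Z (w(j := x)) - Z (w(j := x, i := c i)))\<^sup>2 \<partial>M j) \<partial>PiM I M)" if "i \<in> insert j I" for i
    by (subst integral_PiM_insert_bounded[where B="4 * B\<^sup>2"]) (use insert.hyps that in \<open>auto intro!: B4 B4[simplified]\<close>)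
  have "(\<integral>w. (Z w)\<^sup>2 \<partial>PiM (insert j I) M) = (\<integral>w. (\<integral>x. (Z (w(j := x)))\<^sup>2 \<partial>M j) \<partial>PiM I M)"
    by (subst integral_PiM_insert_bounded[where B="B\<^sup>2"]) (use insert.hyps in \<open>auto intro!: B2 B2[simplified]\<close>)
  \<comment> \<open>Conditional second moment = conditional variance + g^2, with the variance
    bounded by the deviation from the value at \<open>c j\<close>.\<close>
  also have "\<dots> \<le> (\<integral>w. (\<integral>x. (Z (w(j := x)) - Z (w(j := x, j := c j)))\<^sup>2 \<partial>M j) + (g w)\<^sup>2 \<partial>PiM I M)"
  proof (rule integral_mono)
    show "integrable (PiM I M) (\<lambda>w. \<integral>x. (Z (w(j := x)))\<^sup>2 \<partial>M j)" by (rule i2)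
    show "integrable (PiM I M) (\<lambda>w. (\<integral>x. (Z (w(j := x)) - Z (w(j := x, j := c j)))\<^sup>2 \<partial>M j) + (g w)\<^sup>2)"
      by (intro Bochner_Integration.integrable_add i4 ig) simp
    show "(\<integral>x. (Z (w(j := x)))\<^sup>2 \<partial>M j) \<le> (\<integral>x. (Z (w(j := x)) - Z (w(j := x, j := c j)))\<^sup>2 \<partial>M j) + (g w)\<^sup>2"
      if "w \<in> space (PiM I M)" for w
      using Mp.integral_square_deviation_ge[where f="\<lambda>x. Z (w(j := x))" and a="Z (w(j := c j))", OF Zs[OF that] ZB] by (simp add: g_def)
  qed
  also have "\<dots> = (\<integral>w. (Z w - Z (w(j := c j)))\<^sup>2 \<partial>PiM (insert j I) M) + (\<integral>w. (g w)\<^sup>2 \<partial>PiM I M)"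
    unfolding dev[OF insertI1]
    by (intro Bochner_Integration.integral_add i4 ig) simp
  finally have 1: "(\<integral>w. (Z w)\<^sup>2 \<partial>PiM (insert j I) M) \<le> \<dots>" .
  have 2: "(\<integral>w. Z w \<partial>PiM (insert j I) M) = (\<integral>w. g w \<partial>PiM I M)"
    unfolding g_def by (subst integral_PiM_insert_bounded[where B=B]) (use insert.hyps in \<open>auto intro!: ZB\<close>)
  have "(\<integral>w. (g w)\<^sup>2 \<partial>PiM I M) - (\<integral>w. g w \<partial>PiM I M)\<^sup>2 \<le> (\<Sum>i\<in>I. \<integral>w. (g w - g (w(i := c i)))\<^sup>2 \<partial>PiM I M)"
    by (rule insert.IH[OF g gB])
  also have "\<dots> \<le> (\<Sum>i\<in>I. \<integral>w. (Z w - Z (w(i := c i)))\<^sup>2 \<partial>PiM (insert j I) M)"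
  proof (rule sum_mono)
    fix i assume i: "i \<in> I"
    then have ij: "i \<noteq> j" using insert.hyps by auto
    have gB4: "\<bar>(g w - g w')\<^sup>2\<bar> \<le> 4 * B\<^sup>2" for w w'
    proof -
      have "\<bar>g w - g w'\<bar> \<le> B + B" using gB[of w] gB[of w'] by linarith
      from power_mono[OF this, of 2] show ?thesis by simp
    qed
    note ci[OF i, measurable] ci'[OF insertI2[OF i], measurable]
    show "(\<integral>w. (g w - g (w(i := c i)))\<^sup>2 \<partial>PiM I M) \<le> (\<integral>w. (Z w - Z (w(i := c i)))\<^sup>2 \<partial>PiM (insert j I) M)"
      unfolding dev[OF insertI2[OF i]]
    proof (rule integral_mono)
      show "integrable (PiM I M) (\<lambda>w. (g w - g (w(i := c i)))\<^sup>2)"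
        by (rule PI.integrable_bounded[where B="4 * B\<^sup>2"]) (auto intro!: gB4 gB4[simplified])
      show "integrable (PiM I M) (\<lambda>w. \<integral>x. (Z (w(j := x)) - Z (w(j := x, i := c i)))\<^sup>2 \<partial>M j)"
        by (rule i4) (use i in simp)
      fix w assume w: "w \<in> space (PiM I M)"
      have w': "w(i := c i) \<in> space (PiM I M)" using measurable_space[OF ci[OF i] w] .
      have "g w - g (w(i := c i)) = (\<integral>x. Z (w(j := x)) - Z (w(i := c i, j := x)) \<partial>M j)"
        unfolding g_def by (rule Bochner_Integration.integral_diff[symmetric]; rule Mp.integrable_bounded[where B=B])
          (use Zs[OF w] Zs[OF w'] ZB in auto)
      \<comment> \<open>Jensen in the coordinate j; since i and j differ, freezing i commutes with
        integrating over j.\<close>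
      also have "\<dots>\<^sup>2 \<le> (\<integral>x. (Z (w(j := x)) - Z (w(i := c i, j := x)))\<^sup>2 \<partial>M j)"
      proof (rule Mp.square_integral_le[where B="2 * B"])
        show "\<bar>Z (w(j := x)) - Z (w(i := c i, j := x))\<bar> \<le> 2 * B" for x
          using ZB[of "w(j := x)"] ZB[of "w(i := c i, j := x)"] by linarith
      qed (use Zs[OF w] Zs[OF w'] in auto)
      finally show "(g w - g (w(i := c i)))\<^sup>2 \<le> (\<integral>x. (Z (w(j := x)) - Z (w(j := x, i := c i)))\<^sup>2 \<partial>M j)"
        unfolding fun_upd_twist[OF ij, of w] .
    qed
  qed
  finally show ?case unfolding sum.insert[OF insert.hyps] 2 using 1 by linarith
qed

text \<open>Independence: after freezing, \<open>H\<close> no longer sees coordinate i. The integral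
  is taken over the remaining coordinates and coordinate i is put back afterwards as a dummy of mass
  one.\<close>

lemma nn_integral_PiM_coord_times:
  assumes I: "finite I" "i \<in> I" and [measurable]: "G \<in> borel_measurable (M i)" and H: "H \<in> borel_measurable (PiM I M)"
    and c: "c \<in> space (M i)"
  shows "(\<integral>\<^sup>+w. G (w i) * H (w(i := c)) \<partial>PiM I M) = (\<integral>\<^sup>+x. G x \<partial>M i) * (\<integral>\<^sup>+w. H (w(i := c)) \<partial>PiM I M)"
proof -
  let ?J = "I - {i}"
  have J: "finite ?J" "i \<notin> ?J" "insert i ?J = I" using I by auto
  have u [measurable]: "(\<lambda>w. w(i := c)) \<in> measurable (PiM I M) (PiM I M)"
    by (rule measurable_fun_upd) (use c I in auto)
  have u' [measurable]: "(\<lambda>w. w(i := c)) \<in> measurable (PiM ?J M) (PiM I M)"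
    by (rule measurable_fun_upd[where J="?J"]) (use c I in auto)
  note H [measurable]
  have [measurable]: "(\<lambda>w. w i) \<in> measurable (PiM I M) (M i)" using I by simp
  have "(\<integral>\<^sup>+w. G (w i) * H (w(i := c)) \<partial>PiM I M) = (\<integral>\<^sup>+w. (\<integral>\<^sup>+y. G y * H (w(i := c)) \<partial>M i) \<partial>PiM ?J M)"
    by (subst product_nn_integral_insert[OF J(1,2), unfolded J(3)]) auto
  also have "\<dots> = (\<integral>\<^sup>+y. G y \<partial>M i) * (\<integral>\<^sup>+w. H (w(i := c)) \<partial>PiM ?J M)"
    by (simp add: nn_integral_multc nn_integral_cmult)
  also have "(\<integral>\<^sup>+w. H (w(i := c)) \<partial>PiM ?J M) = (\<integral>\<^sup>+w. H (w(i := c)) \<partial>PiM I M)"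
    by (subst product_nn_integral_insert[OF J(1,2), unfolded J(3)]) (auto simp: Mp.emeasure_space_1)
  finally show ?thesis .
qed

end

section \<open>Lindeberg replacement\<close>

text \<open>Instantiated twice, with the common law of the coefficients and with the standard normal
  law. One Taylor estimate thus serves both sides of Lindeberg's replacement.\<close>

locale std_law =
  fixes \<mu> :: "real measure"
  assumes prob_law: "prob_space \<mu>" and sets_law [measurable_cong]: "sets \<mu> = sets borel"
    and int4: "integrable \<mu> (\<lambda>x. x ^ 4)" and mean: "(\<integral>x. x \<partial>\<mu>) = 0" and var: "(\<integral>x. x\<^sup>2 \<partial>\<mu>) = 1"
begin

sublocale prob_space \<mu> by (rule prob_law)

sublocale PF: prob_family "\<lambda>_::'i. \<mu>" by standard

lemma space_law [simp]: "space \<mu> = UNIV"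
  using sets_eq_imp_space_eq[OF sets_law] by simp

lemma prob_law_UNIV [simp]: "measure \<mu> UNIV = 1" "emeasure \<mu> UNIV = 1"
  using prob_space emeasure_space_1 by simp_all

lemma int_abs_power:
  assumes "k \<le> 4" shows "integrable \<mu> (\<lambda>x. \<bar>x\<bar> ^ k)"
proof (rule Bochner_Integration.integrable_bound[where f="\<lambda>x. 1 + x ^ 4"])
  have "\<bar>x\<bar> ^ k \<le> 1 + x ^ 4" for x :: real
  proof (cases "\<bar>x\<bar> \<le> 1")
    case True
    then have "\<bar>x\<bar> ^ k \<le> 1" by (intro power_le_one) auto
    then show ?thesis by (simp add: add_increasing2)
  next
    case False
    then have "\<bar>x\<bar> ^ k \<le> \<bar>x\<bar> ^ 4" using assms by (intro power_increasing) auto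
    then show ?thesis by (simp add: power_even_abs)
  qed
  then show "AE x in \<mu>. norm (\<bar>x\<bar> ^ k) \<le> norm (1 + x ^ 4)" by (auto simp: abs_of_nonneg add_nonneg_nonneg)
qed (use int4 in auto)

lemma int1: "integrable \<mu> (\<lambda>x. x)"
proof -
  have m: "(\<lambda>x. x) \<in> borel_measurable \<mu>" by measurable
  show ?thesis using int_abs_power[of 1] unfolding integrable_abs_iff[OF m, symmetric] by simp
qed

lemma int2: "integrable \<mu> (\<lambda>x. x\<^sup>2)"
  using int_abs_power[of 2] by simp

lemma nn_integral_affine_sq: "(\<integral>\<^sup>+y. ennreal ((s + c * y)\<^sup>2) \<partial>\<mu>) = ennreal (s\<^sup>2 + c\<^sup>2)"
proof -
  have eq: "(\<lambda>y. (s + c * y)\<^sup>2) = (\<lambda>y. s\<^sup>2 + 2 * s * c * y + c\<^sup>2 * y\<^sup>2)"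
    by (simp add: power2_eq_square algebra_simps)
  have i: "integrable \<mu> (\<lambda>y. (s + c * y)\<^sup>2)"
    unfolding eq by (intro Bochner_Integration.integrable_add integrable_mult_right int1 int2) simp
  have "(\<integral>\<^sup>+y. ennreal ((s + c * y)\<^sup>2) \<partial>\<mu>) = ennreal (\<integral>y. (s + c * y)\<^sup>2 \<partial>\<mu>)"
    by (rule nn_integral_eq_integral[OF i]) simp
  also have "(\<integral>y. (s + c * y)\<^sup>2 \<partial>\<mu>) = (\<integral>y. s\<^sup>2 \<partial>\<mu>) + 2 * s * c * (\<integral>y. y \<partial>\<mu>) + c\<^sup>2 * (\<integral>y. y\<^sup>2 \<partial>\<mu>)"
    unfolding eq using int1 int2 by simp
  finally show ?thesis by (simp add: mean var prob_space)
qed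

text \<open>Centred independent coordinates are orthogonal, so the variances add. The offset
  \<open>s\<close> is there for the induction, where it absorbs the coordinate that has been split
  off.\<close>

lemma nn_integral_PiM_affine_sq:
  assumes "finite J"
  shows "(\<integral>\<^sup>+w. ennreal ((s + (\<Sum>j\<in>J. c j * w j))\<^sup>2) \<partial>PiM J (\<lambda>_. \<mu>)) = ennreal (s\<^sup>2 + (\<Sum>j\<in>J. (c j)\<^sup>2))"
  using assms
proof (induction J arbitrary: s)
  case empty
  then show ?case by (simp add: PiM_empty)
next
  case (insert j J)
  have sum: "(\<Sum>k\<in>J. c k * (w(j := y)) k) = (\<Sum>k\<in>J. c k * w k)" for w y
    using insert.hyps by (intro sum.cong) auto
  have "(\<integral>\<^sup>+w. ennreal ((s + (\<Sum>j\<in>insert j J. c j * w j))\<^sup>2) \<partial>PiM (insert j J) (\<lambda>_. \<mu>)) =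
     (\<integral>\<^sup>+y. (\<integral>\<^sup>+w. ennreal (((s + c j * y) + (\<Sum>k\<in>J. c k * w k))\<^sup>2) \<partial>PiM J (\<lambda>_. \<mu>)) \<partial>\<mu>)"
    using insert.hyps sum by (subst PF.product_nn_integral_insert_rev) (auto simp: add.assoc fun_upd_same simp del: fun_upd_apply)
  also have "\<dots> = (\<integral>\<^sup>+y. ennreal ((s + c j * y)\<^sup>2) + ennreal (\<Sum>k\<in>J. (c k)\<^sup>2) \<partial>\<mu>)"
    by (simp add: insert.IH sum_nonneg)
  also have "\<dots> = ennreal (s\<^sup>2 + (c j)\<^sup>2) + ennreal (\<Sum>k\<in>J. (c k)\<^sup>2)"
    by (subst nn_integral_add) (auto simp: nn_integral_affine_sq emeasure_space_1 simp del: ennreal_plus)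
  also have "\<dots> = ennreal (s\<^sup>2 + (\<Sum>k\<in>insert j J. (c k)\<^sup>2))"
    using insert.hyps by (simp add: add.assoc sum_nonneg flip: ennreal_plus)
  finally show ?case .
qed

end

lemma C3_test_Taylor:
  assumes \<phi>: "\<phi> \<in> C3_test"
  shows "\<bar>\<phi> (u + t) - (\<phi> u + deriv \<phi> u * t + (deriv ^^ 2) \<phi> u / 2 * t\<^sup>2)\<bar> \<le> \<bar>t\<bar>^3 / 6"
proof (cases "t = 0")
  case False
  have "\<exists>s. (if u + t < u then u + t < s \<and> s < u else u < s \<and> s < u + t) \<and>
     \<phi> (u + t) = (\<Sum>m<3. (deriv ^^ m) \<phi> u / fact m * (u + t - u) ^ m) + (deriv ^^ 3) \<phi> s / fact 3 * (u + t - u) ^ 3"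
    by (rule Taylor[where a="min u (u + t)" and b="max u (u + t)"]) (use False C3_test_DERIV[OF \<phi>] in auto)
  then obtain s where "\<phi> (u + t) = (\<Sum>m<3. (deriv ^^ m) \<phi> u / fact m * t ^ m) + (deriv ^^ 3) \<phi> s / fact 3 * t ^ 3"
    by auto
  then have "\<phi> (u + t) - (\<phi> u + deriv \<phi> u * t + (deriv ^^ 2) \<phi> u / 2 * t\<^sup>2) = (deriv ^^ 3) \<phi> s * t ^ 3 / 6"
    by (simp add: eval_nat_numeral)
  moreover have "\<bar>(deriv ^^ 3) \<phi> s * t ^ 3\<bar> \<le> 1 * \<bar>t\<bar> ^ 3"
    unfolding abs_mult power_abs by (intro mult_right_mono C3_test_bound[OF \<phi>]) auto
  ultimately show ?thesis by (simp only: abs_divide)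
qed simp

context std_law
begin

text \<open>The quadratic Taylor polynomial integrates to a value that depends on the mean and the
  variance alone, hence to the same value for every law of this kind; the third absolute moment pays
  for the rest.\<close>

lemma one_step_Taylor:
  assumes \<phi>: "\<phi> \<in> C3_test"
  shows "\<bar>(\<integral>x. \<phi> (u + c * x) \<partial>\<mu>) - (\<phi> u + (deriv ^^ 2) \<phi> u / 2 * c\<^sup>2)\<bar> \<le> \<bar>c\<bar>^3 * (\<integral>x. \<bar>x\<bar>^3 \<partial>\<mu>) / 6"
proof -
  let ?T = "\<lambda>x. \<phi> u + deriv \<phi> u * (c * x) + (deriv ^^ 2) \<phi> u / 2 * (c * x)\<^sup>2"
  have [measurable]: "\<phi> \<in> borel_measurable borel" using C3_test_measurable[OF \<phi>, of 0] by simp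
  have i1: "integrable \<mu> (\<lambda>x. \<phi> (u + c * x))"
    by (rule integrable_bounded[where B=1]) (use C3_test_bound[OF \<phi>, of 0] in auto)
  have i2: "integrable \<mu> ?T" using int1 int2 by (simp add: power_mult_distrib)
  have T: "(\<integral>x. ?T x \<partial>\<mu>) = \<phi> u + (deriv ^^ 2) \<phi> u / 2 * c\<^sup>2"
    using int1 int2 mean var by (simp add: power_mult_distrib prob_space)
  have pt: "\<bar>\<phi> (u + c * x) - ?T x\<bar> \<le> \<bar>c\<bar>^3 / 6 * \<bar>x\<bar>^3" for x
    using C3_test_Taylor[OF \<phi>, of u "c * x"] by (simp only: abs_mult power_mult_distrib)
  have "\<bar>(\<integral>x. \<phi> (u + c * x) \<partial>\<mu>) - (\<integral>x. ?T x \<partial>\<mu>)\<bar> = \<bar>\<integral>x. \<phi> (u + c * x) - ?T x \<partial>\<mu>\<bar>"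
    by (subst Bochner_Integration.integral_diff[OF i1 i2]) simp
  also have "\<dots> \<le> (\<integral>x. \<bar>\<phi> (u + c * x) - ?T x\<bar> \<partial>\<mu>)" by (rule integral_abs_bound)
  also have "\<dots> \<le> (\<integral>x. \<bar>c\<bar>^3 / 6 * \<bar>x\<bar>^3 \<partial>\<mu>)"
    by (intro integral_mono pt integrable_abs Bochner_Integration.integrable_diff i1 i2 integrable_mult_right int_abs_power) simp
  finally show ?thesis unfolding T by simp
qed

end

lemma std_law_std_normal: "std_law std_normal_distribution"
proof (unfold std_law_def, intro conjI)
  show "prob_space std_normal_distribution" by (rule prob_space_normal_density) simp
  show "integrable std_normal_distribution (\<lambda>x. x ^ 4)"
    using integrable.intros[OF std_normal_moment_even[of 2]] by (subst integrable_density) auto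
  show "(\<integral>x. x \<partial>std_normal_distribution) = 0"
    using has_bochner_integral_integral_eq[OF std_normal_moment_odd[of 0]] by (subst integral_density) auto
  show "(\<integral>x. x\<^sup>2 \<partial>std_normal_distribution) = 1"
    using has_bochner_integral_integral_eq[OF std_normal_moment_even[of 1]] by (subst integral_density) auto
qed simp

interpretation std_normal: std_law std_normal_distribution
  by (rule std_law_std_normal)

lemma std_normal_abs_moment3: "(\<integral>x. \<bar>x\<bar>^3 \<partial>std_normal_distribution) \<le> 2"
proof -
  have "(\<integral>x. \<bar>x\<bar>^3 \<partial>std_normal_distribution) = sqrt (2/pi) * 2"
    using has_bochner_integral_integral_eq[OF std_normal_moment_abs_odd[of 1]] by (subst integral_density) (auto simp: numeral_3_eq_3)
  also have "sqrt (2/pi) \<le> 1" using pi_gt3 by simp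
  finally show ?thesis by simp
qed

lemma distr_std_normal_scale:
  assumes "\<tau> \<noteq> 0"
  shows "distr std_normal_distribution borel (\<lambda>x. \<tau> * x) = density lborel (\<lambda>x. ennreal (normal_density 0 \<bar>\<tau>\<bar> x))"
proof -
  have "distributed std_normal_distribution lborel (\<lambda>x. x) (normal_density 0 1)"
    unfolding distributed_def by (auto intro!: measure_eqI simp: emeasure_distr)
  from std_normal.normal_density_affine[OF this, of \<tau> 0] assms show ?thesis
    by (auto simp: distributed_def cong: distr_cong)
qed

text \<open>The sum of two independent centred normal variables is normal with the variances added.
  It allows the induction in \<open>lindeberg\<close> to carry one Gaussian variable instead of a
  whole family.\<close>

lemma std_normal_convolution:
  assumes [measurable]: "f \<in> borel_measurable borel" and B: "\<And>x. \<bar>f x\<bar> \<le> (B::real)"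
  shows "(\<integral>z. (\<integral>y. f (s + \<sigma> * z + c * y) \<partial>std_normal_distribution) \<partial>std_normal_distribution) = (\<integral>z. f (s + sqrt (\<sigma>\<^sup>2 + c\<^sup>2) * z) \<partial>std_normal_distribution)"
proof -
  let ?\<nu> = "\<lambda>\<tau>. density lborel (\<lambda>x. ennreal (normal_density 0 \<tau> x))"
  have scale: "(\<integral>y. h (c * y) \<partial>std_normal_distribution) = (\<integral>y. h y \<partial>?\<nu> \<bar>c\<bar>)"
    if "c \<noteq> 0" "h \<in> borel_measurable borel" for h :: "real \<Rightarrow> real" and c
    using that(2) by (subst distr_std_normal_scale[OF that(1), symmetric], subst integral_distr) auto
  show ?thesis
  \<comment> \<open>A normal law with variance 0 has no density, so the convolution formula needs
    both factors to be nonzero. If one vanishes, only the sign of the other has to be removed, by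
    symmetry of the normal law.\<close>
  proof (cases "\<sigma> = 0 \<or> c = 0")
    case True
    have "(\<integral>y. f (s + c * y) \<partial>std_normal_distribution) = (\<integral>z. f (s + \<bar>c\<bar> * z) \<partial>std_normal_distribution)" for c
      using scale[of c "\<lambda>y. f (s + y)"] scale[of "\<bar>c\<bar>" "\<lambda>y. f (s + y)"] by (cases "c = 0") auto
    from this[of c] this[of \<sigma>] show ?thesis
      using True by (auto simp: std_normal.prob_space)
  next
    case False
    then have pos: "0 < \<bar>\<sigma>\<bar>" "0 < \<bar>c\<bar>" by auto
    interpret n1: prob_space "?\<nu> \<bar>\<sigma>\<bar>" by (rule prob_space_normal_density) fact
    interpret n2: prob_space "?\<nu> \<bar>c\<bar>" by (rule prob_space_normal_density) fact
    interpret P: pair_prob_space "?\<nu> \<bar>\<sigma>\<bar>" "?\<nu> \<bar>c\<bar>" ..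
    have "(\<integral>z. (\<integral>y. f (s + \<sigma> * z + c * y) \<partial>std_normal_distribution) \<partial>std_normal_distribution) = (\<integral>z. (\<integral>y. f (s + \<sigma> * z + y) \<partial>?\<nu> \<bar>c\<bar>) \<partial>std_normal_distribution)"
      using False by (subst scale) auto
    also have "\<dots> = (\<integral>z. (\<integral>y. f (s + z + y) \<partial>?\<nu> \<bar>c\<bar>) \<partial>?\<nu> \<bar>\<sigma>\<bar>)"
      using scale[of \<sigma> "\<lambda>z. \<integral>y. f (s + z + y) \<partial>?\<nu> \<bar>c\<bar>"] False by simp
    also have "\<dots> = (\<integral>p. f (s + (fst p + snd p)) \<partial>(?\<nu> \<bar>\<sigma>\<bar> \<Otimes>\<^sub>M ?\<nu> \<bar>c\<bar>))"
      by (subst P.integral_fst'[symmetric]) (auto intro!: P.integrable_bounded[where B=B] B simp: add.assoc)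
    also have "\<dots> = (\<integral>x. f (s + x) \<partial>(?\<nu> \<bar>\<sigma>\<bar> \<star> ?\<nu> \<bar>c\<bar>))"
      unfolding convolution_def by (subst integral_distr) (auto simp: case_prod_beta')
    also have "?\<nu> \<bar>\<sigma>\<bar> \<star> ?\<nu> \<bar>c\<bar> = density lborel (\<lambda>x. \<integral>\<^sup>+y. ennreal (normal_density 0 \<bar>\<sigma>\<bar> (x - y)) * ennreal (normal_density 0 \<bar>c\<bar> y) \<partial>lborel)"
      by (rule convolution_density) (auto intro: n1.finite_measure_axioms n2.finite_measure_axioms)
    also have "\<dots> = ?\<nu> (sqrt (\<sigma>\<^sup>2 + c\<^sup>2))"
      using conv_normal_density_zero_mean[OF pos] by (simp add: ennreal_mult' fun_eq_iff)
    also have "(\<integral>x. f (s + x) \<partial>\<dots>) = (\<integral>z. f (s + sqrt (\<sigma>\<^sup>2 + c\<^sup>2) * z) \<partial>std_normal_distribution)"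
      using pos by (subst scale) (auto simp: abs_of_nonneg sum_power2_eq_zero_iff)
    finally show ?thesis .
  qed
qed

context std_law
begin

text \<open>Induction on the set of coordinates. The new coordinate is exchanged for a Gaussian of
  the same variance at the cost of one Taylor step for each law; that Gaussian then becomes part of
  the shift \<open>s\<close> while the induction hypothesis replaces the other coordinates.\<close>

theorem lindeberg:
  assumes \<phi>: "\<phi> \<in> C3_test" and "finite J"
  shows "\<bar>(\<integral>w. \<phi> (s + (\<Sum>j\<in>J. c j * w j)) \<partial>PiM J (\<lambda>_. \<mu>)) - (\<integral>z. \<phi> (s + sqrt (\<Sum>j\<in>J. (c j)\<^sup>2) * z) \<partial>std_normal_distribution)\<bar>
    \<le> (\<Sum>j\<in>J. \<bar>c j\<bar>^3) * ((\<integral>x. \<bar>x\<bar>^3 \<partial>\<mu>) + 2) / 6"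
  using assms(2)
proof (induction J arbitrary: s)
  case empty
  then show ?case by (simp add: PiM_empty lebesgue_integral_count_space_finite std_normal.prob_space)
next
  case (insert j J)
  let ?K = "(\<integral>x. \<bar>x\<bar>^3 \<partial>\<mu>) + 2"
  let ?\<sigma> = "sqrt (\<Sum>j\<in>J. (c j)\<^sup>2)"
  have [measurable]: "\<phi> \<in> borel_measurable borel" using C3_test_measurable[OF \<phi>, of 0] by simp
  have B: "\<bar>\<phi> x\<bar> \<le> 1" for x using C3_test_bound[OF \<phi>, of 0] by simp
  interpret PJ: prob_space "PiM J (\<lambda>_. \<mu>)" by (intro prob_space_PiM prob_law)
  interpret PN: pair_prob_space "PiM J (\<lambda>_. \<mu>)" std_normal_distribution ..
  have sum: "(\<Sum>k\<in>J. c k * (w(j := y)) k) = (\<Sum>k\<in>J. c k * w k)" for w y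
    using insert.hyps by (intro sum.cong) auto
  define S where "S w = (\<Sum>k\<in>J. c k * w k)" for w
  have [measurable]: "S \<in> borel_measurable (PiM J (\<lambda>_. \<mu>))" unfolding S_def by measurable
  have step: "\<bar>(\<integral>y. \<phi> (u + c j * y) \<partial>\<mu>) - (\<integral>z. \<phi> (u + c j * z) \<partial>std_normal_distribution)\<bar> \<le> \<bar>c j\<bar>^3 * ?K / 6" for u
  proof -
    have "\<bar>c j\<bar>^3 * (\<integral>x. \<bar>x\<bar>^3 \<partial>std_normal_distribution) / 6 \<le> \<bar>c j\<bar>^3 * 2 / 6"
      using std_normal_abs_moment3 by (intro divide_right_mono mult_left_mono) auto
    then show ?thesis
      using one_step_Taylor[OF \<phi>, of u "c j"] std_normal.one_step_Taylor[OF \<phi>, of u "c j"]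
      unfolding distrib_left add_divide_distrib by linarith
  qed
  have 1: "(\<integral>w. \<phi> (s + (\<Sum>j\<in>insert j J. c j * w j)) \<partial>PiM (insert j J) (\<lambda>_. \<mu>)) = (\<integral>w. (\<integral>y. \<phi> ((s + S w) + c j * y) \<partial>\<mu>) \<partial>PiM J (\<lambda>_. \<mu>))"
    using insert.hyps sum by (subst PF.integral_PiM_insert_bounded[where B=1]) (auto simp: B S_def algebra_simps fun_upd_same simp del: fun_upd_apply)
  \<comment> \<open>Interchanging the integrals puts the Gaussian outside, where it is a fixed shift
    as the induction hypothesis demands.\<close>
  have 2: "(\<integral>w. (\<integral>z. \<phi> ((s + S w) + c j * z) \<partial>std_normal_distribution) \<partial>PiM J (\<lambda>_. \<mu>)) = (\<integral>z. (\<integral>w. \<phi> ((s + c j * z) + S w) \<partial>PiM J (\<lambda>_. \<mu>)) \<partial>std_normal_distribution)"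
    by (subst PN.Fubini_integral) (auto intro!: PN.integrable_bounded[where B=1] B simp: algebra_simps)
  \<comment> \<open>The new Gaussian and the one produced by the induction hypothesis merge into one
    of the total variance.\<close>
  have 3: "(\<integral>z. (\<integral>y. \<phi> ((s + c j * z) + ?\<sigma> * y) \<partial>std_normal_distribution) \<partial>std_normal_distribution) = (\<integral>z. \<phi> (s + sqrt (\<Sum>j\<in>insert j J. (c j)\<^sup>2) * z) \<partial>std_normal_distribution)"
    by (subst std_normal_convolution[where B=1]) (use insert.hyps in \<open>auto simp: B sum_nonneg\<close>)
  have b1: "\<bar>(\<integral>w. (\<integral>y. \<phi> ((s + S w) + c j * y) \<partial>\<mu>) \<partial>PiM J (\<lambda>_. \<mu>)) - (\<integral>w. (\<integral>z. \<phi> ((s + S w) + c j * z) \<partial>std_normal_distribution) \<partial>PiM J (\<lambda>_. \<mu>))\<bar>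
     \<le> \<bar>c j\<bar>^3 * ?K / 6"
    by (subst Bochner_Integration.integral_diff[symmetric],
        (auto intro!: PJ.integrable_bounded[where B=1] abs_integral_le std_normal.abs_integral_le B)[2],
        rule PJ.abs_integral_le, measurable, rule step)
  have b2: "\<bar>(\<integral>z. (\<integral>w. \<phi> ((s + c j * z) + S w) \<partial>PiM J (\<lambda>_. \<mu>)) \<partial>std_normal_distribution) - (\<integral>z. (\<integral>y. \<phi> ((s + c j * z) + ?\<sigma> * y) \<partial>std_normal_distribution) \<partial>std_normal_distribution)\<bar>
     \<le> (\<Sum>j\<in>J. \<bar>c j\<bar>^3) * ?K / 6"
    unfolding S_def
    by (subst Bochner_Integration.integral_diff[symmetric],
        (auto intro!: std_normal.integrable_bounded[where B=1] PJ.abs_integral_le std_normal.abs_integral_le B)[2],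
        rule std_normal.abs_integral_le, measurable, rule insert.IH)
  show ?case
    using b1 b2 unfolding 1 2 3[symmetric]
    unfolding sum.insert[OF insert.hyps] distrib_right add_divide_distrib by linarith
qed

end

section \<open>Fluctuations\<close>

lemma abs_ker_rem_le: "\<bar>ker_rem h z\<bar> \<le> 2 + \<bar>h\<bar>"
proof -
  have "\<bar>h * ker1 z\<bar> \<le> \<bar>h\<bar>" using abs_ker1_le[of z] by (simp add: abs_mult mult_left_le)
  then show ?thesis
    using abs_ker_le[of "z + h"] abs_ker_le[of z] unfolding ker_rem_def by linarith
qed

text \<open>What the argument needs from the trigonometric system, with c = 1/sqrt n and 2n
  functions. \<open>sum_e_sq\<close> is cos^2 + sin^2 = 1 and gives the sum unit variance at every
  point; the 1/2 in \<open>bessel\<close> is the squared norm of each function under the uniform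
  law.\<close>

locale rand_sum = std_law \<mu> for \<mu> +
  fixes Q :: "'x measure" and I :: "'i set" and e :: "'i \<Rightarrow> 'x \<Rightarrow> real" and c :: real
  assumes prob_Q: "prob_space Q" and finite_I: "finite I" and c_pos: "0 < c"
    and e_measurable [measurable]: "\<And>i. e i \<in> borel_measurable Q"
    and e_le: "\<And>i x. \<bar>e i x\<bar> \<le> 1"
    and sum_e_sq: "\<And>x. (\<Sum>i\<in>I. (c * e i x)\<^sup>2) = 1"
    and card_I: "real (card I) * c\<^sup>2 = 2"
    and bessel: "\<And>F B. F \<in> borel_measurable Q \<Longrightarrow> (\<And>x. \<bar>F x\<bar> \<le> B) \<Longrightarrow>
       (\<Sum>i\<in>I. (\<integral>x. F x * e i x \<partial>Q)\<^sup>2) \<le> (\<integral>x. (F x)\<^sup>2 \<partial>Q) / 2"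
begin

abbreviation "P \<equiv> PiM I (\<lambda>_. \<mu>)"

definition f :: "('i \<Rightarrow> real) \<Rightarrow> 'x \<Rightarrow> real" where
  "f w x = (\<Sum>i\<in>I. c * e i x * w i)"

definition Z :: "real \<Rightarrow> ('i \<Rightarrow> real) \<Rightarrow> real" where
  "Z y w = (\<integral>x. ker (f w x - y) \<partial>Q)"

text \<open>The Fourier coefficient of \<open>ker1\<close> (f w - y) along \<open>e i\<close>. Up to
  the factor c it is the derivative of \<open>Z y\<close> in coordinate i, to first order.\<close>

definition A :: "'i \<Rightarrow> real \<Rightarrow> ('i \<Rightarrow> real) \<Rightarrow> real" where
  "A i y w = (\<integral>x. ker1 (f w x - y) * e i x \<partial>Q)"

sublocale Q: prob_space Q by (rule prob_Q)
sublocale P: prob_space P by (intro prob_space_PiM prob_law)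
sublocale PQ: pair_prob_space P Q ..
sublocale PL: pair_sigma_finite P "lborel :: real measure" ..
sublocale QL: pair_sigma_finite Q "lborel :: real measure" ..

lemma measurable_law [simp]: "measurable \<mu> N = measurable borel N" "measurable N \<mu> = measurable N borel"
  by (simp_all add: measurable_cong_sets[OF sets_law refl] measurable_cong_sets[OF refl sets_law])

lemma coord_measurable: "i \<in> I \<Longrightarrow> g \<in> measurable N P \<Longrightarrow> (\<lambda>p. g p i) \<in> borel_measurable N"
  using measurable_compose[OF _ measurable_component_singleton[of i I "\<lambda>_. \<mu>"], of g N] by simp

lemma coord_measurable_fst [measurable]:
  "i \<in> I \<Longrightarrow> (\<lambda>w. w i) \<in> borel_measurable P" "i \<in> I \<Longrightarrow> (\<lambda>p. fst p i) \<in> borel_measurable (P \<Otimes>\<^sub>M N)"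
  by (auto intro: coord_measurable)

lemma f_measurable [measurable (raw)]:
  assumes g: "g \<in> measurable N P" and k: "k \<in> measurable N Q"
  shows "(\<lambda>p. f (g p) (k p)) \<in> borel_measurable N"
  unfolding f_def by (intro borel_measurable_sum borel_measurable_times[OF borel_measurable_times[OF borel_measurable_const
    measurable_compose[OF k e_measurable]] coord_measurable[OF _ g]])

lemma upd_measurable [measurable (raw)]:
  assumes "i \<in> I" "g \<in> measurable N P" shows "(\<lambda>p. (g p)(i := 0)) \<in> measurable N P"
  by (rule measurable_fun_upd) (use assms in auto)

lemma Z_measurable [measurable (raw)]:
  assumes [measurable]: "k \<in> borel_measurable N" "g \<in> measurable N P"
  shows "(\<lambda>p. Z (k p) (g p)) \<in> borel_measurable N"
  unfolding Z_def by measurable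

lemma A_measurable [measurable (raw)]:
  assumes [measurable]: "k \<in> borel_measurable N" "g \<in> measurable N P"
  shows "(\<lambda>p. A i (k p) (g p)) \<in> borel_measurable N"
  unfolding A_def by measurable

lemma f_split: "i \<in> I \<Longrightarrow> f w x = f (w(i := 0)) x + c * w i * e i x"
  unfolding f_def by (subst (1 2) sum.remove[OF finite_I]) (auto intro!: sum.cong)

lemma nn_integral_f_sq: "(\<integral>\<^sup>+w. ennreal ((f w x)\<^sup>2) \<partial>P) = 1"
  using nn_integral_PiM_affine_sq[OF finite_I, of 0 "\<lambda>i. c * e i x"] by (simp add: f_def sum_e_sq)

lemma nn_integral_f0_sq:
  assumes "i \<in> I" shows "(\<integral>\<^sup>+w. ennreal ((f (w(i := 0)) x)\<^sup>2) \<partial>P) \<le> 1"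
proof -
  let ?d = "\<lambda>j. if j = i then 0 else c * e j x"
  have "f (w(i := 0)) x = (\<Sum>j\<in>I. ?d j * w j)" for w
    unfolding f_def by (intro sum.cong) auto
  then have "(\<integral>\<^sup>+w. ennreal ((f (w(i := 0)) x)\<^sup>2) \<partial>P) = ennreal (\<Sum>j\<in>I. (?d j)\<^sup>2)"
    using nn_integral_PiM_affine_sq[OF finite_I, of 0 ?d] by simp
  also have "\<dots> \<le> ennreal (\<Sum>j\<in>I. (c * e j x)\<^sup>2)"
    by (intro ennreal_leI sum_mono) auto
  finally show ?thesis by (simp add: sum_e_sq)
qed

text \<open>The sum without its i-th term is independent of \<open>w i\<close> and has second moment
  at most 1, so the quadratic weight averages to at most \<open>\<alpha>\<close> +
  \<open>\<beta>\<close>.\<close>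

lemma nn_integral_coord_f0:
  assumes i: "i \<in> I" and G [measurable]: "G \<in> borel_measurable borel" and "0 \<le> \<alpha>" "0 \<le> \<beta>" and x [measurable]: "x \<in> space Q"
  shows "(\<integral>\<^sup>+w. G (w i) * ennreal (\<alpha> + \<beta> * (f (w(i := 0)) x)\<^sup>2) \<partial>P) \<le> (\<integral>\<^sup>+y. G y \<partial>\<mu>) * ennreal (\<alpha> + \<beta>)"
proof -
  note i [measurable]
  have eq: "(\<integral>\<^sup>+w. G (w i) * ennreal (\<alpha> + \<beta> * (f (w(i := 0)) x)\<^sup>2) \<partial>P)
      = (\<integral>\<^sup>+y. G y \<partial>\<mu>) * (\<integral>\<^sup>+w. ennreal (\<alpha> + \<beta> * (f (w(i := 0)) x)\<^sup>2) \<partial>P)"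
  proof (rule PF.nn_integral_PiM_coord_times[OF finite_I i])
    show "G \<in> borel_measurable \<mu>" by (simp add: G)
    show "(\<lambda>w. ennreal (\<alpha> + \<beta> * (f w x)\<^sup>2)) \<in> borel_measurable P" by measurable
  qed simp
  have "(\<integral>\<^sup>+w. ennreal (\<alpha> + \<beta> * (f (w(i := 0)) x)\<^sup>2) \<partial>P) = ennreal \<alpha> + ennreal \<beta> * (\<integral>\<^sup>+w. ennreal ((f (w(i := 0)) x)\<^sup>2) \<partial>P)"
    using assms by (simp add: nn_integral_add nn_integral_cmult ennreal_mult P.emeasure_space_1)
  also have "\<dots> \<le> ennreal \<alpha> + ennreal \<beta> * 1"
    by (intro add_mono mult_left_mono nn_integral_f0_sq i) auto
  also have "\<dots> = ennreal (\<alpha> + \<beta>)" using assms by simp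
  finally have le: "(\<integral>\<^sup>+w. ennreal (\<alpha> + \<beta> * (f (w(i := 0)) x)\<^sup>2) \<partial>P) \<le> ennreal (\<alpha> + \<beta>)" .
  show ?thesis unfolding eq by (intro mult_left_mono le) simp
qed

lemma nn_integral_scaled_power4: "(\<integral>\<^sup>+y. ennreal ((c * y)^4) \<partial>\<mu>) = ennreal (c^4 * (\<integral>y. y^4 \<partial>\<mu>))"
proof -
  have eq: "(\<lambda>y. (c * y)^4) = (\<lambda>y. c^4 * y^4)" by (simp add: power_mult_distrib)
  have "(\<integral>\<^sup>+y. ennreal ((c * y)^4) \<partial>\<mu>) = ennreal (\<integral>y. (c * y)^4 \<partial>\<mu>)"
    by (rule nn_integral_eq_integral) (auto simp: eq int4)
  then show ?thesis by (simp add: eq)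
qed

text \<open>Integrating in y first makes the translation invariant estimate available and leaves a
  weight in f (w(i := 0)) x, which is independent of \<open>w i\<close>. The constant is 17/48 =
  11/48 + 1/8.\<close>

lemma nn_integral_rem:
  assumes i [measurable]: "i \<in> I"
  shows "(\<integral>\<^sup>+w. (\<integral>\<^sup>+y. (\<integral>\<^sup>+x. ennreal ((1 + y\<^sup>2) * (ker_rem (c * w i * e i x) (f (w(i := 0)) x - y))\<^sup>2) \<partial>Q) \<partial>lborel) \<partial>P)
    \<le> ennreal (17/48 * c^4 * (\<integral>y. y^4 \<partial>\<mu>))"
proof -
  have "(\<integral>\<^sup>+w. (\<integral>\<^sup>+y. (\<integral>\<^sup>+x. ennreal ((1 + y\<^sup>2) * (ker_rem (c * w i * e i x) (f (w(i := 0)) x - y))\<^sup>2) \<partial>Q) \<partial>lborel) \<partial>P) =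
    (\<integral>\<^sup>+w. (\<integral>\<^sup>+x. (\<integral>\<^sup>+y. ennreal ((1 + y\<^sup>2) * (ker_rem (c * w i * e i x) (f (w(i := 0)) x - y))\<^sup>2) \<partial>lborel) \<partial>Q) \<partial>P)"
    by (intro nn_integral_cong QL.Fubini') measurable
  also have "\<dots> \<le> (\<integral>\<^sup>+w. (\<integral>\<^sup>+x. ennreal ((c * w i)^4) * ennreal (11/48 + 1/8 * (f (w(i := 0)) x)\<^sup>2) \<partial>Q) \<partial>P)"
  proof (intro nn_integral_mono order.trans[OF nn_integral_weight_ker_rem])
    fix w x
    have "(c * w i * e i x)^4 \<le> (c * w i)^4"
      using e_le[of i x] power_le_one[of "\<bar>e i x\<bar>" 4] by (simp add: power_mult_distrib power_even_abs mult_left_le)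
    then have "(c * w i * e i x)^4 * ((1 + 2 * (f (w(i := 0)) x)\<^sup>2) / 16 + 1/6) \<le> (c * w i)^4 * (11/48 + 1/8 * (f (w(i := 0)) x)\<^sup>2)"
      by (intro mult_mono) (auto simp: field_simps)
    then show "ennreal ((c * w i * e i x)^4 * ((1 + 2 * (f (w(i := 0)) x)\<^sup>2) / 16 + 1/6)) \<le> ennreal ((c * w i)^4) * ennreal (11/48 + 1/8 * (f (w(i := 0)) x)\<^sup>2)"
      by (subst ennreal_mult[symmetric]) (auto intro!: ennreal_leI)
  qed
  also have "\<dots> = (\<integral>\<^sup>+x. (\<integral>\<^sup>+w. ennreal ((c * w i)^4) * ennreal (11/48 + 1/8 * (f (w(i := 0)) x)\<^sup>2) \<partial>P) \<partial>Q)"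
    by (rule PQ.Fubini'[symmetric]) measurable
  also have "\<dots> \<le> (\<integral>\<^sup>+x. (\<integral>\<^sup>+y. ennreal ((c * y)^4) \<partial>\<mu>) * ennreal (11/48 + 1/8) \<partial>Q)"
    by (intro nn_integral_mono nn_integral_coord_f0 i) auto
  also have "\<dots> = (\<integral>\<^sup>+y. ennreal ((c * y)^4) \<partial>\<mu>) * ennreal (17/48)"
    by (simp add: Q.emeasure_space_1)
  also have "(\<integral>\<^sup>+y. ennreal ((c * y)^4) \<partial>\<mu>) = ennreal (c^4 * (\<integral>y. y^4 \<partial>\<mu>))"
    by (rule nn_integral_scaled_power4)
  also have "\<dots> * ennreal (17/48) = ennreal (17/48 * c^4 * (\<integral>y. y^4 \<partial>\<mu>))"
    by (subst ennreal_mult[symmetric]) (auto simp: mult_ac)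
  finally show ?thesis .
qed

text \<open>The cost of moving one Fourier coefficient from \<open>w(i := 0)\<close> back to
  \<open>w\<close>. Only the second moment of \<open>w i\<close> enters; 29/16 = 23/16 +
  3/8.\<close>

lemma nn_integral_ker1_shift:
  assumes i [measurable]: "i \<in> I"
  shows "(\<integral>\<^sup>+w. (\<integral>\<^sup>+y. (\<integral>\<^sup>+x. ennreal ((1 + y\<^sup>2) * (ker1 (f w x - y) - ker1 (f (w(i := 0)) x - y))\<^sup>2) \<partial>Q) \<partial>lborel) \<partial>P)
    \<le> ennreal (29/16 * c\<^sup>2)"
proof -
  have shift: "ker1 (f w x - y) = ker1 (f (w(i := 0)) x - y + c * w i * e i x)" for w x y
    using f_split[OF i, of w x] by (simp add: algebra_simps)
  have "(\<integral>\<^sup>+w. (\<integral>\<^sup>+y. (\<integral>\<^sup>+x. ennreal ((1 + y\<^sup>2) * (ker1 (f w x - y) - ker1 (f (w(i := 0)) x - y))\<^sup>2) \<partial>Q) \<partial>lborel) \<partial>P) =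
    (\<integral>\<^sup>+w. (\<integral>\<^sup>+x. (\<integral>\<^sup>+y. ennreal ((1 + y\<^sup>2) * (ker1 (f (w(i := 0)) x - y + c * w i * e i x) - ker1 (f (w(i := 0)) x - y))\<^sup>2) \<partial>lborel) \<partial>Q) \<partial>P)"
    unfolding shift[symmetric] by (intro nn_integral_cong QL.Fubini') measurable
  also have "\<dots> \<le> (\<integral>\<^sup>+w. (\<integral>\<^sup>+x. ennreal ((c * w i)^2) * ennreal (23/16 + 3/8 * (f (w(i := 0)) x)\<^sup>2) \<partial>Q) \<partial>P)"
  proof (intro nn_integral_mono order.trans[OF nn_integral_weight_ker1_diff])
    fix w x
    have "(c * w i * e i x)\<^sup>2 \<le> (c * w i)\<^sup>2"
      using e_le[of i x] power_le_one[of "\<bar>e i x\<bar>" 2] by (simp add: power_mult_distrib mult_left_le)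
    then have "(c * w i * e i x)\<^sup>2 * (3 * (1 + 2 * (f (w(i := 0)) x)\<^sup>2) / 16 + 5/4) \<le> (c * w i)\<^sup>2 * (23/16 + 3/8 * (f (w(i := 0)) x)\<^sup>2)"
      by (intro mult_mono) (auto simp: field_simps)
    then show "ennreal ((c * w i * e i x)\<^sup>2 * (3 * (1 + 2 * (f (w(i := 0)) x)\<^sup>2) / 16 + 5/4)) \<le> ennreal ((c * w i)\<^sup>2) * ennreal (23/16 + 3/8 * (f (w(i := 0)) x)\<^sup>2)"
      by (subst ennreal_mult[symmetric]) (auto intro!: ennreal_leI)
  qed
  also have "\<dots> = (\<integral>\<^sup>+x. (\<integral>\<^sup>+w. ennreal ((c * w i)^2) * ennreal (23/16 + 3/8 * (f (w(i := 0)) x)\<^sup>2) \<partial>P) \<partial>Q)"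
    by (rule PQ.Fubini'[symmetric]) measurable
  also have "\<dots> \<le> (\<integral>\<^sup>+x. (\<integral>\<^sup>+y. ennreal ((c * y)^2) \<partial>\<mu>) * ennreal (23/16 + 3/8) \<partial>Q)"
    by (intro nn_integral_mono nn_integral_coord_f0 i) auto
  also have "\<dots> = (\<integral>\<^sup>+y. ennreal ((c * y)^2) \<partial>\<mu>) * ennreal (29/16)"
    by (simp add: Q.emeasure_space_1)
  also have "(\<integral>\<^sup>+y. ennreal ((c * y)^2) \<partial>\<mu>) = ennreal (c^2)"
    using nn_integral_affine_sq[of 0 c] by simp
  also have "\<dots> * ennreal (29/16) = ennreal (29/16 * c\<^sup>2)"
    by (subst ennreal_mult[symmetric]) (auto simp: mult_ac)
  finally show ?thesis .
qed

lemma nn_integral_ker1_f: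
  "(\<integral>\<^sup>+w. (\<integral>\<^sup>+y. (\<integral>\<^sup>+x. ennreal ((1 + y\<^sup>2) * (ker1 (f w x - y))\<^sup>2) \<partial>Q) \<partial>lborel) \<partial>P) \<le> ennreal (7/16)"
proof -
  have "(\<integral>\<^sup>+w. (\<integral>\<^sup>+y. (\<integral>\<^sup>+x. ennreal ((1 + y\<^sup>2) * (ker1 (f w x - y))\<^sup>2) \<partial>Q) \<partial>lborel) \<partial>P) =
    (\<integral>\<^sup>+w. (\<integral>\<^sup>+x. (\<integral>\<^sup>+y. ennreal ((1 + y\<^sup>2) * (ker1 (f w x - y))\<^sup>2) \<partial>lborel) \<partial>Q) \<partial>P)"
    by (intro nn_integral_cong QL.Fubini') measurable
  also have "\<dots> \<le> (\<integral>\<^sup>+w. (\<integral>\<^sup>+x. ennreal (5/16) + ennreal (1/8) * ennreal ((f w x)\<^sup>2) \<partial>Q) \<partial>P)"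
    by (intro nn_integral_mono order.trans[OF nn_integral_weight_ker1])
       (auto simp: ennreal_plus[symmetric] ennreal_mult[symmetric] field_simps simp del: ennreal_plus intro!: ennreal_leI)
  also have "\<dots> = (\<integral>\<^sup>+x. (\<integral>\<^sup>+w. ennreal (5/16) + ennreal (1/8) * ennreal ((f w x)\<^sup>2) \<partial>P) \<partial>Q)"
    by (rule PQ.Fubini'[symmetric]) measurable
  also have "\<dots> = (\<integral>\<^sup>+x. ennreal (7/16) \<partial>Q)"
    by (intro nn_integral_cong)
       (simp add: nn_integral_add nn_integral_cmult nn_integral_f_sq P.emeasure_space_1 ennreal_plus[symmetric] del: ennreal_plus)
  finally show ?thesis by (simp add: Q.emeasure_space_1)
qed

end

lemma nn_integral_linear2:
  assumes [measurable]: "a \<in> borel_measurable M" "b \<in> borel_measurable M"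
  shows "(\<integral>\<^sup>+x. k * a x + l * b x \<partial>M) = k * (\<integral>\<^sup>+x. a x \<partial>M) + l * (\<integral>\<^sup>+x. b x \<partial>M)"
  by (simp add: nn_integral_add nn_integral_cmult)

context rand_sum
begin

text \<open>Kept as a measurability rule, this one would also unify with the identity function and make
  the proofs below fail.\<close>

declare coord_measurable_fst(1) [measurable del]

lemma upd_in_space: "i \<in> I \<Longrightarrow> w \<in> space P \<Longrightarrow> w(i := 0) \<in> space P"
  using measurable_space[OF upd_measurable[of i "\<lambda>w. w" P]] by auto

lemma ker_bounds_Q:
  assumes [measurable]: "w \<in> space P"
  shows "integrable Q (\<lambda>x. ker (f w x - y))" "integrable Q (\<lambda>x. ker1 (f w x - y) * e i x)"
proof -
  show "integrable Q (\<lambda>x. ker (f w x - y))"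
    by (rule Q.integrable_bounded[where B=1]) (use abs_ker_le in auto)
  have "\<bar>ker1 (f w x - y) * e i x\<bar> \<le> 1 * 1" for x
    unfolding abs_mult by (intro mult_mono abs_ker1_le e_le) auto
  then show "integrable Q (\<lambda>x. ker1 (f w x - y) * e i x)"
    by (intro Q.integrable_bounded[where B=1]) auto
qed

text \<open>Expansion to first order around \<open>w(i := 0)\<close> rather than around
  \<open>w\<close>, so that in the leading term \<open>w i\<close> multiplies something independent
  of it.\<close>

lemma Z_diff_sq:
  assumes i: "i \<in> I" and w [measurable]: "w \<in> space P"
  shows "(Z y w - Z y (w(i := 0)))\<^sup>2 \<le> 4 * ((c * w i)\<^sup>2 * (A i y (w(i := 0)))\<^sup>2)
      + 4/3 * (\<integral>x. (ker_rem (c * w i * e i x) (f (w(i := 0)) x - y))\<^sup>2 \<partial>Q)"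
proof -
  define v where "v = w(i := 0)"
  have v [measurable]: "v \<in> space P" unfolding v_def by (rule upd_in_space[OF i w])
  let ?h = "c * w i"
  let ?R = "\<lambda>x. ker_rem (?h * e i x) (f v x - y)"
  have R: "\<bar>?R x\<bar> \<le> 2 + \<bar>?h\<bar>" for x
    by (rule order.trans[OF abs_ker_rem_le]) (use e_le[of i x] in \<open>simp add: abs_mult mult_left_le\<close>)
  have Rm [measurable]: "?R \<in> borel_measurable Q" by measurable
  have "Z y w - Z y v = (\<integral>x. ker (f w x - y) - ker (f v x - y) \<partial>Q)"
    unfolding Z_def by (intro Bochner_Integration.integral_diff[symmetric] ker_bounds_Q w v)
  also have "\<dots> = (\<integral>x. ?R x + ?h * (ker1 (f v x - y) * e i x) \<partial>Q)"
    using f_split[OF i, of w] by (intro Bochner_Integration.integral_cong) (auto simp: ker_rem_def v_def algebra_simps)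
  also have "\<dots> = (\<integral>x. ?R x \<partial>Q) + ?h * A i y v"
    unfolding A_def using Q.integrable_bounded[OF Rm R] ker_bounds_Q(2)[OF v] by simp
  finally have eq: "Z y w - Z y v = (\<integral>x. ?R x \<partial>Q) + ?h * A i y v" .
  \<comment> \<open>An uneven split in favour of the remainder \<open>a\<close>, which carries the
    fourth moment m4. With 2 and 2 the fourth moment would enter \<open>K\<close> with 17/12 instead
    of 17/18, and the final coefficient of sqrt m4 would exceed the admissible 8, since 4 sqrt (17
    pi/12) is about 8.44.\<close>
  have "(a + b)\<^sup>2 \<le> 4 * b\<^sup>2 + 4/3 * a\<^sup>2" for a b :: real
    using zero_le_power2[of "a - 3 * b"] by (simp add: power2_eq_square algebra_simps)
  then have "(Z y w - Z y v)\<^sup>2 \<le> 4 * (?h * A i y v)\<^sup>2 + 4/3 * (\<integral>x. ?R x \<partial>Q)\<^sup>2"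
    unfolding eq .
  also have "\<dots> \<le> 4 * (?h * A i y v)\<^sup>2 + 4/3 * (\<integral>x. (?R x)\<^sup>2 \<partial>Q)"
    using Q.square_integral_le[OF Rm R] by simp
  finally show ?thesis unfolding v_def power_mult_distrib[of ?h] .
qed

text \<open>Prepares Bessel's inequality, which applies only when all Fourier coefficients belong to
  the same \<open>w\<close>. As the functions \<open>e i\<close> are bounded by 1, the error is an
  L2 distance in which \<open>e i\<close> no longer occurs.\<close>

lemma A_upd_sq:
  assumes i: "i \<in> I" and w [measurable]: "w \<in> space P"
  shows "(A i y (w(i := 0)))\<^sup>2 \<le> 2 * (A i y w)\<^sup>2 + 2 * (\<integral>x. (ker1 (f w x - y) - ker1 (f (w(i := 0)) x - y))\<^sup>2 \<partial>Q)"
proof -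
  define v where "v = w(i := 0)"
  have v [measurable]: "v \<in> space P" unfolding v_def by (rule upd_in_space[OF i w])
  let ?q = "\<lambda>x. ker1 (f w x - y) - ker1 (f v x - y)"
  have q: "\<bar>?q x\<bar> \<le> 2" for x using abs_ker1_le[of "f w x - y"] abs_ker1_le[of "f v x - y"] by linarith
  have qe: "\<bar>?q x * e i x\<bar> \<le> 2 * 1" for x
    unfolding abs_mult by (intro mult_mono q e_le) auto
  have q2: "(?q x * e i x)\<^sup>2 \<le> (?q x)\<^sup>2" for x
    using e_le[of i x] by (simp add: power_mult_distrib mult_left_le power_le_one abs_square_le_1)
  have "A i y w - A i y v = (\<integral>x. ?q x * e i x \<partial>Q)"
    unfolding A_def by (subst Bochner_Integration.integral_diff[symmetric, OF ker_bounds_Q(2)[OF w] ker_bounds_Q(2)[OF v]]) (simp add: algebra_simps)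
  then have "A i y v = A i y w + - (\<integral>x. ?q x * e i x \<partial>Q)" by simp
  then have "(A i y v)\<^sup>2 \<le> 2 * (A i y w)\<^sup>2 + 2 * (\<integral>x. ?q x * e i x \<partial>Q)\<^sup>2"
    using square_add_le[of "A i y w" "- (\<integral>x. ?q x * e i x \<partial>Q)"] by simp
  also have "(\<integral>x. ?q x * e i x \<partial>Q)\<^sup>2 \<le> (\<integral>x. (?q x * e i x)\<^sup>2 \<partial>Q)"
    by (rule Q.square_integral_le[where B="2 * 1"]) (use qe in auto)
  also have "\<dots> \<le> (\<integral>x. (?q x)\<^sup>2 \<partial>Q)"
  proof (rule integral_mono[OF _ _ q2])
    have 4: "\<bar>(?q x)\<^sup>2\<bar> \<le> 2\<^sup>2" for x using power_mono[OF q[of x], of 2] by simp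
    show "integrable Q (\<lambda>x. (?q x)\<^sup>2)" by (rule Q.integrable_bounded[OF _ 4]) measurable
    show "integrable Q (\<lambda>x. (?q x * e i x)\<^sup>2)"
      by (rule Q.integrable_bounded[where B="2\<^sup>2"]) (use order.trans[OF q2 order.trans[OF abs_ge_self 4]] in auto)
  qed
  finally show ?thesis unfolding v_def by simp
qed

lemma nn_integral_Q_bounded_sq:
  assumes "g \<in> borel_measurable Q" "\<And>x. \<bar>g x\<bar> \<le> B"
  shows "ennreal (\<integral>x. (g x)\<^sup>2 \<partial>Q) = (\<integral>\<^sup>+x. ennreal ((g x)\<^sup>2) \<partial>Q)"
proof (rule nn_integral_eq_integral[symmetric])
  show "integrable Q (\<lambda>x. (g x)\<^sup>2)"
    by (rule Q.integrable_bounded[where B="B\<^sup>2"]) (use assms power_mono[OF assms(2), of _ 2] in auto)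
qed simp

lemma weight_nn_integral_Q:
  assumes "g \<in> borel_measurable Q" "\<And>x. \<bar>g x\<bar> \<le> B" "0 \<le> a"
  shows "ennreal (a * (\<integral>x. (g x)\<^sup>2 \<partial>Q)) = (\<integral>\<^sup>+x. ennreal (a * (g x)\<^sup>2) \<partial>Q)"
  using assms by (simp add: ennreal_mult nn_integral_Q_bounded_sq[OF assms(1,2)] nn_integral_cmult)

text \<open>Bessel's inequality for fixed \<open>w\<close> and y, applied to \<open>ker1\<close> (f
  w - y). The sum of 2n squares costs no more than half of one L2 norm: 7/32 is half of
  7/16.\<close>

lemma sum_nn_integral_A:
  "(\<Sum>i\<in>I. \<integral>\<^sup>+w. (\<integral>\<^sup>+y. ennreal ((1 + y\<^sup>2) * (A i y w)\<^sup>2) \<partial>lborel) \<partial>P) \<le> ennreal (7/32)"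
proof -
  have "(\<Sum>i\<in>I. \<integral>\<^sup>+w. (\<integral>\<^sup>+y. ennreal ((1 + y\<^sup>2) * (A i y w)\<^sup>2) \<partial>lborel) \<partial>P)
      = (\<integral>\<^sup>+w. (\<integral>\<^sup>+y. (\<Sum>i\<in>I. ennreal ((1 + y\<^sup>2) * (A i y w)\<^sup>2)) \<partial>lborel) \<partial>P)"
  proof (subst nn_integral_sum[symmetric])
    show "(\<integral>\<^sup>+w. (\<Sum>i\<in>I. \<integral>\<^sup>+y. ennreal ((1 + y\<^sup>2) * (A i y w)\<^sup>2) \<partial>lborel) \<partial>P)
      = (\<integral>\<^sup>+w. (\<integral>\<^sup>+y. (\<Sum>i\<in>I. ennreal ((1 + y\<^sup>2) * (A i y w)\<^sup>2)) \<partial>lborel) \<partial>P)"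
      by (intro nn_integral_cong nn_integral_sum[symmetric]) measurable
  qed measurable
  also have "\<dots> \<le> (\<integral>\<^sup>+w. (\<integral>\<^sup>+y. ennreal (1/2) * (\<integral>\<^sup>+x. ennreal ((1 + y\<^sup>2) * (ker1 (f w x - y))\<^sup>2) \<partial>Q) \<partial>lborel) \<partial>P)"
  proof (intro nn_integral_mono)
    fix w y assume w [measurable]: "w \<in> space P"
    have "(\<Sum>i\<in>I. ennreal ((1 + y\<^sup>2) * (A i y w)\<^sup>2)) = ennreal ((1 + y\<^sup>2) * (\<Sum>i\<in>I. (A i y w)\<^sup>2))"
      by (simp add: sum_ennreal sum_distrib_left)
    also have "\<dots> \<le> ennreal (1/2 * ((1 + y\<^sup>2) * (\<integral>x. (ker1 (f w x - y))\<^sup>2 \<partial>Q)))"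
    proof (rule ennreal_leI)
      have "(\<Sum>i\<in>I. (A i y w)\<^sup>2) \<le> (\<integral>x. (ker1 (f w x - y))\<^sup>2 \<partial>Q) / 2"
        unfolding A_def by (rule bessel[where B=1]) (use abs_ker1_le in auto)
      from mult_left_mono[OF this, of "1 + y\<^sup>2"]
      show "(1 + y\<^sup>2) * (\<Sum>i\<in>I. (A i y w)\<^sup>2) \<le> 1/2 * ((1 + y\<^sup>2) * (\<integral>x. (ker1 (f w x - y))\<^sup>2 \<partial>Q))"
        by simp
    qed
    also have "\<dots> = ennreal (1/2) * ennreal ((1 + y\<^sup>2) * (\<integral>x. (ker1 (f w x - y))\<^sup>2 \<partial>Q))"
      by (rule ennreal_mult) auto
    also have "ennreal ((1 + y\<^sup>2) * (\<integral>x. (ker1 (f w x - y))\<^sup>2 \<partial>Q)) = (\<integral>\<^sup>+x. ennreal ((1 + y\<^sup>2) * (ker1 (f w x - y))\<^sup>2) \<partial>Q)"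
      by (rule weight_nn_integral_Q[where B=1]) (use abs_ker1_le in auto)
    finally show "(\<Sum>i\<in>I. ennreal ((1 + y\<^sup>2) * (A i y w)\<^sup>2)) \<le> ennreal (1/2) * (\<integral>\<^sup>+x. ennreal ((1 + y\<^sup>2) * (ker1 (f w x - y))\<^sup>2) \<partial>Q)" .
  qed
  also have "\<dots> = ennreal (1/2) * (\<integral>\<^sup>+w. (\<integral>\<^sup>+y. (\<integral>\<^sup>+x. ennreal ((1 + y\<^sup>2) * (ker1 (f w x - y))\<^sup>2) \<partial>Q) \<partial>lborel) \<partial>P)"
  proof -
    let ?k = "\<lambda>w y. \<integral>\<^sup>+x. ennreal ((1 + y\<^sup>2) * (ker1 (f w x - y))\<^sup>2) \<partial>Q"
    have "(\<integral>\<^sup>+w. (\<integral>\<^sup>+y. ennreal (1/2) * ?k w y \<partial>lborel) \<partial>P) = (\<integral>\<^sup>+w. ennreal (1/2) * (\<integral>\<^sup>+y. ?k w y \<partial>lborel) \<partial>P)"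
      by (intro nn_integral_cong nn_integral_cmult) measurable
    also have "\<dots> = ennreal (1/2) * (\<integral>\<^sup>+w. (\<integral>\<^sup>+y. ?k w y \<partial>lborel) \<partial>P)"
      by (rule nn_integral_cmult) measurable
    finally show ?thesis .
  qed
  also have "\<dots> \<le> ennreal (1/2) * ennreal (7/16)"
    by (intro mult_left_mono nn_integral_ker1_f) simp
  also have "\<dots> = ennreal (7/32)" by (subst ennreal_mult[symmetric]) auto
  finally show ?thesis .
qed

lemma nn_integral_A_upd:
  assumes i [measurable]: "i \<in> I"
  shows "(\<integral>\<^sup>+w. (\<integral>\<^sup>+y. ennreal ((1 + y\<^sup>2) * (A i y (w(i := 0)))\<^sup>2) \<partial>lborel) \<partial>P)
    \<le> 2 * (\<integral>\<^sup>+w. (\<integral>\<^sup>+y. ennreal ((1 + y\<^sup>2) * (A i y w)\<^sup>2) \<partial>lborel) \<partial>P) + ennreal (29/8 * c\<^sup>2)"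
proof -
  let ?q = "\<lambda>w y x. ker1 (f w x - y) - ker1 (f (w(i := 0)) x - y)"
  have "(\<integral>\<^sup>+w. (\<integral>\<^sup>+y. ennreal ((1 + y\<^sup>2) * (A i y (w(i := 0)))\<^sup>2) \<partial>lborel) \<partial>P)
    \<le> (\<integral>\<^sup>+w. (\<integral>\<^sup>+y. 2 * ennreal ((1 + y\<^sup>2) * (A i y w)\<^sup>2) + 2 * (\<integral>\<^sup>+x. ennreal ((1 + y\<^sup>2) * (?q w y x)\<^sup>2) \<partial>Q) \<partial>lborel) \<partial>P)"
  proof (intro nn_integral_mono)
    fix w y assume w [measurable]: "w \<in> space P"
    note v [measurable] = upd_in_space[OF i w]
    have q: "\<bar>?q w y x\<bar> \<le> 2" for x using abs_ker1_le[of "f w x - y"] abs_ker1_le[of "f (w(i := 0)) x - y"] by linarith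
    have "ennreal ((1 + y\<^sup>2) * (A i y (w(i := 0)))\<^sup>2) \<le> ennreal (2 * ((1 + y\<^sup>2) * (A i y w)\<^sup>2) + 2 * ((1 + y\<^sup>2) * (\<integral>x. (?q w y x)\<^sup>2 \<partial>Q)))"
      using mult_left_mono[OF A_upd_sq[OF i w, of y], of "1 + y\<^sup>2"] by (intro ennreal_leI) (simp only: distrib_left mult.left_commute[of _ 2] zero_le_power2 add_nonneg_nonneg zero_le_one simp_thms)
    also have "\<dots> = 2 * ennreal ((1 + y\<^sup>2) * (A i y w)\<^sup>2) + 2 * ennreal ((1 + y\<^sup>2) * (\<integral>x. (?q w y x)\<^sup>2 \<partial>Q))"
      by (simp add: ennreal_mult)
    also have "ennreal ((1 + y\<^sup>2) * (\<integral>x. (?q w y x)\<^sup>2 \<partial>Q)) = (\<integral>\<^sup>+x. ennreal ((1 + y\<^sup>2) * (?q w y x)\<^sup>2) \<partial>Q)"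
      by (rule weight_nn_integral_Q[OF _ q]) auto
    finally show "ennreal ((1 + y\<^sup>2) * (A i y (w(i := 0)))\<^sup>2) \<le> 2 * ennreal ((1 + y\<^sup>2) * (A i y w)\<^sup>2) + 2 * (\<integral>\<^sup>+x. ennreal ((1 + y\<^sup>2) * (?q w y x)\<^sup>2) \<partial>Q)" .
  qed
  also have "\<dots> = 2 * (\<integral>\<^sup>+w. (\<integral>\<^sup>+y. ennreal ((1 + y\<^sup>2) * (A i y w)\<^sup>2) \<partial>lborel) \<partial>P) +
      2 * (\<integral>\<^sup>+w. (\<integral>\<^sup>+y. (\<integral>\<^sup>+x. ennreal ((1 + y\<^sup>2) * (?q w y x)\<^sup>2) \<partial>Q) \<partial>lborel) \<partial>P)"
    (is "_ = 2 * (\<integral>\<^sup>+w. (\<integral>\<^sup>+y. ?a w y \<partial>lborel) \<partial>P) + 2 * (\<integral>\<^sup>+w. (\<integral>\<^sup>+y. ?b w y \<partial>lborel) \<partial>P)")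
  proof -
    have "(\<integral>\<^sup>+w. (\<integral>\<^sup>+y. 2 * ?a w y + 2 * ?b w y \<partial>lborel) \<partial>P) = (\<integral>\<^sup>+w. 2 * (\<integral>\<^sup>+y. ?a w y \<partial>lborel) + 2 * (\<integral>\<^sup>+y. ?b w y \<partial>lborel) \<partial>P)"
    proof (rule nn_integral_cong)
      fix w assume w [measurable]: "w \<in> space P"
      note v [measurable] = upd_in_space[OF i w]
      have m: "?a w \<in> borel_measurable borel" "?b w \<in> borel_measurable borel" by measurable
      show "(\<integral>\<^sup>+y. 2 * ?a w y + 2 * ?b w y \<partial>lborel) = 2 * (\<integral>\<^sup>+y. ?a w y \<partial>lborel) + 2 * (\<integral>\<^sup>+y. ?b w y \<partial>lborel)"
        by (rule nn_integral_linear2) (use m in simp_all)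
    qed
    also have "\<dots> = 2 * (\<integral>\<^sup>+w. (\<integral>\<^sup>+y. ?a w y \<partial>lborel) \<partial>P) + 2 * (\<integral>\<^sup>+w. (\<integral>\<^sup>+y. ?b w y \<partial>lborel) \<partial>P)"
    proof -
      have "(\<lambda>w. \<integral>\<^sup>+y. ?a w y \<partial>lborel) \<in> borel_measurable P" "(\<lambda>w. \<integral>\<^sup>+y. ?b w y \<partial>lborel) \<in> borel_measurable P"
        by measurable
      then show ?thesis by (rule nn_integral_linear2)
    qed
    finally show ?thesis .
  qed
  also have "\<dots> \<le> 2 * (\<integral>\<^sup>+w. (\<integral>\<^sup>+y. ennreal ((1 + y\<^sup>2) * (A i y w)\<^sup>2) \<partial>lborel) \<partial>P) + 2 * ennreal (29/16 * c\<^sup>2)"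
    by (intro add_left_mono mult_left_mono nn_integral_ker1_shift i) simp
  also have "2 * ennreal (29/16 * c\<^sup>2) = ennreal (29/8 * c\<^sup>2)"
    using ennreal_mult[of 2 "29/16 * c\<^sup>2"] by simp
  finally show ?thesis .
qed

text \<open>Independence separates (c w i)^2 from the Fourier coefficient at
  \<open>w(i := 0)\<close>; only afterwards is the coefficient moved back to \<open>w\<close>. In
  the reverse order, (w i)^2 would be multiplied by a quantity depending on
  \<open>w i\<close>.\<close>

lemma nn_integral_Z_diff:
  assumes i [measurable]: "i \<in> I"
  shows "(\<integral>\<^sup>+w. (\<integral>\<^sup>+y. ennreal ((1 + y\<^sup>2) * (Z y w - Z y (w(i := 0)))\<^sup>2) \<partial>lborel) \<partial>P)
    \<le> ennreal (8 * c\<^sup>2) * (\<integral>\<^sup>+w. (\<integral>\<^sup>+y. ennreal ((1 + y\<^sup>2) * (A i y w)\<^sup>2) \<partial>lborel) \<partial>P)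
       + ennreal (29/2 * c^4 + 17/36 * c^4 * (\<integral>y. y^4 \<partial>\<mu>))"
proof -
  let ?R = "\<lambda>w y x. ker_rem (c * w i * e i x) (f (w(i := 0)) x - y)"
  let ?b = "\<lambda>w y. \<integral>\<^sup>+x. ennreal ((1 + y\<^sup>2) * (?R w y x)\<^sup>2) \<partial>Q"
  let ?a = "\<lambda>w y. ennreal ((1 + y\<^sup>2) * (A i y (w(i := 0)))\<^sup>2)"
  define H where "H w = (\<integral>\<^sup>+y. ennreal ((1 + y\<^sup>2) * (A i y w)\<^sup>2) \<partial>lborel)" for w
  have [measurable]: "H \<in> borel_measurable P" unfolding H_def by measurable
  have wi [measurable]: "(\<lambda>w. w i) \<in> borel_measurable P" by (rule coord_measurable_fst(1)[OF i])
  have "(\<integral>\<^sup>+w. (\<integral>\<^sup>+y. ennreal ((1 + y\<^sup>2) * (Z y w - Z y (w(i := 0)))\<^sup>2) \<partial>lborel) \<partial>P)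
    \<le> (\<integral>\<^sup>+w. (\<integral>\<^sup>+y. ennreal (4 * (c * w i)\<^sup>2) * ?a w y + ennreal (4/3) * ?b w y \<partial>lborel) \<partial>P)"
  proof (intro nn_integral_mono)
    fix w y assume w [measurable]: "w \<in> space P"
    note v [measurable] = upd_in_space[OF i w]
    have R: "\<bar>?R w y x\<bar> \<le> 2 + \<bar>c * w i\<bar>" for x
      by (rule order.trans[OF abs_ker_rem_le]) (use e_le[of i x] in \<open>simp add: abs_mult mult_left_le\<close>)
    have "(1 + y\<^sup>2) * (Z y w - Z y (w(i := 0)))\<^sup>2 \<le>
        4 * (c * w i)\<^sup>2 * ((1 + y\<^sup>2) * (A i y (w(i := 0)))\<^sup>2) + 4/3 * ((1 + y\<^sup>2) * (\<integral>x. (?R w y x)\<^sup>2 \<partial>Q))"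
      (is "?l \<le> ?r1 + ?r2")
    proof -
      have "?l \<le> (1 + y\<^sup>2) * (4 * ((c * w i)\<^sup>2 * (A i y (w(i := 0)))\<^sup>2) + 4/3 * (\<integral>x. (?R w y x)\<^sup>2 \<partial>Q))"
        by (rule mult_left_mono[OF Z_diff_sq[OF i w]]) simp
      also have "\<dots> = ?r1 + ?r2" by (simp only: distrib_left mult_ac)
      finally show ?thesis .
    qed
    then have "ennreal ?l \<le> ennreal (?r1 + ?r2)" by (rule ennreal_leI)
    also have "\<dots> = ennreal ?r1 + ennreal ?r2" by (intro ennreal_plus) auto
    also have "ennreal ?r1 = ennreal (4 * (c * w i)\<^sup>2) * ?a w y" by (rule ennreal_mult) auto
    also have "ennreal ?r2 = ennreal (4/3) * ennreal ((1 + y\<^sup>2) * (\<integral>x. (?R w y x)\<^sup>2 \<partial>Q))" by (rule ennreal_mult) auto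
    also have "ennreal ((1 + y\<^sup>2) * (\<integral>x. (?R w y x)\<^sup>2 \<partial>Q)) = ?b w y"
      by (rule weight_nn_integral_Q[OF _ R]) auto
    finally show "ennreal ?l \<le> ennreal (4 * (c * w i)\<^sup>2) * ?a w y + ennreal (4/3) * ?b w y" .
  qed
  also have "\<dots> = (\<integral>\<^sup>+w. 4 * (ennreal ((c * w i)\<^sup>2) * H (w(i := 0))) + ennreal (4/3) * (\<integral>\<^sup>+y. ?b w y \<partial>lborel) \<partial>P)"
  proof (rule nn_integral_cong)
    fix w assume w [measurable]: "w \<in> space P"
    note v [measurable] = upd_in_space[OF i w]
    have m: "?a w \<in> borel_measurable borel" "?b w \<in> borel_measurable borel" by measurable
    have "(\<integral>\<^sup>+y. ennreal (4 * (c * w i)\<^sup>2) * ?a w y + ennreal (4/3) * ?b w y \<partial>lborel) =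
        ennreal (4 * (c * w i)\<^sup>2) * (\<integral>\<^sup>+y. ?a w y \<partial>lborel) + ennreal (4/3) * (\<integral>\<^sup>+y. ?b w y \<partial>lborel)"
      by (rule nn_integral_linear2) (use m in simp_all)
    also have "\<dots> = 4 * (ennreal ((c * w i)\<^sup>2) * H (w(i := 0))) + ennreal (4/3) * (\<integral>\<^sup>+y. ?b w y \<partial>lborel)"
    proof -
      have 4: "ennreal (4 * (c * w i)\<^sup>2) = 4 * ennreal ((c * w i)\<^sup>2)" by (simp add: ennreal_mult)
      show ?thesis unfolding 4 H_def by (simp only: mult.assoc)
    qed
    finally show "(\<integral>\<^sup>+y. ennreal (4 * (c * w i)\<^sup>2) * ?a w y + ennreal (4/3) * ?b w y \<partial>lborel) =
        4 * (ennreal ((c * w i)\<^sup>2) * H (w(i := 0))) + ennreal (4/3) * (\<integral>\<^sup>+y. ?b w y \<partial>lborel)" .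
  qed
  also have "\<dots> = 4 * (\<integral>\<^sup>+w. ennreal ((c * w i)\<^sup>2) * H (w(i := 0)) \<partial>P) + ennreal (4/3) * (\<integral>\<^sup>+w. (\<integral>\<^sup>+y. ?b w y \<partial>lborel) \<partial>P)"
    by (rule nn_integral_linear2) measurable
  also have "(\<integral>\<^sup>+w. ennreal ((c * w i)\<^sup>2) * H (w(i := 0)) \<partial>P) = (\<integral>\<^sup>+y. ennreal ((c * y)\<^sup>2) \<partial>\<mu>) * (\<integral>\<^sup>+w. H (w(i := 0)) \<partial>P)"
    by (rule PF.nn_integral_PiM_coord_times[OF finite_I i]) simp_all
  also have "(\<integral>\<^sup>+y. ennreal ((c * y)\<^sup>2) \<partial>\<mu>) = ennreal (c\<^sup>2)"
    using nn_integral_affine_sq[of 0 c] by simp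
  also have "4 * (ennreal (c\<^sup>2) * (\<integral>\<^sup>+w. H (w(i := 0)) \<partial>P)) + ennreal (4/3) * (\<integral>\<^sup>+w. (\<integral>\<^sup>+y. ?b w y \<partial>lborel) \<partial>P)
     \<le> 4 * (ennreal (c\<^sup>2) * (2 * (\<integral>\<^sup>+w. H w \<partial>P) + ennreal (29/8 * c\<^sup>2))) + ennreal (4/3) * ennreal (17/48 * c^4 * (\<integral>y. y^4 \<partial>\<mu>))"
    unfolding H_def by (intro add_mono mult_left_mono nn_integral_A_upd nn_integral_rem i) simp_all
  also have "\<dots> = ennreal (8 * c\<^sup>2) * (\<integral>\<^sup>+w. H w \<partial>P) + ennreal (29/2 * c^4 + 17/36 * c^4 * (\<integral>y. y^4 \<partial>\<mu>))"
  proof -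
    have "ennreal (4 * (c\<^sup>2 * (29/8 * c\<^sup>2))) = ennreal 4 * ennreal (c\<^sup>2 * (29/8 * c\<^sup>2))" by (rule ennreal_mult) auto
    also have "ennreal (c\<^sup>2 * (29/8 * c\<^sup>2)) = ennreal (c\<^sup>2) * ennreal (29/8 * c\<^sup>2)" by (rule ennreal_mult) auto
    also have "4 * (c\<^sup>2 * (29/8 * c\<^sup>2)) = 29/2 * c^4" by (simp add: power4_eq_xxxx power2_eq_square)
    finally have 1: "4 * (ennreal (c\<^sup>2) * ennreal (29/8 * c\<^sup>2)) = ennreal (29/2 * c^4)" by simp
    have 2: "ennreal (4/3) * ennreal (17/48 * c^4 * (\<integral>y. y^4 \<partial>\<mu>)) = ennreal (17/36 * c^4 * (\<integral>y. y^4 \<partial>\<mu>))"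
      by (subst ennreal_mult[symmetric]) auto
    have 3: "4 * (ennreal (c\<^sup>2) * (2 * X)) = ennreal (8 * c\<^sup>2) * X" for X
      by (simp add: ennreal_mult mult_ac)
    have 4: "ennreal (29/2 * c^4 + 17/36 * c^4 * (\<integral>y. y^4 \<partial>\<mu>)) = ennreal (29/2 * c^4) + ennreal (17/36 * c^4 * (\<integral>y. y^4 \<partial>\<mu>))"
      by (rule ennreal_plus) auto
    show ?thesis unfolding distrib_left 1 2 3 4 by (simp only: add.assoc)
  qed
  finally show ?thesis unfolding H_def .
qed

lemma sum_nn_integral_Z_diff:
  "(\<Sum>i\<in>I. \<integral>\<^sup>+w. (\<integral>\<^sup>+y. ennreal ((1 + y\<^sup>2) * (Z y w - Z y (w(i := 0)))\<^sup>2) \<partial>lborel) \<partial>P)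
    \<le> ennreal (c\<^sup>2 * (123/4 + 17/18 * (\<integral>y. y^4 \<partial>\<mu>)))"
proof -
  let ?m = "\<integral>y. y^4 \<partial>\<mu>"
  have "(\<Sum>i\<in>I. \<integral>\<^sup>+w. (\<integral>\<^sup>+y. ennreal ((1 + y\<^sup>2) * (Z y w - Z y (w(i := 0)))\<^sup>2) \<partial>lborel) \<partial>P)
    \<le> (\<Sum>i\<in>I. ennreal (8 * c\<^sup>2) * (\<integral>\<^sup>+w. (\<integral>\<^sup>+y. ennreal ((1 + y\<^sup>2) * (A i y w)\<^sup>2) \<partial>lborel) \<partial>P)
       + ennreal (29/2 * c^4 + 17/36 * c^4 * ?m))"
    by (intro sum_mono nn_integral_Z_diff)
  also have "\<dots> = ennreal (8 * c\<^sup>2) * (\<Sum>i\<in>I. \<integral>\<^sup>+w. (\<integral>\<^sup>+y. ennreal ((1 + y\<^sup>2) * (A i y w)\<^sup>2) \<partial>lborel) \<partial>P)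
       + of_nat (card I) * ennreal (29/2 * c^4 + 17/36 * c^4 * ?m)"
    by (simp only: sum.distrib sum_constant sum_distrib_left)
  also have "\<dots> \<le> ennreal (8 * c\<^sup>2) * ennreal (7/32) + of_nat (card I) * ennreal (29/2 * c^4 + 17/36 * c^4 * ?m)"
    by (intro add_mono mult_left_mono sum_nn_integral_A) auto
  also have "\<dots> = ennreal (8 * c\<^sup>2 * (7/32) + real (card I) * (29/2 * c^4 + 17/36 * c^4 * ?m))"
  proof -
    have mult_add: "ennreal a * ennreal b + of_nat k * ennreal d = ennreal (a * b + real k * d)" if "0 \<le> a" "0 \<le> b" "0 \<le> d" for a b d k
      using that by (simp add: ennreal_of_nat_eq_real_of_nat ennreal_mult[symmetric] ennreal_plus[symmetric] del: ennreal_plus)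
    show ?thesis by (rule mult_add) auto
  qed
  \<comment> \<open>There are 2n coordinates and c^2 = 1/n, so the terms with c^4 sum to order c^2;
    123/4 = 7/4 + 29.\<close>
  also have "8 * c\<^sup>2 * (7/32) + real (card I) * (29/2 * c^4 + 17/36 * c^4 * ?m) =
      8 * c\<^sup>2 * (7/32) + (real (card I) * c\<^sup>2) * c\<^sup>2 * (29/2 + 17/36 * ?m)"
    by (simp add: power4_eq_xxxx power2_eq_square algebra_simps)
  also have "\<dots> = c\<^sup>2 * (123/4 + 17/18 * ?m)"
    unfolding card_I by (simp add: algebra_simps)
  finally show ?thesis .
qed

end

section \<open>From the weighted variance to the L1 fluctuation\<close>

lemma nn_integral_Cauchy_density: "(\<integral>\<^sup>+y. ennreal (1 / (1 + y\<^sup>2)) \<partial>lborel) = ennreal pi"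
proof (rule nn_integral_real_split[where p="\<lambda>y. 1 / (1 + y\<^sup>2)" and q="\<lambda>y. 1 / (1 + y\<^sup>2)"
      and P="\<lambda>y. arctan y - pi/2" and Q="\<lambda>y. arctan y - pi/2"])
  show "((\<lambda>y::real. arctan y - pi/2) \<longlongrightarrow> 0) at_top" by real_asymp
  show "((\<lambda>y::real. arctan y - pi/2) \<longlongrightarrow> 0) at_top" by real_asymp
  show "((\<lambda>y. arctan y - pi / 2) has_real_derivative 1 / (1 + x\<^sup>2)) (at x)" for x
    using DERIV_diff[OF DERIV_arctan[of x] DERIV_const[of "pi/2"]] by (simp add: inverse_eq_divide)
  show "((\<lambda>y. arctan y - pi / 2) has_real_derivative 1 / (1 + x\<^sup>2)) (at x)" for x
    using DERIV_diff[OF DERIV_arctan[of x] DERIV_const[of "pi/2"]] by (simp add: inverse_eq_divide)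
qed auto

context rand_sum
begin

text \<open>Holds for every \<open>w\<close>, as \<open>efron_stein\<close> requires; where the
  integrand is not measurable the integral is 0 by convention.\<close>

lemma abs_Z_le: "\<bar>Z y w\<bar> \<le> 1"
proof (cases "(\<lambda>x. ker (f w x - y)) \<in> borel_measurable Q")
  case True
  then show ?thesis unfolding Z_def by (rule Q.abs_integral_le) (rule abs_ker_le)
next
  case False
  then have "\<not> integrable Q (\<lambda>x. ker (f w x - y))" by auto
  then show ?thesis by (simp add: Z_def not_integrable_integral_eq)
qed

definition EZ :: "real \<Rightarrow> real" where "EZ y = (\<integral>w. Z y w \<partial>P)"

lemma EZ_measurable [measurable]: "EZ \<in> borel_measurable borel"
  unfolding EZ_def by measurable

lemma variance_Z_le:
  "(\<integral>\<^sup>+w. ennreal ((Z y w - EZ y)\<^sup>2) \<partial>P) \<le> (\<Sum>i\<in>I. \<integral>\<^sup>+w. ennreal ((Z y w - Z y (w(i := 0)))\<^sup>2) \<partial>P)"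
proof -
  have Z2: "\<bar>(Z y w)\<^sup>2\<bar> \<le> 1" for w using power_mono[OF abs_Z_le[of y w], of 2] by simp
  have m [measurable]: "Z y \<in> borel_measurable P" by measurable
  have D: "integrable P (\<lambda>w. (Z y w - b w)\<^sup>2)" if [measurable]: "b \<in> borel_measurable P" and b: "\<And>w. \<bar>b w\<bar> \<le> 1" for b
  proof (rule P.integrable_bounded[where B="2\<^sup>2"])
    fix w
    have "\<bar>Z y w - b w\<bar> \<le> 2" using abs_Z_le[of y w] b[of w] by linarith
    from power_mono[OF this, of 2] show "\<bar>(Z y w - b w)\<^sup>2\<bar> \<le> 2\<^sup>2" by simp
  qed measurable
  have i1: "integrable P (Z y)" by (rule P.integrable_bounded[OF m abs_Z_le])
  have i2: "integrable P (\<lambda>w. (Z y w)\<^sup>2)" by (rule P.integrable_bounded[OF _ Z2]) measurable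
  have EZ: "\<bar>EZ y\<bar> \<le> 1" unfolding EZ_def by (rule P.abs_integral_le[OF m abs_Z_le])
  have "(\<integral>\<^sup>+w. ennreal ((Z y w - EZ y)\<^sup>2) \<partial>P) = ennreal (\<integral>w. (Z y w - EZ y)\<^sup>2 \<partial>P)"
    by (rule nn_integral_eq_integral) (use D[of "\<lambda>_. EZ y"] EZ in auto)
  also have "(\<integral>w. (Z y w - EZ y)\<^sup>2 \<partial>P) = (\<integral>w. (Z y w)\<^sup>2 \<partial>P) - (\<integral>w. Z y w \<partial>P)\<^sup>2"
    unfolding EZ_def by (rule P.variance_eq[OF i1 i2])
  also have "\<dots> \<le> (\<Sum>i\<in>I. \<integral>w. (Z y w - Z y (w(i := 0)))\<^sup>2 \<partial>P)"
    by (rule PF.efron_stein[OF finite_I _ m abs_Z_le]) simp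
  also have "ennreal \<dots> = (\<Sum>i\<in>I. ennreal (\<integral>w. (Z y w - Z y (w(i := 0)))\<^sup>2 \<partial>P))"
    by (rule sum_ennreal[symmetric]) simp
  also have "\<dots> = (\<Sum>i\<in>I. \<integral>\<^sup>+w. ennreal ((Z y w - Z y (w(i := 0)))\<^sup>2) \<partial>P)"
  proof (rule sum.cong[OF refl])
    fix i assume [measurable]: "i \<in> I"
    have "integrable P (\<lambda>w. (Z y w - Z y (w(i := 0)))\<^sup>2)"
      by (rule D) (measurable, rule abs_Z_le)
    then show "ennreal (\<integral>w. (Z y w - Z y (w(i := 0)))\<^sup>2 \<partial>P) = (\<integral>\<^sup>+w. ennreal ((Z y w - Z y (w(i := 0)))\<^sup>2) \<partial>P)"
      by (intro nn_integral_eq_integral[symmetric]) auto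
  qed
  finally show ?thesis by (simp add: ennreal_leI)
qed

definition K :: real where "K = 123/4 + 17/18 * (\<integral>y. y^4 \<partial>\<mu>)"

lemma K_pos: "0 < K"
proof -
  have "0 \<le> (\<integral>y. y^4 \<partial>\<mu>)" by simp
  then show ?thesis unfolding K_def by linarith
qed

lemma nn_integral_weighted_variance:
  "(\<integral>\<^sup>+w. (\<integral>\<^sup>+y. ennreal ((1 + y\<^sup>2) * (Z y w - EZ y)\<^sup>2) \<partial>lborel) \<partial>P) \<le> ennreal (c\<^sup>2 * K)"
proof -
  have split: "ennreal ((1 + y\<^sup>2) * v\<^sup>2) = ennreal (1 + y\<^sup>2) * ennreal (v\<^sup>2)" for y v :: real
    by (rule ennreal_mult) auto
  have "(\<integral>\<^sup>+w. (\<integral>\<^sup>+y. ennreal ((1 + y\<^sup>2) * (Z y w - EZ y)\<^sup>2) \<partial>lborel) \<partial>P) =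
      (\<integral>\<^sup>+y. (\<integral>\<^sup>+w. ennreal (1 + y\<^sup>2) * ennreal ((Z y w - EZ y)\<^sup>2) \<partial>P) \<partial>lborel)"
    unfolding split by (rule PL.Fubini'[symmetric]) measurable
  also have "\<dots> = (\<integral>\<^sup>+y. ennreal (1 + y\<^sup>2) * (\<integral>\<^sup>+w. ennreal ((Z y w - EZ y)\<^sup>2) \<partial>P) \<partial>lborel)"
    by (intro nn_integral_cong nn_integral_cmult) measurable
  also have "\<dots> \<le> (\<integral>\<^sup>+y. ennreal (1 + y\<^sup>2) * (\<Sum>i\<in>I. \<integral>\<^sup>+w. ennreal ((Z y w - Z y (w(i := 0)))\<^sup>2) \<partial>P) \<partial>lborel)"
    by (intro nn_integral_mono mult_left_mono variance_Z_le) simp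
  also have "\<dots> = (\<integral>\<^sup>+y. (\<Sum>i\<in>I. \<integral>\<^sup>+w. ennreal ((1 + y\<^sup>2) * (Z y w - Z y (w(i := 0)))\<^sup>2) \<partial>P) \<partial>lborel)"
    unfolding sum_distrib_left split by (intro nn_integral_cong sum.cong refl nn_integral_cmult[symmetric]) measurable
  also have "\<dots> = (\<Sum>i\<in>I. \<integral>\<^sup>+y. (\<integral>\<^sup>+w. ennreal ((1 + y\<^sup>2) * (Z y w - Z y (w(i := 0)))\<^sup>2) \<partial>P) \<partial>lborel)"
    by (rule nn_integral_sum) measurable
  also have "\<dots> = (\<Sum>i\<in>I. \<integral>\<^sup>+w. (\<integral>\<^sup>+y. ennreal ((1 + y\<^sup>2) * (Z y w - Z y (w(i := 0)))\<^sup>2) \<partial>lborel) \<partial>P)"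
    by (intro sum.cong refl PL.Fubini') measurable
  also have "\<dots> \<le> ennreal (c\<^sup>2 * K)" unfolding K_def by (rule sum_nn_integral_Z_diff)
  finally show ?thesis .
qed

text \<open>The L1 distance in y between the smoothed law of f w under \<open>Q\<close> and its
  mean. No test function occurs in it.\<close>

definition T :: "('i \<Rightarrow> real) \<Rightarrow> ennreal" where
  "T w = (\<integral>\<^sup>+y. ennreal \<bar>Z y w - EZ y\<bar> \<partial>lborel)"

lemma T_measurable [measurable]: "T \<in> borel_measurable P"
  unfolding T_def by measurable

text \<open>Cauchy-Schwarz against the density 1/(1 + y^2) in its arithmetic-geometric form. The
  free parameter \<open>\<gamma>\<close> allows a choice for which the final bound is linear in the
  square root of the fourth moment.\<close>

lemma nn_integral_T_le:
  assumes \<gamma>: "0 < \<gamma>"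
  shows "(\<integral>\<^sup>+w. T w \<partial>P) \<le> ennreal (c * (\<gamma> * pi + K / \<gamma>) / 2)"
proof -
  \<comment> \<open>The weighted variance is of order c^2, so a parameter proportional to c balances
    the two halves.\<close>
  define \<epsilon> where "\<epsilon> = c * \<gamma>"
  have \<epsilon>: "0 < \<epsilon>" using c_pos \<gamma> by (simp add: \<epsilon>_def)
  have amgm: "ennreal \<bar>v\<bar> \<le> ennreal (\<epsilon> / 2) * ennreal (1 / (1 + y\<^sup>2)) + ennreal (1 / (2 * \<epsilon>)) * ennreal ((1 + y\<^sup>2) * v\<^sup>2)" for v y :: real
  proof -
    have y: "0 < 1 + y\<^sup>2" by (simp add: add_pos_nonneg)
    have "0 \<le> (\<epsilon> - (1 + y\<^sup>2) * \<bar>v\<bar>)\<^sup>2" by simp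
    then have "2 * \<epsilon> * (1 + y\<^sup>2) * \<bar>v\<bar> \<le> \<epsilon>\<^sup>2 + ((1 + y\<^sup>2) * \<bar>v\<bar>)\<^sup>2" by (simp add: power2_diff)
    also have "((1 + y\<^sup>2) * \<bar>v\<bar>)\<^sup>2 = (1 + y\<^sup>2)\<^sup>2 * v\<^sup>2" by (simp add: power_mult_distrib)
    finally have "\<bar>v\<bar> \<le> (\<epsilon>\<^sup>2 + (1 + y\<^sup>2)\<^sup>2 * v\<^sup>2) / (2 * \<epsilon> * (1 + y\<^sup>2))"
      using \<epsilon> y by (simp add: pos_le_divide_eq mult.commute)
    also have "\<dots> = \<epsilon> / 2 * (1 / (1 + y\<^sup>2)) + 1 / (2 * \<epsilon>) * ((1 + y\<^sup>2) * v\<^sup>2)"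
      using \<epsilon> y by (simp add: add_divide_distrib power2_eq_square)
    finally have "ennreal \<bar>v\<bar> \<le> ennreal (\<epsilon> / 2 * (1 / (1 + y\<^sup>2)) + 1 / (2 * \<epsilon>) * ((1 + y\<^sup>2) * v\<^sup>2))"
      by (rule ennreal_leI)
    also have "\<dots> = ennreal (\<epsilon> / 2 * (1 / (1 + y\<^sup>2))) + ennreal (1 / (2 * \<epsilon>) * ((1 + y\<^sup>2) * v\<^sup>2))"
      using \<epsilon> by (intro ennreal_plus) auto
    also have "ennreal (\<epsilon> / 2 * (1 / (1 + y\<^sup>2))) = ennreal (\<epsilon> / 2) * ennreal (1 / (1 + y\<^sup>2))"
      using \<epsilon> by (intro ennreal_mult) auto
    also have "ennreal (1 / (2 * \<epsilon>) * ((1 + y\<^sup>2) * v\<^sup>2)) = ennreal (1 / (2 * \<epsilon>)) * ennreal ((1 + y\<^sup>2) * v\<^sup>2)"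
      using \<epsilon> by (intro ennreal_mult) auto
    finally show ?thesis .
  qed
  have "(\<integral>\<^sup>+w. T w \<partial>P) \<le> (\<integral>\<^sup>+w. (\<integral>\<^sup>+y. ennreal (\<epsilon> / 2) * ennreal (1 / (1 + y\<^sup>2)) + ennreal (1 / (2 * \<epsilon>)) * ennreal ((1 + y\<^sup>2) * (Z y w - EZ y)\<^sup>2) \<partial>lborel) \<partial>P)"
    unfolding T_def by (intro nn_integral_mono amgm)
  also have "\<dots> = (\<integral>\<^sup>+w. ennreal (\<epsilon> / 2) * ennreal pi + ennreal (1 / (2 * \<epsilon>)) * (\<integral>\<^sup>+y. ennreal ((1 + y\<^sup>2) * (Z y w - EZ y)\<^sup>2) \<partial>lborel) \<partial>P)"
  proof (rule nn_integral_cong)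
    fix w assume [measurable]: "w \<in> space P"
    show "(\<integral>\<^sup>+y. ennreal (\<epsilon> / 2) * ennreal (1 / (1 + y\<^sup>2)) + ennreal (1 / (2 * \<epsilon>)) * ennreal ((1 + y\<^sup>2) * (Z y w - EZ y)\<^sup>2) \<partial>lborel)
      = ennreal (\<epsilon> / 2) * ennreal pi + ennreal (1 / (2 * \<epsilon>)) * (\<integral>\<^sup>+y. ennreal ((1 + y\<^sup>2) * (Z y w - EZ y)\<^sup>2) \<partial>lborel)"
      unfolding nn_integral_Cauchy_density[symmetric] by (rule nn_integral_linear2) measurable
  qed
  also have "\<dots> = ennreal (\<epsilon> / 2) * ennreal pi + ennreal (1 / (2 * \<epsilon>)) * (\<integral>\<^sup>+w. (\<integral>\<^sup>+y. ennreal ((1 + y\<^sup>2) * (Z y w - EZ y)\<^sup>2) \<partial>lborel) \<partial>P)"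
    by (subst nn_integral_linear2) (measurable, simp add: P.emeasure_space_1)
  also have "\<dots> \<le> ennreal (\<epsilon> / 2) * ennreal pi + ennreal (1 / (2 * \<epsilon>)) * ennreal (c\<^sup>2 * K)"
    by (intro add_mono mult_left_mono nn_integral_weighted_variance) auto
  also have "\<dots> = ennreal (\<epsilon> / 2 * pi + 1 / (2 * \<epsilon>) * (c\<^sup>2 * K))"
    using \<epsilon> K_pos by (simp add: ennreal_mult[symmetric] ennreal_plus[symmetric] del: ennreal_plus)
  also have "\<epsilon> / 2 * pi + 1 / (2 * \<epsilon>) * (c\<^sup>2 * K) = c * (\<gamma> * pi + K / \<gamma>) / 2"
    using c_pos \<gamma> by (simp add: \<epsilon>_def field_simps power2_eq_square)
  finally show ?thesis .
qed

end

text \<open>Stated for an arbitrary probability space because it is applied to \<open>Q\<close>,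
  with the coefficients fixed, and to the product with \<open>P\<close>, for the mean.\<close>

lemma (in prob_space) has_bochner_integral_ker_representation:
  assumes \<phi>: "\<phi> \<in> C3_test" and U [measurable]: "U \<in> borel_measurable M"
  shows "has_bochner_integral lborel (\<lambda>y. ker_op \<phi> y * (\<integral>u. ker (U u - y) \<partial>M)) (\<integral>u. \<phi> (U u) \<partial>M)"
proof -
  interpret KL: pair_sigma_finite M "lborel :: real measure" ..
  note [measurable] = ker_op_measurable[OF \<phi>]
  have "integrable (M \<Otimes>\<^sub>M lborel) (\<lambda>(u, y). ker (U u - y) * ker_op \<phi> y)"
  proof (rule KL.Fubini_integrable)
    have le: "(\<integral>y. norm (ker (U u - y) * ker_op \<phi> y) \<partial>lborel) \<le> 4" for u
    proof -
      have "(\<integral>y. norm (ker (U u - y) * ker_op \<phi> y) \<partial>lborel) \<le> (\<integral>y. ker (U u - y) * 4 \<partial>lborel)"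
      proof (rule integral_mono)
        show "integrable lborel (\<lambda>y. norm (ker (U u - y) * ker_op \<phi> y))"
          using has_bochner_integral_ker_ker_op[OF \<phi>, of "U u"] by (intro integrable_norm) (simp add: has_bochner_integral_iff)
        show "integrable lborel (\<lambda>y. ker (U u - y) * 4)"
          using has_bochner_integral_ker[of "U u"] by (simp add: has_bochner_integral_iff)
        show "norm (ker (U u - y) * ker_op \<phi> y) \<le> ker (U u - y) * 4" for y
          using abs_ker_op_le[OF \<phi>, of y] ker_nonneg[of "U u - y"] by (simp add: abs_mult mult_left_mono)
      qed
      also have "\<dots> = 4" using has_bochner_integral_ker[of "U u"] by (simp add: has_bochner_integral_iff)
      finally show ?thesis .
    qed
    show "integrable M (\<lambda>u. \<integral>y. norm (case (u, y) of (u, y) \<Rightarrow> ker (U u - y) * ker_op \<phi> y) \<partial>lborel)"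
      by (rule integrable_bounded[where B=4]) (use le in auto)
    show "AE u in M. integrable lborel (\<lambda>y. case (u, y) of (u, y) \<Rightarrow> ker (U u - y) * ker_op \<phi> y)"
      using has_bochner_integral_ker_ker_op[OF \<phi>] by (auto simp: has_bochner_integral_iff)
  qed measurable
  note int = this
  have "(\<integral>y. (\<integral>u. ker (U u - y) * ker_op \<phi> y \<partial>M) \<partial>lborel) = (\<integral>u. (\<integral>y. ker (U u - y) * ker_op \<phi> y \<partial>lborel) \<partial>M)"
    using KL.Fubini_integral[OF int] by simp
  also have "\<dots> = (\<integral>u. \<phi> (U u) \<partial>M)"
    using has_bochner_integral_ker_ker_op[OF \<phi>] by (simp add: has_bochner_integral_iff)
  finally show ?thesis
    using KL.integrable_snd[OF int] by (simp add: has_bochner_integral_iff mult.commute)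
qed

context rand_sum
begin

lemma EZ_eq: "EZ y = (\<integral>p. ker (f (fst p) (snd p) - y) \<partial>(P \<Otimes>\<^sub>M Q))"
  unfolding EZ_def Z_def
  by (subst PQ.integral_fst'[symmetric]) (auto intro!: PQ.integrable_bounded[where B=1] abs_ker_le)

text \<open>Both integrals are represented with the same function \<open>ker_op \<phi>\<close>, so
  their difference pairs it with Z - EZ; its bound 4 then leaves a right-hand side that does not
  depend on \<open>\<phi>\<close>.\<close>

lemma fluctuation_le:
  assumes \<phi>: "\<phi> \<in> C3_test" and w [measurable]: "w \<in> space P"
  shows "ennreal \<bar>(\<integral>x. \<phi> (f w x) \<partial>Q) - (\<integral>p. \<phi> (f (fst p) (snd p)) \<partial>(P \<Otimes>\<^sub>M Q))\<bar> \<le> 4 * T w"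
proof -
  note [measurable] = ker_op_measurable[OF \<phi>]
  have 1: "has_bochner_integral lborel (\<lambda>y. ker_op \<phi> y * Z y w) (\<integral>x. \<phi> (f w x) \<partial>Q)"
    unfolding Z_def by (rule Q.has_bochner_integral_ker_representation[OF \<phi>]) measurable
  have 2: "has_bochner_integral lborel (\<lambda>y. ker_op \<phi> y * EZ y) (\<integral>p. \<phi> (f (fst p) (snd p)) \<partial>(P \<Otimes>\<^sub>M Q))"
    unfolding EZ_eq by (rule PQ.has_bochner_integral_ker_representation[OF \<phi>]) measurable
  have 3: "has_bochner_integral lborel (\<lambda>y. ker_op \<phi> y * (Z y w - EZ y)) ((\<integral>x. \<phi> (f w x) \<partial>Q) - (\<integral>p. \<phi> (f (fst p) (snd p)) \<partial>(P \<Otimes>\<^sub>M Q)))"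
    using has_bochner_integral_diff[OF 1 2] by (simp add: right_diff_distrib)
  have "ennreal \<bar>(\<integral>x. \<phi> (f w x) \<partial>Q) - (\<integral>p. \<phi> (f (fst p) (snd p)) \<partial>(P \<Otimes>\<^sub>M Q))\<bar> \<le> (\<integral>\<^sup>+y. ennreal \<bar>ker_op \<phi> y * (Z y w - EZ y)\<bar> \<partial>lborel)"
    using integral_norm_bound_ennreal[of lborel "\<lambda>y. ker_op \<phi> y * (Z y w - EZ y)"] 3 by (simp add: has_bochner_integral_iff)
  also have "\<dots> \<le> (\<integral>\<^sup>+y. 4 * ennreal \<bar>Z y w - EZ y\<bar> \<partial>lborel)"
  proof (rule nn_integral_mono)
    fix y
    have "\<bar>ker_op \<phi> y * (Z y w - EZ y)\<bar> \<le> 4 * \<bar>Z y w - EZ y\<bar>"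
      unfolding abs_mult by (intro mult_right_mono abs_ker_op_le[OF \<phi>]) simp
    then have "ennreal \<bar>ker_op \<phi> y * (Z y w - EZ y)\<bar> \<le> ennreal (4 * \<bar>Z y w - EZ y\<bar>)" by (rule ennreal_leI)
    then show "ennreal \<bar>ker_op \<phi> y * (Z y w - EZ y)\<bar> \<le> 4 * ennreal \<bar>Z y w - EZ y\<bar>" by (simp add: ennreal_mult)
  qed
  also have "\<dots> = 4 * T w"
    unfolding T_def by (rule nn_integral_cmult) measurable
  finally show ?thesis .
qed

text \<open>Lindeberg's bound holds for each x separately and is then averaged over x. The cubes sum
  to at most c because every weight is at most c and the squares sum to 1.\<close>

lemma bias_le:
  assumes \<phi>: "\<phi> \<in> C3_test"
  shows "\<bar>(\<integral>p. \<phi> (f (fst p) (snd p)) \<partial>(P \<Otimes>\<^sub>M Q)) - (\<integral>z. \<phi> z \<partial>std_normal_distribution)\<bar> \<le> c * ((\<integral>x. \<bar>x\<bar>^3 \<partial>\<mu>) + 2) / 6"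
proof -
  have [measurable]: "\<phi> \<in> borel_measurable borel" using C3_test_measurable[OF \<phi>, of 0] by simp
  have B: "\<bar>\<phi> x\<bar> \<le> 1" for x using C3_test_bound[OF \<phi>, of 0] by simp
  let ?E = "\<lambda>x. \<integral>w. \<phi> (f w x) \<partial>P"
  have int: "integrable (P \<Otimes>\<^sub>M Q) (\<lambda>p. \<phi> (f (fst p) (snd p)))"
    by (rule PQ.integrable_bounded[where B=1]) (auto intro: B)
  have "(\<integral>p. \<phi> (f (fst p) (snd p)) \<partial>(P \<Otimes>\<^sub>M Q)) = (\<integral>x. ?E x \<partial>Q)"
    using PQ.integral_snd[of "\<lambda>w x. \<phi> (f w x)"] int by (simp add: case_prod_beta')
  moreover have "(\<integral>x. ?E x \<partial>Q) - (\<integral>z. \<phi> z \<partial>std_normal_distribution) = (\<integral>x. ?E x - (\<integral>z. \<phi> z \<partial>std_normal_distribution) \<partial>Q)"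
    by (subst Bochner_Integration.integral_diff)
       (auto intro!: Q.integrable_bounded[where B=1] P.abs_integral_le B simp: Q.prob_space)
  moreover have "\<bar>\<integral>x. ?E x - (\<integral>z. \<phi> z \<partial>std_normal_distribution) \<partial>Q\<bar> \<le> c * ((\<integral>x. \<bar>x\<bar>^3 \<partial>\<mu>) + 2) / 6"
  proof (rule Q.abs_integral_le)
    fix x
    have 3: "(\<Sum>i\<in>I. \<bar>c * e i x\<bar>^3) \<le> c"
    proof -
      have "(\<Sum>i\<in>I. \<bar>c * e i x\<bar>^3) \<le> (\<Sum>i\<in>I. c * (c * e i x)\<^sup>2)"
      proof (rule sum_mono)
        fix i
        have "\<bar>c * e i x\<bar> \<le> c" using c_pos e_le[of i x] by (simp add: abs_mult mult_left_le)
        then have "\<bar>c * e i x\<bar> * \<bar>c * e i x\<bar>\<^sup>2 \<le> c * \<bar>c * e i x\<bar>\<^sup>2" by (rule mult_right_mono) simp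
        then show "\<bar>c * e i x\<bar>^3 \<le> c * (c * e i x)\<^sup>2" by (simp add: power3_eq_cube power2_eq_square mult_ac)
      qed
      also have "\<dots> = c" by (simp add: sum_e_sq flip: sum_distrib_left)
      finally show ?thesis .
    qed
    have "\<bar>?E x - (\<integral>z. \<phi> z \<partial>std_normal_distribution)\<bar> \<le> (\<Sum>i\<in>I. \<bar>c * e i x\<bar>^3) * ((\<integral>x. \<bar>x\<bar>^3 \<partial>\<mu>) + 2) / 6"
      using lindeberg[OF \<phi> finite_I, of 0 "\<lambda>i. c * e i x"] by (simp add: f_def sum_e_sq)
    also have "\<dots> \<le> c * ((\<integral>x. \<bar>x\<bar>^3 \<partial>\<mu>) + 2) / 6"
      by (intro divide_right_mono mult_right_mono 3) auto
    finally show "\<bar>?E x - (\<integral>z. \<phi> z \<partial>std_normal_distribution)\<bar> \<le> c * ((\<integral>x. \<bar>x\<bar>^3 \<partial>\<mu>) + 2) / 6" .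
  qed measurable
  ultimately show ?thesis by simp
qed

theorem distance_le:
  assumes \<phi>: "\<phi> \<in> C3_test" and w: "w \<in> space P"
  shows "ennreal ((\<integral>x. \<phi> (f w x) \<partial>Q) - (\<integral>z. \<phi> z \<partial>std_normal_distribution)) \<le> 4 * T w + ennreal (c * ((\<integral>x. \<bar>x\<bar>^3 \<partial>\<mu>) + 2) / 6)"
proof -
  let ?m = "\<integral>p. \<phi> (f (fst p) (snd p)) \<partial>(P \<Otimes>\<^sub>M Q)"
  have "ennreal ((\<integral>x. \<phi> (f w x) \<partial>Q) - (\<integral>z. \<phi> z \<partial>std_normal_distribution)) \<le> ennreal (\<bar>(\<integral>x. \<phi> (f w x) \<partial>Q) - ?m\<bar> + \<bar>?m - (\<integral>z. \<phi> z \<partial>std_normal_distribution)\<bar>)"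
    by (rule ennreal_leI) linarith
  also have "\<dots> = ennreal \<bar>(\<integral>x. \<phi> (f w x) \<partial>Q) - ?m\<bar> + ennreal \<bar>?m - (\<integral>z. \<phi> z \<partial>std_normal_distribution)\<bar>"
    by (rule ennreal_plus) auto
  also have "\<dots> \<le> 4 * T w + ennreal (c * ((\<integral>x. \<bar>x\<bar>^3 \<partial>\<mu>) + 2) / 6)"
    by (intro add_mono fluctuation_le[OF \<phi> w] ennreal_leI bias_le[OF \<phi>])
  finally show ?thesis .
qed

end

section \<open>Random trigonometric polynomials\<close>

lemma sets_PX [measurable_cong, simp]: "sets PX = sets borel"
  by (simp add: PX_def)

lemma space_PX [simp]: "space PX = UNIV"
  by (simp add: PX_def)

lemma prob_space_PX: "prob_space PX"
  unfolding PX_def by (rule prob_space_uniform_measure) auto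

interpretation PX: prob_space PX
  by (rule prob_space_PX)

lemma PX_eq_density: "PX = density lborel (\<lambda>x. ennreal (indicator {0..2*pi} x / (2 * pi)))"
  unfolding PX_def uniform_measure_def
  by (intro density_cong) (auto simp: indicator_def divide_ennreal[symmetric] ennreal_1[symmetric] simp del: ennreal_1)

lemma integral_PX_FTC:
  fixes h :: "real \<Rightarrow> real"
  assumes "\<And>x. DERIV H x :> h x" "\<And>x. isCont h x"
  shows "(\<integral>x. h x \<partial>PX) = (H (2 * pi) - H 0) / (2 * pi)"
proof -
  have [measurable]: "h \<in> borel_measurable borel"
    using assms(2) by (intro borel_measurable_continuous_onI) (simp add: continuous_on_eq_continuous_at)
  have "(\<integral>x. h x \<partial>PX) = (\<integral>x. (h x * indicator {0..2*pi} x) / (2 * pi) \<partial>lborel)"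
    unfolding PX_eq_density by (subst integral_density) (auto simp: mult.commute)
  also have "\<dots> = (H (2 * pi) - H 0) / (2 * pi)"
    using integral_FTC_Icc_real[of 0 "2 * pi" H h] assms by simp
  finally show ?thesis .
qed

lemma integral_PX_cos: "(\<integral>x. cos (real_of_int m * x) \<partial>PX) = (if m = 0 then 1 else 0)"
proof (cases "m = 0")
  case False
  have "(\<integral>x. cos (real_of_int m * x) \<partial>PX) = (sin (real_of_int m * (2 * pi)) / real_of_int m - sin (real_of_int m * 0) / real_of_int m) / (2 * pi)"
    by (rule integral_PX_FTC) (use False in \<open>auto intro!: derivative_eq_intros continuous_intros simp: field_simps\<close>)
  also have "sin (real_of_int m * (2 * pi)) = 0"
    using sin_int_2pin[of m] by (simp add: mult_ac)
  finally show ?thesis using False by simp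
qed (use PX.prob_space in simp)

lemma integral_PX_sin: "(\<integral>x. sin (real_of_int m * x) \<partial>PX) = 0"
proof (cases "m = 0")
  case False
  have "(\<integral>x. sin (real_of_int m * x) \<partial>PX) = (- cos (real_of_int m * (2 * pi)) / real_of_int m - (- cos (real_of_int m * 0) / real_of_int m)) / (2 * pi)"
    by (rule integral_PX_FTC) (use False in \<open>auto intro!: derivative_eq_intros continuous_intros simp: field_simps\<close>)
  also have "cos (real_of_int m * (2 * pi)) = 1"
    using cos_int_2pin[of m] by (simp add: mult_ac)
  finally show ?thesis by simp
qed simp

definition trig :: "nat + nat \<Rightarrow> real \<Rightarrow> real" where
  "trig i x = (case i of Inl k \<Rightarrow> cos (real k * x) | Inr k \<Rightarrow> sin (real k * x))"

definition freqs :: "nat \<Rightarrow> (nat + nat) set" where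
  "freqs n = Inl ` {1..n} \<union> Inr ` {1..n}"

lemma finite_freqs [simp]: "finite (freqs n)"
  by (simp add: freqs_def)

lemma sum_freqs: "(\<Sum>i\<in>freqs n. h i) = (\<Sum>k=1..n. h (Inl k) + h (Inr k))"
  unfolding freqs_def by (subst sum.union_disjoint) (auto simp: sum.reindex sum.distrib)

lemma card_freqs: "card (freqs n) = 2 * n"
  unfolding freqs_def by (subst card_Un_disjoint) (auto simp: card_image)

lemma trig_measurable [measurable]: "trig i \<in> borel_measurable borel"
  unfolding trig_def by (cases i) auto

lemma abs_trig_le: "\<bar>trig i x\<bar> \<le> 1"
  by (cases i) (auto simp: trig_def)

text \<open>Product-to-sum formulas. Frequencies start at 1, so the sum of two of them is never 0
  and only the difference can contribute.\<close>

lemma integral_PX_trig_trig: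
  assumes "i \<in> freqs n" "j \<in> freqs n"
  shows "(\<integral>x. trig i x * trig j x \<partial>PX) = (if i = j then 1/2 else 0)"
proof -
  have int: "integrable PX (\<lambda>x. cos (real_of_int m * x))" "integrable PX (\<lambda>x. sin (real_of_int m * x))" for m
    by (rule PX.integrable_bounded[where B=1]; auto)+
  have cc: "(\<integral>x. cos (real_of_int m * x) * cos (real_of_int l * x) \<partial>PX) = ((if m = l then 1 else 0) + (if m + l = 0 then 1 else 0)) / 2" for m l
    using int[of "m - l"] int[of "m + l"] integral_PX_cos[of "m - l"] integral_PX_cos[of "m + l"]
    by (simp add: cos_times_cos left_diff_distrib distrib_right)
  have ss: "(\<integral>x. sin (real_of_int m * x) * sin (real_of_int l * x) \<partial>PX) = ((if m = l then 1 else 0) - (if m + l = 0 then 1 else 0)) / 2" for m l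
    using int[of "m - l"] int[of "m + l"] integral_PX_cos[of "m - l"] integral_PX_cos[of "m + l"]
    by (simp add: sin_times_sin left_diff_distrib distrib_right)
  have sc: "(\<integral>x. sin (real_of_int m * x) * cos (real_of_int l * x) \<partial>PX) = 0" for m l
    using int[of "m - l"] int[of "m + l"] integral_PX_sin[of "m - l"] integral_PX_sin[of "m + l"]
    by (simp add: sin_times_cos left_diff_distrib distrib_right)
  show ?thesis
  proof (cases i; cases j)
    fix k l assume "i = Inl k" "j = Inl l"
    then show ?thesis using assms cc[of "int k" "int l"] by (auto simp: freqs_def trig_def)
  next
    fix k l assume "i = Inr k" "j = Inr l"
    then show ?thesis using assms ss[of "int k" "int l"] by (auto simp: freqs_def trig_def)
  next
    fix k l assume "i = Inr k" "j = Inl l"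
    then show ?thesis using sc[of "int k" "int l"] by (simp add: trig_def)
  next
    fix k l assume "i = Inl k" "j = Inr l"
    then show ?thesis using sc[of "int l" "int k"] by (simp add: trig_def mult.commute)
  qed
qed

text \<open>Each function has squared norm 1/2, so the orthogonal projection of F onto their span is
  2 S and not S.\<close>

lemma bessel_trig:
  assumes [measurable]: "F \<in> borel_measurable PX" and B: "\<And>x. \<bar>F x\<bar> \<le> B"
  shows "(\<Sum>i\<in>freqs n. (\<integral>x. F x * trig i x \<partial>PX)\<^sup>2) \<le> (\<integral>x. (F x)\<^sup>2 \<partial>PX) / 2"
proof -
  define a where "a i = (\<integral>x. F x * trig i x \<partial>PX)" for i
  define S where "S x = (\<Sum>i\<in>freqs n. a i * trig i x)" for x
  have [measurable]: "trig i \<in> borel_measurable PX" for i by simp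
  have B0: "0 \<le> B" using B[of 0] by linarith
  have iF: "integrable PX (\<lambda>x. (F x)\<^sup>2)"
    by (rule PX.integrable_bounded[where B="B\<^sup>2"]) (use power_mono[OF B, of _ 2] in auto)
  have iFt: "integrable PX (\<lambda>x. F x * trig i x)" for i
    by (rule PX.integrable_bounded[where B="B * 1"]) (auto simp: abs_mult intro!: mult_mono[OF B abs_trig_le, simplified] B0)
  have itt: "integrable PX (\<lambda>x. trig i x * trig j x)" for i j
    by (rule PX.integrable_bounded[where B="1 * 1"]) (auto simp: abs_mult intro!: mult_mono[OF abs_trig_le abs_trig_le, simplified])
  have FS: "F x * S x = (\<Sum>i\<in>freqs n. a i * (F x * trig i x))" for x
    unfolding S_def sum_distrib_left by (intro sum.cong) auto
  have SS: "S x * S x = (\<Sum>i\<in>freqs n. \<Sum>j\<in>freqs n. a i * a j * (trig i x * trig j x))" for x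
    unfolding S_def sum_product by (intro sum.cong) auto
  have iFS: "integrable PX (\<lambda>x. F x * S x)" unfolding FS using iFt by auto
  have iSS: "integrable PX (\<lambda>x. S x * S x)" unfolding SS using itt by auto
  have eFS: "(\<integral>x. F x * S x \<partial>PX) = (\<Sum>i\<in>freqs n. (a i)\<^sup>2)"
    unfolding FS using iFt by (simp add: a_def power2_eq_square)
  have "(\<integral>x. S x * S x \<partial>PX) = (\<Sum>i\<in>freqs n. \<Sum>j\<in>freqs n. a i * a j * (\<integral>x. trig i x * trig j x \<partial>PX))"
    unfolding SS using itt by simp
  also have "\<dots> = (\<Sum>i\<in>freqs n. \<Sum>j\<in>freqs n. if i = j then (a i)\<^sup>2 / 2 else 0)"
    by (intro sum.cong refl) (simp add: integral_PX_trig_trig power2_eq_square)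
  also have "\<dots> = (\<Sum>i\<in>freqs n. (a i)\<^sup>2) / 2"
    by (simp add: sum_divide_distrib)
  finally have eSS: "(\<integral>x. S x * S x \<partial>PX) = (\<Sum>i\<in>freqs n. (a i)\<^sup>2) / 2" .
  \<comment> \<open>The squared distance from F to its projection.\<close>
  have "0 \<le> (\<integral>x. (F x - 2 * S x)\<^sup>2 \<partial>PX)" by simp
  also have "\<dots> = (\<integral>x. (F x)\<^sup>2 - 4 * (F x * S x) + 4 * (S x * S x) \<partial>PX)"
    by (intro Bochner_Integration.integral_cong) (auto simp: power2_eq_square algebra_simps)
  also have "\<dots> = (\<integral>x. (F x)\<^sup>2 \<partial>PX) - 4 * (\<Sum>i\<in>freqs n. (a i)\<^sup>2) + 4 * ((\<Sum>i\<in>freqs n. (a i)\<^sup>2) / 2)"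
    using iF iFS iSS eFS eSS by simp
  finally show ?thesis unfolding a_def by simp
qed

section \<open>Measurability of the distance and the final constant\<close>

lemma C3_test_Lipschitz:
  assumes "\<phi> \<in> C3_test" shows "\<bar>\<phi> s - \<phi> t\<bar> \<le> \<bar>s - t\<bar>"
  using field_differentiable_bound[of UNIV \<phi> "deriv \<phi>" 1 s t] C3_test_DERIV[OF assms, of 0] C3_test_bound[OF assms, of 1]
  by simp

lemma integral_PX_C3_test_bound: "\<phi> \<in> C3_test \<Longrightarrow> U \<in> borel_measurable borel \<Longrightarrow> \<bar>\<integral>x. \<phi> (U x) \<partial>PX\<bar> \<le> 1"
  using C3_test_measurable[of \<phi> 0] C3_test_bound[of \<phi> 0] by (intro PX.abs_integral_le) auto

lemma bdd_above_dC3X: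
  assumes "U \<in> borel_measurable borel" "V \<in> borel_measurable borel"
  shows "bdd_above ((\<lambda>\<phi>. (\<integral>x. \<phi> (U x) \<partial>PX) - (\<integral>x. \<phi> (V x) \<partial>PX)) ` C3_test)"
  by (rule bdd_aboveI2[where M=2]) (use integral_PX_C3_test_bound[OF _ assms(1)] integral_PX_C3_test_bound[OF _ assms(2)] in \<open>force simp: abs_le_iff\<close>)

text \<open>Test functions have derivative at most 1 in absolute value, so a uniform perturbation by
  d moves every expectation, and hence the supremum, by at most d.\<close>

lemma dC3X_le_add:
  assumes [measurable]: "U \<in> borel_measurable borel" "U' \<in> borel_measurable borel" "V \<in> borel_measurable borel"
    and d: "\<And>x. \<bar>U x - U' x\<bar> \<le> d"
  shows "dC3X U V \<le> dC3X U' V + d"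
  unfolding dC3X_def
proof (rule cSUP_least)
  show "C3_test \<noteq> {}" using zero_in_C3_test by auto
  fix \<phi> assume \<phi>: "\<phi> \<in> C3_test"
  have [measurable]: "\<phi> \<in> borel_measurable borel" using C3_test_measurable[OF \<phi>, of 0] by simp
  have i: "integrable PX (\<lambda>x. \<phi> (W x))" if [measurable]: "W \<in> borel_measurable borel" for W
    by (rule PX.integrable_bounded[where B=1]) (use C3_test_bound[OF \<phi>, of 0] in auto)
  have "(\<integral>x. \<phi> (U x) \<partial>PX) - (\<integral>x. \<phi> (U' x) \<partial>PX) = (\<integral>x. \<phi> (U x) - \<phi> (U' x) \<partial>PX)"
    by (rule Bochner_Integration.integral_diff[symmetric]; rule i) measurable
  also have "\<dots> \<le> d"
    using PX.abs_integral_le[of "\<lambda>x. \<phi> (U x) - \<phi> (U' x)" d] order.trans[OF C3_test_Lipschitz[OF \<phi>] d] by (auto simp: abs_le_iff)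
  finally have "(\<integral>x. \<phi> (U x) \<partial>PX) \<le> (\<integral>x. \<phi> (U' x) \<partial>PX) + d" by simp
  moreover have "(\<integral>x. \<phi> (U' x) \<partial>PX) - (\<integral>x. \<phi> (V x) \<partial>PX) \<le> (SUP \<phi>\<in>C3_test. (\<integral>x. \<phi> (U' x) \<partial>PX) - (\<integral>x. \<phi> (V x) \<partial>PX))"
    by (rule cSUP_upper[OF \<phi> bdd_above_dC3X]) auto
  ultimately show "(\<integral>x. \<phi> (U x) \<partial>PX) - (\<integral>x. \<phi> (V x) \<partial>PX) \<le> (SUP \<phi>\<in>C3_test. (\<integral>x. \<phi> (U' x) \<partial>PX) - (\<integral>x. \<phi> (V x) \<partial>PX)) + d"
    by linarith
qed

lemma fn_eq: "fn a b n w x = (\<Sum>i\<in>freqs n. (1 / sqrt (real n)) * trig i x * coeffs a b i w)"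
  unfolding fn_def sum_freqs sum_distrib_left by (intro sum.cong) (auto simp: trig_def coeffs_def algebra_simps add_divide_distrib)

text \<open>The supremum over the uncountable class of test functions is measurable because it is
  Lipschitz in the finitely many coefficients.\<close>

lemma dC3X_fn_measurable:
  assumes a: "\<And>k. k \<ge> 1 \<Longrightarrow> a k \<in> borel_measurable M" and b: "\<And>k. k \<ge> 1 \<Longrightarrow> b k \<in> borel_measurable M"
    and g: "g \<in> borel_measurable borel"
  shows "(\<lambda>w. dC3X (fn a b n w) g) \<in> borel_measurable M"
proof -
  define U where "U v x = (\<Sum>i\<in>freqs n. (1 / sqrt (real n)) * trig i x * v i)" for v :: "nat + nat \<Rightarrow> real" and x
  have U [measurable]: "U v \<in> borel_measurable borel" for v unfolding U_def by measurable
  define L where "L v v' = (\<Sum>i\<in>freqs n. \<bar>1 / sqrt (real n)\<bar> * \<bar>v i - v' i\<bar>)" for v v' :: "nat + nat \<Rightarrow> real"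
  have L: "\<bar>U v x - U v' x\<bar> \<le> L v v'" for v v' x
  proof -
    have "\<bar>U v x - U v' x\<bar> = \<bar>\<Sum>i\<in>freqs n. (1 / sqrt (real n)) * trig i x * (v i - v' i)\<bar>"
      unfolding U_def sum_subtractf[symmetric] by (intro arg_cong[where f=abs] sum.cong) (auto simp: right_diff_distrib)
    also have "\<dots> \<le> (\<Sum>i\<in>freqs n. \<bar>(1 / sqrt (real n)) * trig i x * (v i - v' i)\<bar>)" by (rule sum_abs)
    also have "\<dots> \<le> L v v'" unfolding L_def
    proof (rule sum_mono)
      fix i
      have "\<bar>1 / sqrt (real n)\<bar> * \<bar>trig i x\<bar> * \<bar>v i - v' i\<bar> \<le> \<bar>1 / sqrt (real n)\<bar> * 1 * \<bar>v i - v' i\<bar>"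
        by (intro mult_right_mono mult_left_mono abs_trig_le) auto
      then show "\<bar>(1 / sqrt (real n)) * trig i x * (v i - v' i)\<bar> \<le> \<bar>1 / sqrt (real n)\<bar> * \<bar>v i - v' i\<bar>"
        by (simp add: abs_mult)
    qed
    finally show ?thesis .
  qed
  have dd: "\<bar>dC3X (U v) g - dC3X (U v') g\<bar> \<le> L v v'" for v v'
    using dC3X_le_add[OF U U g L, of v v'] dC3X_le_add[OF U U g L, of v' v]
    by (simp add: abs_le_iff L_def abs_minus_commute)
  \<comment> \<open>Continuity is meant in the product topology on all coefficient families; it
    holds because \<open>L\<close> involves finitely many coordinates.\<close>
  have "continuous_on UNIV (\<lambda>v. dC3X (U v) g)"
    unfolding continuous_on_def
  proof (intro ballI)
    fix v :: "nat + nat \<Rightarrow> real"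
    have co: "((\<lambda>v'. v' i) \<longlongrightarrow> v i) (at v)" for i
      using continuous_on_product_coordinates[of i] by (auto simp: continuous_on_def)
    have "((\<lambda>v'. L v' v) \<longlongrightarrow> L v v) (at v)"
      unfolding L_def by (intro tendsto_intros co)
    then have "((\<lambda>v'. L v' v) \<longlongrightarrow> 0) (at v)" by (simp add: L_def)
    then have "((\<lambda>v'. dC3X (U v') g - dC3X (U v) g) \<longlongrightarrow> 0) (at v)"
      by (rule Lim_null_comparison[rotated]) (use dd in \<open>auto intro: always_eventually\<close>)
    then show "((\<lambda>v'. dC3X (U v') g) \<longlongrightarrow> dC3X (U v) g) (at v)"
      using LIM_zero_iff by blast
  qed
  then have c: "(\<lambda>v. dC3X (U v) g) \<in> borel_measurable borel"
    by (rule borel_measurable_continuous_onI)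
  \<comment> \<open>Measurability is known for indices from 1 on. Setting the coordinates outside
    \<open>freqs n\<close> to 0 gives a measurable family without changing the polynomial.\<close>
  have "(\<lambda>w i. if i \<in> freqs n then coeffs a b i w else 0) \<in> borel_measurable M"
  proof (rule measurable_coordinatewise_then_product)
    show "(\<lambda>w. if i \<in> freqs n then coeffs a b i w else 0) \<in> borel_measurable M" for i
      by (cases "i \<in> freqs n"; cases i) (use a b in \<open>auto simp: freqs_def coeffs_def\<close>)
  qed
  from measurable_compose[OF this c]
  have "(\<lambda>w. dC3X (U (\<lambda>i. if i \<in> freqs n then coeffs a b i w else 0)) g) \<in> borel_measurable M" .
  moreover have "U (\<lambda>i. if i \<in> freqs n then coeffs a b i w else 0) = fn a b n w" for w
    unfolding U_def by (auto simp: fn_eq fun_eq_iff intro!: sum.cong)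
  ultimately show ?thesis by simp
qed

lemma rand_sum_trig:
  assumes "std_law \<mu>" "n \<ge> 1"
  shows "rand_sum \<mu> PX (freqs n) trig (1 / sqrt (real n))"
proof -
  interpret std_law \<mu> by fact
  show ?thesis
  proof (unfold_locales)
    show "(\<Sum>i\<in>freqs n. (1 / sqrt (real n) * trig i x)\<^sup>2) = 1" for x
    proof -
      have "(\<Sum>i\<in>freqs n. (1 / sqrt (real n) * trig i x)\<^sup>2) = (\<Sum>k=1..n. 1 / real n)"
        unfolding sum_freqs
        by (intro sum.cong refl) (simp add: trig_def power_divide add_divide_distrib[symmetric])
      then show ?thesis using assms(2) by simp
    qed
    show "real (card (freqs n)) * (1 / sqrt (real n))\<^sup>2 = 2"
      using assms(2) by (simp add: card_freqs power_divide)
    show "(\<Sum>i\<in>freqs n. (\<integral>x. F x * trig i x \<partial>PX)\<^sup>2) \<le> (\<integral>x. (F x)\<^sup>2 \<partial>PX) / 2"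
      if "F \<in> borel_measurable PX" "\<And>x. \<bar>F x\<bar> \<le> B" for F B
      using bessel_trig[OF that] .
  qed (use assms(2) abs_trig_le PX.emeasure_space_1 in auto)
qed

text \<open>Here r is the square root of the fourth moment. Its coefficient is the delicate one: pi
  < 4 gives 4 and the quotient gives 34/9, together just below 8.\<close>

lemma constant_bound:
  fixes r m1 m3 s :: real
  assumes "0 \<le> r" "0 \<le> m1" "0 \<le> m3" "0 \<le> s"
  shows "2 * ((3 + r / 2) * pi + (123/4 + 17/18 * r\<^sup>2) / (3 + r / 2)) + (m3 + 2) / 6
    \<le> 81 * sqrt (13 + s) + 8 * r + sqrt 2 + 8 * m3 + 24 * m1"
proof -
  have "(3 + r / 2) * pi \<le> (3 + r / 2) * 4"
    using assms(1) pi_less_4 by (intro mult_left_mono) auto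
  then have 1: "2 * ((3 + r / 2) * pi) \<le> 24 + 4 * r" by simp
  \<comment> \<open>The linear factor matches the constant and the quadratic coefficient exactly;
    the surplus is a nonnegative multiple of r.\<close>
  have "123/4 + 17/18 * r\<^sup>2 \<le> (41/4 + 17/9 * r) * (3 + r / 2)"
  proof -
    have "(41/4 + 17/9 * r) * (3 + r / 2) = 123/4 + 17/18 * r\<^sup>2 + (41/8 + 17/3) * r"
      by (simp add: field_simps power2_eq_square)
    then show ?thesis using assms(1) by simp
  qed
  then have "(123/4 + 17/18 * r\<^sup>2) / (3 + r / 2) \<le> 41/4 + 17/9 * r"
    using assms(1) by (simp add: pos_divide_le_eq)
  then have 2: "2 * ((123/4 + 17/18 * r\<^sup>2) / (3 + r / 2)) \<le> 21 + 4 * r"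
    using assms(1) by linarith
  have 3: "(m3 + 2) / 6 \<le> 8 * m3 + 1" using assms(3) by simp
  \<comment> \<open>All absolute constants, 24 + 21 + 1 = 46, are absorbed here.\<close>
  have "3 \<le> sqrt (13 + s)"
    using assms(4) by (intro real_le_rsqrt) auto
  then have 4: "46 \<le> 81 * sqrt (13 + s)" by simp
  have "2 * ((3 + r / 2) * pi + (123/4 + 17/18 * r\<^sup>2) / (3 + r / 2)) + (m3 + 2) / 6 \<le> (24 + 4 * r) + (21 + 4 * r) + (8 * m3 + 1)"
    unfolding distrib_left[of 2] by (intro add_mono 1 2 3)
  also have "\<dots> = 46 + (8 * r + 8 * m3)" by simp
  also have "\<dots> \<le> 81 * sqrt (13 + s) + (8 * r + sqrt 2 + 8 * m3 + 24 * m1)"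
    by (rule add_mono[OF 4]) (use assms in simp)
  finally show ?thesis by (simp add: add.assoc)
qed

theorem theorem2:
  fixes M :: "'w measure" and a b :: "nat \<Rightarrow> 'w \<Rightarrow> real" and g :: "real \<Rightarrow> real" and n :: nat
  assumes "prob_space M"
    and "\<And>k. k \<ge> 1 \<Longrightarrow> a k \<in> borel_measurable M"
    and "\<And>k. k \<ge> 1 \<Longrightarrow> b k \<in> borel_measurable M"
    and "prob_space.indep_vars M (\<lambda>_. borel) (coeffs a b) (Inl ` {1..} \<union> Inr ` {1..})"
    and "\<And>k. k \<ge> 1 \<Longrightarrow> distr M borel (a k) = distr M borel (a 1)"
    and "\<And>k. k \<ge> 1 \<Longrightarrow> distr M borel (b k) = distr M borel (a 1)"
    and "integrable M (\<lambda>w. a 1 w ^ 4)"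
    and "(\<integral>w. a 1 w \<partial>M) = 0"
    and "(\<integral>w. a 1 w ^ 2 \<partial>M) = 1"
    and "g \<in> borel_measurable borel"
    and "distr PX borel g = density lborel std_normal_density"
    and "n \<ge> 1"
  shows "(\<lambda>w. dC3X (fn a b n w) g) \<in> borel_measurable M
       \<and> (\<integral>\<^sup>+ w. ennreal (dC3X (fn a b n w) g) \<partial>M)
           \<le> ennreal ((81 * sqrt (13 + \<bar>\<integral>w. a 1 w ^ 3 \<partial>M\<bar>) + 8 * sqrt (\<integral>w. a 1 w ^ 4 \<partial>M)
                       + sqrt 2 + 8 * (\<integral>w. \<bar>a 1 w\<bar> ^ 3 \<partial>M) + 24 * (\<integral>w. \<bar>a 1 w\<bar> \<partial>M)) / sqrt (real n))"
proof
  show "(\<lambda>w. dC3X (fn a b n w) g) \<in> borel_measurable M"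
    by (rule dC3X_fn_measurable) fact+
next
  interpret M: prob_space M by fact
  define \<mu> where "\<mu> = distr M borel (a 1)"
  define c where "c = 1 / sqrt (real n)"
  have a1 [measurable]: "a 1 \<in> borel_measurable M" by (rule assms(2)) simp
  note a1 [unfolded One_nat_def, measurable]
  have law: "std_law \<mu>"
  proof (unfold std_law_def, intro conjI)
    show "prob_space \<mu>" unfolding \<mu>_def by (rule M.prob_space_distr) measurable
    show "integrable \<mu> (\<lambda>x. x ^ 4)" unfolding \<mu>_def using assms(7) by (subst integrable_distr_eq) auto
    show "(\<integral>x. x \<partial>\<mu>) = 0" unfolding \<mu>_def using assms(8) by (subst integral_distr) auto
    show "(\<integral>x. x\<^sup>2 \<partial>\<mu>) = 1" unfolding \<mu>_def using assms(9) by (subst integral_distr) auto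
  qed (simp add: \<mu>_def)
  have m4: "(\<integral>x. x ^ 4 \<partial>\<mu>) = (\<integral>w. a 1 w ^ 4 \<partial>M)" and m3: "(\<integral>x. \<bar>x\<bar> ^ 3 \<partial>\<mu>) = (\<integral>w. \<bar>a 1 w\<bar> ^ 3 \<partial>M)"
    unfolding \<mu>_def by (subst integral_distr; simp)+
  interpret R: rand_sum \<mu> PX "freqs n" trig c
    unfolding c_def by (rule rand_sum_trig[OF law assms(12)])
  have rv: "coeffs a b i \<in> borel_measurable M" and distr_eq: "distr M borel (coeffs a b i) = \<mu>" if "i \<in> freqs n" for i
    using that by (auto simp: freqs_def coeffs_def \<mu>_def intro: assms(2,3,5,6)[unfolded One_nat_def])
  \<comment> \<open>Restricting to the finitely many frequencies in use carries the problem from the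
    given space to the product of the common law, where the fluctuation estimates live.\<close>
  define cf where "cf w = (\<lambda>i\<in>freqs n. coeffs a b i w)" for w
  have cf [measurable]: "cf \<in> measurable M (PiM (freqs n) (\<lambda>_. \<mu>))"
    unfolding cf_def by (rule measurable_restrict) (use rv in \<open>simp add: \<mu>_def\<close>)
  have P: "distr M (PiM (freqs n) (\<lambda>_. \<mu>)) cf = PiM (freqs n) (\<lambda>_. \<mu>)"
  proof -
    have "M.indep_vars (\<lambda>_. borel) (coeffs a b) (freqs n)"
      by (rule M.indep_vars_subset[OF assms(4)]) (auto simp: freqs_def)
    moreover have "freqs n \<noteq> {}" using assms(12) by (auto simp: freqs_def)
    ultimately have "distr M (\<Pi>\<^sub>M i\<in>freqs n. borel) cf = (\<Pi>\<^sub>M i\<in>freqs n. distr M borel (coeffs a b i))"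
      unfolding cf_def using M.indep_vars_iff_distr_eq_PiM'[where I="freqs n" and M'="\<lambda>_. borel" and X="coeffs a b"] rv by auto
    also have "\<dots> = PiM (freqs n) (\<lambda>_. \<mu>)"
      by (intro PiM_cong refl) (simp add: distr_eq)
    also have "distr M (\<Pi>\<^sub>M i\<in>freqs n. borel) cf = distr M (PiM (freqs n) (\<lambda>_. \<mu>)) cf"
      by (intro distr_cong refl sets_PiM_cong) (simp add: \<mu>_def)
    finally show ?thesis .
  qed
  have fn: "fn a b n w = R.f (cf w)" for w
  proof (rule ext)
    fix x
    have "fn a b n w x = (\<Sum>i\<in>freqs n. c * trig i x * coeffs a b i w)" by (simp only: fn_eq c_def)
    also have "\<dots> = R.f (cf w) x" unfolding R.f_def cf_def by (intro sum.cong) auto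
    finally show "fn a b n w x = R.f (cf w) x" .
  qed
  \<comment> \<open>A rounded minimiser of \<open>\<gamma>\<close> pi + K/\<open>\<gamma>\<close>.
    The exact one is sqrt (K/pi) with K = 123/4 + 17/18 m4, where m4 is the fourth moment; sqrt
    (123/(4 pi)) is about 3.13 and sqrt (17/(18 pi)) about 0.55.\<close>
  define \<gamma> where "\<gamma> = 3 + sqrt (\<integral>w. a 1 w ^ 4 \<partial>M) / 2"
  have \<gamma>: "0 < \<gamma>" unfolding \<gamma>_def by (intro add_pos_nonneg) auto
  let ?b = "c * ((\<integral>w. \<bar>a 1 w\<bar> ^ 3 \<partial>M) + 2) / 6"
  have c: "0 < c" by (rule R.c_pos)
  have b: "0 \<le> ?b" using c by (intro divide_nonneg_nonneg mult_nonneg_nonneg add_nonneg_nonneg) auto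
  \<comment> \<open>The bound does not mention \<open>\<phi>\<close>, so the supremum is at most the
    bound for each single test function. The supremum is a real number, whence the case distinction:
    an infinite bound is trivial, a finite one is a real upper bound.\<close>
  have dist: "ennreal (dC3X (fn a b n w) g) \<le> 4 * R.T (cf w) + ennreal ?b" if w: "w \<in> space M" for w
  proof (cases "4 * R.T (cf w) + ennreal ?b" rule: ennreal_cases)
    case (real r)
    have "dC3X (fn a b n w) g \<le> r"
      unfolding dC3X_def
    proof (rule cSUP_least)
      show "C3_test \<noteq> {}" using zero_in_C3_test by auto
      fix \<phi> assume \<phi>: "\<phi> \<in> C3_test"
      have [measurable]: "\<phi> \<in> borel_measurable borel" using C3_test_measurable[OF \<phi>, of 0] by simp
      \<comment> \<open>Only the law of \<open>g\<close> matters, and that is standard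
        normal.\<close>
      have "(\<integral>x. \<phi> (g x) \<partial>PX) = (\<integral>z. \<phi> z \<partial>distr PX borel g)"
        using assms(10) by (subst integral_distr) auto
      then have g: "(\<integral>x. \<phi> (g x) \<partial>PX) = (\<integral>z. \<phi> z \<partial>std_normal_distribution)" unfolding assms(11) .
      have "ennreal ((\<integral>x. \<phi> (fn a b n w x) \<partial>PX) - (\<integral>x. \<phi> (g x) \<partial>PX)) \<le> ennreal r"
        unfolding real(2)[symmetric] g fn m3[symmetric]
        by (rule R.distance_le[OF \<phi> measurable_space[OF cf w]])
      then show "(\<integral>x. \<phi> (fn a b n w x) \<partial>PX) - (\<integral>x. \<phi> (g x) \<partial>PX) \<le> r"
        using real(1) by simp
    qed
    then show ?thesis unfolding real(2) by (rule ennreal_leI)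
  qed simp
  have "(\<integral>\<^sup>+w. ennreal (dC3X (fn a b n w) g) \<partial>M) \<le> (\<integral>\<^sup>+w. 4 * R.T (cf w) + ennreal ?b \<partial>M)"
    by (intro nn_integral_mono dist)
  also have "\<dots> = 4 * (\<integral>\<^sup>+w. R.T (cf w) \<partial>M) + ennreal ?b"
    by (subst nn_integral_add) (auto simp: nn_integral_cmult M.emeasure_space_1)
  also have "(\<integral>\<^sup>+w. R.T (cf w) \<partial>M) = (\<integral>\<^sup>+v. R.T v \<partial>distr M (PiM (freqs n) (\<lambda>_. \<mu>)) cf)"
    by (rule nn_integral_distr[symmetric]) measurable
  also have "\<dots> = (\<integral>\<^sup>+v. R.T v \<partial>PiM (freqs n) (\<lambda>_. \<mu>))" unfolding P ..
  also have "4 * \<dots> + ennreal ?b \<le> 4 * ennreal (c * (\<gamma> * pi + R.K / \<gamma>) / 2) + ennreal ?b"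
    by (intro add_mono mult_left_mono R.nn_integral_T_le[OF \<gamma>]) auto
  also have "\<dots> = ennreal (4 * (c * (\<gamma> * pi + R.K / \<gamma>) / 2) + ?b)"
  proof -
    have "0 \<le> c * (\<gamma> * pi + R.K / \<gamma>) / 2"
      using c \<gamma> R.K_pos by (intro divide_nonneg_nonneg mult_nonneg_nonneg add_nonneg_nonneg) auto
    then show ?thesis using b by (simp only: ennreal_plus ennreal_mult ennreal_numeral zero_le_numeral mult_nonneg_nonneg)
  qed
  also have "\<dots> \<le> ennreal ((81 * sqrt (13 + \<bar>\<integral>w. a 1 w ^ 3 \<partial>M\<bar>) + 8 * sqrt (\<integral>w. a 1 w ^ 4 \<partial>M)
                       + sqrt 2 + 8 * (\<integral>w. \<bar>a 1 w\<bar> ^ 3 \<partial>M) + 24 * (\<integral>w. \<bar>a 1 w\<bar> \<partial>M)) / sqrt (real n))"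
  proof (rule ennreal_leI)
    let ?r = "sqrt (\<integral>w. a 1 w ^ 4 \<partial>M)"
    have r2: "?r\<^sup>2 = (\<integral>x. x ^ 4 \<partial>\<mu>)" unfolding m4 by simp
    have "4 * (c * (\<gamma> * pi + R.K / \<gamma>) / 2) + ?b =
        c * (2 * ((3 + ?r / 2) * pi + (123/4 + 17/18 * ?r\<^sup>2) / (3 + ?r / 2)) + ((\<integral>w. \<bar>a 1 w\<bar> ^ 3 \<partial>M) + 2) / 6)"
      unfolding R.K_def \<gamma>_def[symmetric] r2 by (simp add: distrib_left)
    also have "\<dots> \<le> c * (81 * sqrt (13 + \<bar>\<integral>w. a 1 w ^ 3 \<partial>M\<bar>) + 8 * ?r
                       + sqrt 2 + 8 * (\<integral>w. \<bar>a 1 w\<bar> ^ 3 \<partial>M) + 24 * (\<integral>w. \<bar>a 1 w\<bar> \<partial>M))"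
      using c by (intro mult_left_mono constant_bound) auto
    finally show "4 * (c * (\<gamma> * pi + R.K / \<gamma>) / 2) + ?b \<le> (81 * sqrt (13 + \<bar>\<integral>w. a 1 w ^ 3 \<partial>M\<bar>) + 8 * ?r
                       + sqrt 2 + 8 * (\<integral>w. \<bar>a 1 w\<bar> ^ 3 \<partial>M) + 24 * (\<integral>w. \<bar>a 1 w\<bar> \<partial>M)) / sqrt (real n)"
      by (simp add: c_def)
  qed
  finally show "(\<integral>\<^sup>+ w. ennreal (dC3X (fn a b n w) g) \<partial>M)
           \<le> ennreal ((81 * sqrt (13 + \<bar>\<integral>w. a 1 w ^ 3 \<partial>M\<bar>) + 8 * sqrt (\<integral>w. a 1 w ^ 4 \<partial>M)
                       + sqrt 2 + 8 * (\<integral>w. \<bar>a 1 w\<bar> ^ 3 \<partial>M) + 24 * (\<integral>w. \<bar>a 1 w\<bar> \<partial>M)) / sqrt (real n))" .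
qed

end
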